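(* Let $\hat R,R_1,T_0>0$, let $R>\hat R+R_1$, and set $T:=T_0+R+\hat R+R_1$. Let $\Gamma_R=\{\boldsymbol x\in\mathbb R^3:|\boldsymbol x|=R\}$ with unit normal vector $\boldsymbol\nu$. For $\boldsymbol x=(x_1,x_2,x_3)$ write $\tilde{\boldsymbol x}=(x_1,x_2,0)$ and identify $\mathbb R^2$ with $\{\boldsymbol x\in\mathbb R^3:x_3=0\}$. Let $\boldsymbol J(\tilde{\boldsymbol x})=(J_1(\tilde{\boldsymbol x}),J_2(\tilde{\boldsymbol x}),0)$ be a given real-valued function in $H^2(\mathbb R^2)^3$ with $\mathrm{supp}(\boldsymbol J)\subset\{\tilde{\boldsymbol x}\in\mathbb R^2:|\tilde{\boldsymbol x}|<\tfrac{\sqrt2}{2}\hat R\}$ and $\nabla_{\tilde{\boldsymbol x}}\cdot\boldsymbol J=\partial_{x_1}J_1+\partial_{x_2}J_2=0$, and such that $\boldsymbol J\in\mathcal A$, i.e. for $i=1$ or $i=2$ one has $J_i(0)>J_i(\tilde{\boldsymbol x})$ for all $\tilde{\boldsymbol x}\ne0$. Let $h\in H^2(\mathbb R)$ be a given real-valued function, not identically zero, with $\mathrm{supp}(h)\subset(-\tfrac{\sqrt2}{2}\hat R,\tfrac{\sqrt2}{2}\hat R)$. Let $g\in C^1(\mathbb R_+;\mathbb R)$ be given with $g(t)=0$ for $t\ge T_0$ and for $t\le0$, and with $\mathrm{supp}(g)=[0,T_0]$. Then the planar orbit function is uniquely determined on $[0,T_0]$ by the data $\{\boldsymbol E(\boldsymbol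 x,t)\times\boldsymbol\nu:\boldsymbol x\in\Gamma_R,\ t\in(0,T)\}$. That is: let $\tilde{\boldsymbol a},\tilde{\boldsymbol b}\in C^1([0,T_0];\mathbb R^2)$ satisfy $|\tilde{\boldsymbol a}(t)|\le R_1$ and $|\tilde{\boldsymbol b}(t)|\le R_1$ for all $t\in[0,T_0]$, and let $\boldsymbol E_1,\boldsymbol E_2$ be the solutions of $$\partial_t^2\boldsymbol E_i(\boldsymbol x,t)+\nabla\times(\nabla\times\boldsymbol E_i(\boldsymbol x,t))=\boldsymbol F_i(\boldsymbol x,t),\quad\boldsymbol x\in\mathbb R^3,\ t>0,\qquad\boldsymbol E_i(\boldsymbol x,0)=\partial_t\boldsymbol E_i(\boldsymbol x,0)=0,\quad\boldsymbol x\in\mathbb R^3,$$ with $\boldsymbol F_1(\boldsymbol x,t)=\boldsymbol J(\tilde{\boldsymbol x}-\tilde{\boldsymbol a}(t))\,h(x_3)\,g(t)$ and $\boldsymbol F_2(\boldsymbol x,t)=\boldsymbol J(\tilde{\boldsymbol x}-\tilde{\boldsymbol b}(t))\,h(x_3)\,g(t)$ (both understood as $0$ for $t\ge T_0$). If $\boldsymbol E_1(\boldsymbol x,t)\times\boldsymbol\nu=\boldsymbol E_2(\boldsymbol x,t)\times\boldsymbol\nu$ for all $\boldsymbol x\in\Gamma_R$ and $t\in(0,T)$, then $\tilde{\boldsymbol a}(t)=\tilde{\boldsymbol b}(t)$ for all $t\in[0,T_0]$.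
   Context: $\mathbb R_+$ denotes the nonnegative time half-line. Functions in $H^2(\mathbb R^2)$ are identified with their continuous representatives, so that point values of $J_i$ make sense. For sources as in the claim (which are divergence free in $\mathbb R^3$), "the solution" of the initial value problem for the Maxwell system means the unique solution with $\boldsymbol E\in C([0,\tau];H^2(\mathbb R^3))^3\cap C^2([0,\tau];L^2(\mathbb R^3))^3$ for every $\tau>0$; it satisfies $\nabla\cdot\boldsymbol E=0$ and the componentwise wave equation $\partial_t^2\boldsymbol E-\Delta\boldsymbol E=\boldsymbol F$ with zero initial data. *)

theory Defs
  imports "HOL-Analysis.Analysis"
begin

section \<open>Classical differentiability and supports\<close>

definition fsupp :: "('a::topological_space \<Rightarrow> 'b::zero) \<Rightarrow> 'a set" where
  "fsupp f = closure {x. f x \<noteq> 0}"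

text \<open>Unlike the library's \<open>C1_differentiable_on\<close>, the derivative is taken within \<open>S\<close>,
  so that it is one-sided at the endpoints of an interval.\<close>

definition C1_within :: "real set \<Rightarrow> (real \<Rightarrow> 'b::real_normed_vector) \<Rightarrow> bool" where
  "C1_within S f \<longleftrightarrow>
     (\<exists>f'. (\<forall>t\<in>S. (f has_vector_derivative f' t) (at t within S)) \<and> continuous_on S f')"

definition partial :: "'a \<Rightarrow> ('a::euclidean_space \<Rightarrow> real) \<Rightarrow> 'a \<Rightarrow> real" where
  "partial b f = (\<lambda>x. frechet_derivative f (at x) b)"

primrec Ck :: "nat \<Rightarrow> ('a::euclidean_space \<Rightarrow> real) \<Rightarrow> bool" where
  "Ck 0 f \<longleftrightarrow> continuous_on UNIV f"
| "Ck (Suc k) f \<longleftrightarrow> f differentiable_on UNIV \<and> (\<forall>b\<in>Basis. Ck k (partial b f))"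

definition test_function :: "('a::euclidean_space \<Rightarrow> real) \<Rightarrow> bool" where
  "test_function \<phi> \<longleftrightarrow> (\<forall>k. Ck k \<phi>) \<and> compact (fsupp \<phi>)"


section \<open>Weak derivatives and Sobolev spaces\<close>

text \<open>Elements of Lebesgue and Sobolev spaces are represented by Borel measurable functions;
  every almost-everywhere class has such a representative.\<close>

definition locally_integrable :: "('a::euclidean_space \<Rightarrow> real) \<Rightarrow> bool" where
  "locally_integrable f \<longleftrightarrow>
     f \<in> borel_measurable borel \<and> (\<forall>K. compact K \<longrightarrow> set_integrable lborel K f)"

definition has_weak_partial ::
    "'a \<Rightarrow> ('a::euclidean_space \<Rightarrow> real) \<Rightarrow> ('a \<Rightarrow> real) \<Rightarrow> bool" where
  "has_weak_partial b f g \<longleftrightarrow> locally_integrable f \<and> locally_integrable g \<and>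
     (\<forall>\<phi>. test_function \<phi> \<longrightarrow>
        (LINT x|lborel. f x * partial b \<phi> x) = - (LINT x|lborel. g x * \<phi> x))"

text \<open>A weak derivative is unique up to a null set, so the choice below is immaterial in
  norms and in almost-everywhere identities. It is unspecified if there is none.\<close>

definition weak_partial :: "'a \<Rightarrow> ('a::euclidean_space \<Rightarrow> real) \<Rightarrow> 'a \<Rightarrow> real" where
  "weak_partial b f = (SOME g. has_weak_partial b f g)"

definition L2 :: "('a::euclidean_space \<Rightarrow> real) \<Rightarrow> bool" where
  "L2 f \<longleftrightarrow> f \<in> borel_measurable borel \<and> integrable lborel (\<lambda>x. (f x)\<^sup>2)"

definition L2_norm :: "('a::euclidean_space \<Rightarrow> real) \<Rightarrow> real" where
  "L2_norm f = sqrt (LINT x|lborel. (f x)\<^sup>2)"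

primrec Hk :: "nat \<Rightarrow> ('a::euclidean_space \<Rightarrow> real) \<Rightarrow> bool" where
  "Hk 0 f \<longleftrightarrow> L2 f"
| "Hk (Suc k) f \<longleftrightarrow> L2 f \<and>
     (\<forall>b\<in>Basis. (\<exists>g. has_weak_partial b f g) \<and> Hk k (weak_partial b f))"

text \<open>For \<open>k = 2\<close> this is \<open>\<parallel>f\<parallel>\<^sup>2 + \<parallel>\<nabla>f\<parallel>\<^sup>2 + \<parallel>D\<^sup>2 f\<parallel>\<^sup>2\<close> with \<open>D\<^sup>2 f\<close> the full Hessian.\<close>

primrec Hk_norm_sq :: "nat \<Rightarrow> ('a::euclidean_space \<Rightarrow> real) \<Rightarrow> real" where
  "Hk_norm_sq 0 f = (L2_norm f)\<^sup>2"
| "Hk_norm_sq (Suc k) f = (L2_norm f)\<^sup>2 + (\<Sum>b\<in>Basis. Hk_norm_sq k (weak_partial b f))"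

definition Hk_norm :: "nat \<Rightarrow> ('a::euclidean_space \<Rightarrow> real) \<Rightarrow> real" where
  "Hk_norm k f = sqrt (Hk_norm_sq k f)"


section \<open>Functions of time with values in \<open>L\<^sup>2\<close> and \<open>H\<^sup>k\<close>\<close>

definition continuous_in_Hk ::
    "nat \<Rightarrow> real set \<Rightarrow> (real \<Rightarrow> 'a::euclidean_space \<Rightarrow> real) \<Rightarrow> bool" where
  "continuous_in_Hk k S u \<longleftrightarrow> (\<forall>t\<in>S. Hk k (u t) \<and>
     ((\<lambda>s. Hk_norm k (\<lambda>x. u s x - u t x)) \<longlongrightarrow> 0) (at t within S))"

definition has_time_derivative_L2 ::
    "real set \<Rightarrow> (real \<Rightarrow> 'a::euclidean_space \<Rightarrow> real) \<Rightarrow> (real \<Rightarrow> 'a \<Rightarrow> real) \<Rightarrow> bool" where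
  "has_time_derivative_L2 S u u' \<longleftrightarrow> (\<forall>t\<in>S. L2 (u t) \<and> L2 (u' t) \<and>
     ((\<lambda>s. L2_norm (\<lambda>x. (u s x - u t x) / (s - t) - u' t x)) \<longlongrightarrow> 0) (at t within S))"

text \<open>\<open>u \<in> C\<^sup>2(S; L\<^sup>2)\<close> with first and second time derivatives \<open>u'\<close> and \<open>u''\<close>; recall that
  \<open>Hk 0\<close> is \<open>L\<^sup>2\<close>, and that \<open>u\<close> and \<open>u'\<close> are continuous because they are differentiable.\<close>

definition C2_in_L2 ::
    "real set \<Rightarrow> (real \<Rightarrow> 'a::euclidean_space \<Rightarrow> real) \<Rightarrow>
     (real \<Rightarrow> 'a \<Rightarrow> real) \<Rightarrow> (real \<Rightarrow> 'a \<Rightarrow> real) \<Rightarrow> bool" where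
  "C2_in_L2 S u u' u'' \<longleftrightarrow>
     has_time_derivative_L2 S u u' \<and> has_time_derivative_L2 S u' u'' \<and> continuous_in_Hk 0 S u''"


section \<open>The Maxwell system\<close>

definition div2 :: "(real^2 \<Rightarrow> real^3) \<Rightarrow> real^2 \<Rightarrow> real" where
  "div2 J = (\<lambda>y. weak_partial (axis 1 1) (\<lambda>y. J y $ 1) y + weak_partial (axis 2 1) (\<lambda>y. J y $ 2) y)"

definition curl :: "(real^3 \<Rightarrow> real^3) \<Rightarrow> real^3 \<Rightarrow> real^3" where
  "curl u = (\<lambda>x. let D = (\<lambda>i j. weak_partial (axis i 1) (\<lambda>y. u y $ j) x)
     in vector [D 2 3 - D 3 2, D 3 1 - D 1 3, D 1 2 - D 2 1])"

text \<open>Time comes first: \<open>E t x\<close> is the field at the point \<open>x\<close> and the time \<open>t\<close>. Each \<open>E t\<close> is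
  the continuous representative of its class, so that its values on a sphere make sense.
  The derivatives \<open>E'\<close> and \<open>E''\<close> in \<open>L\<^sup>2\<close> are determined by \<open>E\<close> up to null sets.\<close>

definition maxwell_solution ::
    "(real \<Rightarrow> real^3 \<Rightarrow> real^3) \<Rightarrow> (real \<Rightarrow> real^3 \<Rightarrow> real^3) \<Rightarrow> bool" where
  "maxwell_solution F E \<longleftrightarrow>
     (\<forall>t\<ge>0. continuous_on UNIV (E t)) \<and>
     (\<exists>E' E''.
        (\<forall>\<tau>>0. \<forall>i. continuous_in_Hk 2 {0..\<tau>} (\<lambda>t x. E t x $ i) \<and>
           C2_in_L2 {0..\<tau>} (\<lambda>t x. E t x $ i) (\<lambda>t x. E' t x $ i) (\<lambda>t x. E'' t x $ i)) \<and>
        (\<forall>t>0. AE x in lborel. E'' t x + curl (curl (E t)) x = F t x) \<and>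
        (\<forall>x. E 0 x = 0) \<and>
        (AE x in lborel. E' 0 x = 0))"

definition planar :: "real^3 \<Rightarrow> real^2" where
  "planar x = vector [x $ 1, x $ 2]"

definition moving_source ::
    "(real^2 \<Rightarrow> real^3) \<Rightarrow> (real \<Rightarrow> real) \<Rightarrow> (real \<Rightarrow> real) \<Rightarrow> (real \<Rightarrow> real^2) \<Rightarrow>
     real \<Rightarrow> real^3 \<Rightarrow> real^3" where
  "moving_source J h g a t x = (h (x $ 3) * g t) *\<^sub>R J (planar x - a t)"

text \<open>Membership in the set \<open>\<A>\<close>: some component among the first two has its strict global
  maximum at the origin.\<close>

definition class_A :: "(real^2 \<Rightarrow> real^3) \<Rightarrow> bool" where
  "class_A J \<longleftrightarrow> (\<exists>i\<in>{1, 2}. \<forall>y. y \<noteq> 0 \<longrightarrow> J 0 $ i > J y $ i)"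

end

theory Submission
  imports Defs
begin

text \<open>Let \<open>u = E\<^sub>1 - E\<^sub>2\<close>. Outside the sphere the source vanishes and \<open>u\<close> has zero tangential trace, so
  by conservation of energy \<open>u\<close> vanishes there up to time \<open>T\<close>. Now test the equation in the ball against
  \<open>k (t + x \<bullet> d) p\<close> with a unit vector \<open>d\<close>, a polarization \<open>p\<close> orthogonal to \<open>d\<close>, and a profile \<open>k\<close>
  that vanishes beyond \<open>T - R\<close>: this wave solves the homogeneous Maxwell system, and at time \<open>T\<close> it has left the
  ball, so the difference of the sources is orthogonal to it.

  Before \<open>T - R\<close> the profile may be taken to be a real exponential, \<open>k s = exp (l * s)\<close>. With
  \<open>l d = (v, c)\<close> and \<open>p = (- v\<^sub>2, v\<^sub>1, 0)\<close> the pairing factorizes into the Laplace transform of \<open>h\<close> at \<open>c\<close>,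
  that of \<open>J \<bullet> p\<close> at \<open>v\<close>, and \<open>\<integral> g t (exp (v \<bullet> a t) - exp (v \<bullet> b t)) exp (l t) dt\<close>. The first is
  nonzero for \<open>c\<close> in some interval. If \<open>a t \<noteq> b t\<close> and \<open>g t \<noteq> 0\<close> for some \<open>t\<close>, then for
  \<open>v\<close> not orthogonal to \<open>a t - b t\<close> the third is nonzero for some \<open>l\<close>, so the second vanishes; as \<open>J\<close> is
  divergence free, its whole Laplace transform vanishes, hence \<open>J = 0\<close>, contradicting the strict maximum.\<close>

subsection \<open>Smooth functions\<close>

text \<open>Only the tangential trace of the field is observed. Uniqueness outside the sphere
  replaces the unknown trace of its curl: the field and its curl both vanish there, so a cut-off
  plane wave can be tested against the equation without boundary terms.

  The real exponential is injective, so \<open>exp (v \<bullet> a t) = exp (v \<bullet> b t)\<close>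
  forces \<open>v \<bullet> (a t - b t) = 0\<close>; oscillating waves would leave a period to
  exclude. Uniqueness for the transforms then follows from Weierstrass approximation on compact
  sets.

  Since J is horizontal, p is taken horizontal, and orthogonality to d makes it perpendicular to v.
  It sees the component of the transform of J that the divergence condition leaves open; the
  component along v is zero.

  As d is a unit vector, \<open>l^2 = v \<bullet> v + c^2\<close>. For fixed v, an interval of
  values c gives an interval of values l, as uniqueness in time requires.

  On the source, \<open>t + x \<bullet> d\<close> stays strictly below \<open>T - R\<close>, the sum
  of \<open>T\<^sub>0\<close>, \<open>R\<^sub>1\<close> and Rh: the compact support of h keeps the
  profile of the source in a ball of radius less than Rh. This gap hosts the cutoff of the
  exponential.\<close>

lemma Ck_continuous: "Ck k f \<Longrightarrow> continuous_on UNIV f"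
  by (cases k) (simp, metis Ck.simps(2) differentiable_imp_continuous_on)

lemma Ck_Suc_D: "Ck (Suc k) f \<Longrightarrow> Ck k f"
proof (induction k arbitrary: f)
  case 0
  then show ?case by (simp add: differentiable_imp_continuous_on)
next
  case (Suc k)
  then show ?case by simp
qed

lemma partial_eqI: "(f has_derivative f') (at x) \<Longrightarrow> partial b f x = f' b"
  unfolding partial_def using frechet_derivative_at by metis

lemma Ck_SucI:
  assumes "\<And>x. (f has_derivative f' x) (at x)" and "\<And>b. b \<in> Basis \<Longrightarrow> Ck k (\<lambda>x. f' x b)"
  shows "Ck (Suc k) f"
proof -
  have "partial b f = (\<lambda>x. f' x b)" for b
    using partial_eqI[OF assms(1)] by blast
  moreover have "f differentiable_on UNIV"
    using assms(1) by (auto simp: differentiable_on_def differentiable_def)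
  ultimately show ?thesis using assms(2) by simp
qed

lemma Ck_has_derivative:
  assumes "Ck (Suc k) f"
  shows "(f has_derivative (\<lambda>b. partial b f x)) (at x)"
  using assms unfolding partial_def
  by (simp add: differentiable_on_def frechet_derivative_works[symmetric])

lemma Ck_const: "Ck k (\<lambda>x. c)"
proof (induction k arbitrary: c)
  case (Suc k)
  show ?case by (rule Ck_SucI[where f'="\<lambda>x b. 0"]) (use Suc in auto)
qed simp

lemma Ck_add:
  assumes "Ck k f" "Ck k g"
  shows "Ck k (\<lambda>x. f x + g x)"
  using assms
proof (induction k arbitrary: f g)
  case 0
  then show ?case by (simp add: continuous_on_add)
next
  case (Suc k)
  show ?case
    by (rule Ck_SucI[OF has_derivative_add[OF Ck_has_derivative[OF Suc.prems(1)] Ck_has_derivative[OF Suc.prems(2)]]])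
       (use Suc in auto)
qed

lemma Ck_mult:
  assumes "Ck k f" "Ck k g"
  shows "Ck k (\<lambda>x. f x * g x)"
  using assms
proof (induction k arbitrary: f g)
  case 0
  then show ?case by (simp add: continuous_on_mult)
next
  case (Suc k)
  have "Ck k (\<lambda>x. f x * partial b g x + partial b f x * g x)" if "b \<in> Basis" for b
    using Suc.prems Ck_Suc_D that by (intro Ck_add Suc.IH) auto
  then show ?case
    by (rule Ck_SucI[OF has_derivative_mult[OF Ck_has_derivative[OF Suc.prems(1)] Ck_has_derivative[OF Suc.prems(2)]]])
qed

lemma Ck_linear: "bounded_linear f \<Longrightarrow> Ck k f"
proof (cases k)
  case 0
  then show "bounded_linear f \<Longrightarrow> ?thesis" by (simp add: linear_continuous_on)
next
  case (Suc n)
  assume "bounded_linear f"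
  then show ?thesis unfolding Suc
    by (intro Ck_SucI[where f'="\<lambda>_. f"] bounded_linear_imp_has_derivative) (auto simp: Ck_const)
qed

text \<open>The derivatives are carried along as a sequence, which makes composition and products
  of smooth functions a plain induction.\<close>

definition smooth_seq :: "(nat \<Rightarrow> real \<Rightarrow> real) \<Rightarrow> bool" where
  "smooth_seq D \<longleftrightarrow> (\<forall>n x. (D n has_real_derivative D (Suc n) x) (at x))"

lemma smooth_seqD: "smooth_seq D \<Longrightarrow> (D n has_real_derivative D (Suc n) x) (at x)"
  by (simp add: smooth_seq_def)

lemma DERIV_locally_zero:
  fixes f :: "real \<Rightarrow> real"
  assumes "open U" "x \<in> U" "\<And>y. y \<in> U \<Longrightarrow> f y = 0" shows "(f has_real_derivative 0) (at x)"
  using has_field_derivative_transform_within_open[OF DERIV_const[of 0 "at x"] assms(1,2)] assms(3) by simp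

lemma smooth_seq_continuous: "smooth_seq D \<Longrightarrow> continuous_on S (D n)"
  by (meson DERIV_isCont continuous_at_imp_continuous_on smooth_seqD)

text \<open>The chain rule replaces \<open>D n\<close> by \<open>D (Suc n)\<close> and multiplies by
  a partial derivative of g, so the induction on k has to leave n free.\<close>

lemma Ck_compose:
  assumes "smooth_seq D" "Ck k g"
  shows "Ck k (\<lambda>x. D n (g x))"
  using assms(2)
proof (induction k arbitrary: g n)
  case 0
  then show ?case
    using continuous_on_compose2[OF smooth_seq_continuous[OF assms(1), of UNIV n], of UNIV g] by simp
next
  case (Suc k)
  have "((\<lambda>x. D n (g x)) has_derivative (\<lambda>b. D (Suc n) (g x) * partial b g x)) (at x)" for x
    using has_derivative_compose[OF Ck_has_derivative[OF Suc.prems]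
        smooth_seqD[OF assms(1), unfolded has_field_derivative_def]] by simp
  moreover have "Ck k (\<lambda>x. D (Suc n) (g x) * partial b g x)" if "b \<in> Basis" for b
    using Suc.prems Ck_Suc_D[OF Suc.prems] that by (intro Ck_mult Suc.IH) auto
  ultimately show ?case by (rule Ck_SucI)
qed

text \<open>The witness is the Leibniz formula; Pascal's rule shows that differentiating its n-th
  sum gives the next one.\<close>

lemma smooth_seq_mult:
  assumes "smooth_seq D" "smooth_seq E"
  obtains P where "smooth_seq P" "P 0 = (\<lambda>x. D 0 x * E 0 x)"
proof -
  define P where "P n x = (\<Sum>i\<le>n. of_nat (n choose i) * D i x * E (n - i) x)" for n x
  have "(P n has_real_derivative P (Suc n) x) (at x)" for n x
  proof -
    have "(P n has_real_derivative
        (\<Sum>i\<le>n. of_nat (n choose i) * (D (Suc i) x * E (n - i) x + D i x * E (Suc (n - i)) x))) (at x)"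
      unfolding P_def
      by (auto intro!: DERIV_sum derivative_eq_intros smooth_seqD assms simp: algebra_simps)
    also have "(\<Sum>i\<le>n. of_nat (n choose i) * (D (Suc i) x * E (n - i) x + D i x * E (Suc (n - i)) x))
      = (\<Sum>i\<le>n. of_nat (n choose i) * D (Suc i) x * E (n - i) x)
        + (\<Sum>i\<le>n. of_nat (n choose i) * D i x * E (Suc n - i) x)"
      by (simp add: sum.distrib[symmetric] algebra_simps Suc_diff_le)
    \<comment> \<open>The added summand has the coefficient \<open>n choose Suc n\<close>, which is
      0. It lets the sum be shifted by one index and merged with the other by Pascal's rule.\<close>
    also have "(\<Sum>i\<le>n. of_nat (n choose i) * D i x * E (Suc n - i) x)
      = (\<Sum>i\<le>Suc n. of_nat (n choose i) * D i x * E (Suc n - i) x)" by simp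
    also have "\<dots> = D 0 x * E (Suc n) x + (\<Sum>i\<le>n. of_nat (n choose Suc i) * D (Suc i) x * E (n - i) x)"
      by (subst sum.atMost_Suc_shift) simp
    also have "(\<Sum>i\<le>n. of_nat (n choose i) * D (Suc i) x * E (n - i) x) +
        (D 0 x * E (Suc n) x + (\<Sum>i\<le>n. of_nat (n choose Suc i) * D (Suc i) x * E (n - i) x))
      = P (Suc n) x"
      unfolding P_def
      by (subst sum.atMost_Suc_shift) (simp add: sum.distrib[symmetric] algebra_simps)
    finally show ?thesis .
  qed
  then show thesis using that[of P] by (simp add: smooth_seq_def P_def fun_eq_iff)
qed

text \<open>The flat function exp (-1/x) with a polynomial factor in 1/x. This class is closed under
  differentiation, so all derivatives are handled at once.\<close>

definition flat :: "real poly \<Rightarrow> real \<Rightarrow> real" where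
  "flat q x = (if x \<le> 0 then 0 else poly q (inverse x) * exp (- inverse x))"

lemma poly_exp_tendsto_0: "((\<lambda>y. poly q y * exp (- y)) \<longlongrightarrow> (0::real)) at_top"
proof -
  have "((\<lambda>y. \<Sum>i\<le>degree q. coeff q i * (y ^ i / exp y)) \<longlongrightarrow> (\<Sum>i\<le>degree q. coeff q i * 0)) at_top"
    by (intro tendsto_intros tendsto_power_div_exp_0)
  then show ?thesis
    by (simp add: poly_altdef exp_minus sum_distrib_right divide_inverse mult.assoc)
qed

text \<open>For positive x the inner derivative of 1/x contributes the square of 1/x, encoded by
  \<open>[:0, 0, 1:]\<close>, and the product rule gives \<open>q - pderiv q\<close> up to
  sign.\<close>

lemma flat_DERIV:
  "(flat q has_real_derivative flat ([:0, 0, 1:] * (q - pderiv q)) x) (at x)"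
proof -
  consider "x < 0" | "x = 0" | "x > 0" by linarith
  then show ?thesis
  proof cases
    case 1
    have "(flat q has_real_derivative 0) (at x)"
      by (rule DERIV_locally_zero[of "{..<0}"]) (use 1 in \<open>auto simp: flat_def\<close>)
    then show ?thesis using 1 by (simp add: flat_def)
  next
    case 2
    have r: "((\<lambda>h. flat q h / h) \<longlongrightarrow> 0) (at_right 0)"
    proof -
      \<comment> \<open>Division by h only raises the polynomial in 1/h by one degree, and the
        exponential still wins.\<close>
      have "((\<lambda>h. poly ([:0,1:] * q) (inverse h) * exp (- inverse h)) \<longlongrightarrow> (0::real)) (at_right 0)"
        by (rule filterlim_compose[OF poly_exp_tendsto_0 filterlim_inverse_at_top_right])
      moreover have "eventually (\<lambda>h. poly ([:0,1:] * q) (inverse h) * exp (- inverse h) = flat q h / h) (at_right (0::real))"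
        by (auto simp: eventually_at_right_field flat_def field_simps intro!: exI[of _ 1])
      ultimately show ?thesis by (blast intro: Lim_transform_eventually)
    qed
    have l: "((\<lambda>h. flat q h / h) \<longlongrightarrow> 0) (at_left 0)"
    proof (rule Lim_transform_eventually[OF tendsto_const])
      show "eventually (\<lambda>h. 0 = flat q h / h) (at_left (0::real))"
        by (auto simp: eventually_at_left_field flat_def intro!: exI[of _ "-1"])
    qed
    have "((\<lambda>h. flat q h / h) \<longlongrightarrow> 0) (at 0)" using l r by (simp add: filterlim_at_split)
    moreover have "flat p 0 = 0" for p by (simp add: flat_def)
    ultimately show ?thesis using 2 by (simp add: DERIV_def)
  next
    case 3
    have ev: "eventually (\<lambda>x. flat q x = poly q (inverse x) * exp (- inverse x)) (nhds x)"
      using eventually_nhds_in_open[of "{0<..}" x] 3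
      by (auto elim!: eventually_mono simp: flat_def)
    have "((\<lambda>x. poly q (inverse x) * exp (- inverse x)) has_real_derivative
        flat ([:0, 0, 1:] * (q - pderiv q)) x) (at x)"
      using 3 by (auto intro!: derivative_eq_intros DERIV_chain2[OF poly_DERIV]
          simp: flat_def field_simps power2_eq_square)
    then show ?thesis using DERIV_cong_ev[OF refl ev refl] by blast
  qed
qed

lemma smooth_flat: obtains D where "smooth_seq D" "D 0 = flat 1"
proof -
  define D where "D n = flat (((\<lambda>q. [:0, 0, 1:] * (q - pderiv q)) ^^ n) 1)" for n
  show thesis using that[of D] flat_DERIV by (simp add: smooth_seq_def D_def)
qed

lemma smooth_affine:
  assumes "smooth_seq D" obtains E where "smooth_seq E" "E 0 = (\<lambda>x. D 0 (c * x + d))"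
proof -
  define E where "E n x = c ^ n * D n (c * x + d)" for n x
  have "smooth_seq E"
    unfolding smooth_seq_def E_def
    by (auto intro!: derivative_eq_intros DERIV_chain2[OF smooth_seqD[OF assms]])
  then show thesis using that by (auto simp: E_def fun_eq_iff)
qed

text \<open>The factors of \<open>P 0\<close> are scaled so that \<open>P\<close> vanishes in neighbourhoods of \<open>{..0}\<close> and of
  \<open>{1..}\<close>; the step is its normalized antiderivative.\<close>

lemma smooth_step:
  obtains D where "smooth_seq D" "\<And>n x. x \<le> 0 \<Longrightarrow> D n x = 0"
    "\<And>x. x \<ge> 1 \<Longrightarrow> D 0 x = 1" "\<And>x. 0 \<le> D 0 x" "\<And>x. D 0 x \<le> 1" "\<And>n x. x \<ge> 1 \<Longrightarrow> D (Suc n) x = 0"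
proof -
  obtain A0 where A0: "smooth_seq A0" "A0 0 = flat 1" by (rule smooth_flat)
  obtain A where A: "smooth_seq A" "A 0 = (\<lambda>x. A0 0 (3 * x + - 1))" by (rule smooth_affine[OF A0(1)])
  obtain B where B: "smooth_seq B" "B 0 = (\<lambda>x. A0 0 (- 3 * x + 2))" by (rule smooth_affine[OF A0(1)])
  obtain P where P: "smooth_seq P" "P 0 = (\<lambda>x. A 0 x * B 0 x)" by (rule smooth_seq_mult[OF A(1) B(1)])
  \<comment> \<open>The claim is made on an open set, where vanishing of \<open>P n\<close> passes
    to its derivative \<open>P (Suc n)\<close>.\<close>
  have P0: "P n x = 0" if "x \<in> {..<1/3} \<union> {2/3<..}" for n x
    using that
  proof (induction n arbitrary: x)
    case 0
    then show ?case by (auto simp: P(2) A(2) B(2) A0(2) flat_def)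
  next
    case (Suc n)
    have "(P n has_real_derivative 0) (at x)"
      by (rule DERIV_locally_zero[of "{..<1/3} \<union> {2/3<..}"]) (use Suc in auto)
    then show ?case using DERIV_unique smooth_seqD[OF P(1)] by blast
  qed
  have P0': "P n x = 0" if "x \<le> 0 \<or> x \<ge> 1" for n x using P0[of x n] that by auto
  have Pnn: "P 0 x \<ge> 0" for x by (simp add: P(2) A(2) B(2) A0(2) flat_def)
  obtain Q where "\<And>x. (Q has_vector_derivative P 0 x) (at x)"
    using einterval_antiderivative[of "-\<infinity>" "\<infinity>" "P 0"] DERIV_isCont[OF smooth_seqD[OF P(1)]] by auto
  then have Q: "(Q has_real_derivative P 0 x) (at x)" for x
    by (simp add: has_real_derivative_iff_has_vector_derivative)
  have mono: "Q x \<le> Q y" if "x \<le> y" for x y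
    by (rule DERIV_nonneg_imp_nondecreasing[OF that]) (use Q Pnn in blast)
  have const: "Q x = Q y" if "x \<le> y" "y \<le> 0 \<or> 1 \<le> x" for x y
  proof (cases "x = y")
    case False
    have "Q y = Q x"
    proof (rule DERIV_isconst_end[of x y Q])
      show "continuous_on {x..y} Q" by (rule DERIV_continuous_on[OF has_field_derivative_at_within[OF Q]])
      fix z assume "x < z" "z < y"
      then have "P 0 z = 0" using that by (intro P0') auto
      then show "(Q has_real_derivative 0) (at z)" using Q[of z] by simp
    qed (use False that in simp)
    then show ?thesis ..
  qed simp
  have "Q (1/3) < Q (2/3)"
  proof (rule DERIV_pos_imp_increasing_open[of "1/3" "2/3" Q])
    show "\<exists>y. (Q has_real_derivative y) (at x) \<and> y > 0" if "1/3 < x" "x < 2/3" for x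
      using Q[of x] that by (intro exI[of _ "P 0 x"]) (simp add: P(2) A(2) B(2) A0(2) flat_def)
    show "continuous_on {1/3..2/3} Q"
      by (rule DERIV_continuous_on[OF has_field_derivative_at_within[OF Q]])
  qed simp
  then have pos: "Q 0 < Q 1" using mono[of 0 "1/3"] mono[of "2/3" 1] by linarith
  define D where "D n x = (case n of 0 \<Rightarrow> (Q x - Q 0) / (Q 1 - Q 0) | Suc m \<Rightarrow> P m x / (Q 1 - Q 0))" for n x
  have "(D n has_real_derivative D (Suc n) x) (at x)" for n x
    using pos by (cases n) (auto simp: D_def[abs_def] intro!: derivative_eq_intros Q smooth_seqD[OF P(1)])
  then have "smooth_seq D" by (simp add: smooth_seq_def)
  then show thesis
  proof (rule that)
    have le: "Q x = Q 0" if "x \<le> 0" for x using const[of x 0] that by simp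
    have ge: "Q x = Q 1" if "x \<ge> 1" for x using const[of 1 x] that by simp
    show "D n x = 0" if "x \<le> 0" for n x using le[OF that] P0' that by (cases n) (simp_all add: D_def)
    show "D 0 x = 1" if "x \<ge> 1" for x using ge[OF that] pos by (simp add: D_def)
    show "D (Suc n) x = 0" if "x \<ge> 1" for n x using P0' that by (simp add: D_def)
    fix x
    show "0 \<le> D 0 x" using mono[of 0 x] le[of x] pos by (cases "x \<le> 0") (simp_all add: D_def)
    show "D 0 x \<le> 1" using mono[of x 1] ge[of x] pos by (cases "x \<le> 1") (simp_all add: D_def)
  qed
qed

subsection \<open>Square integrable functions\<close>

definition L2v :: "('a::euclidean_space \<Rightarrow> 'b::euclidean_space) \<Rightarrow> bool" where
  "L2v f \<longleftrightarrow> f \<in> borel_measurable borel \<and> integrable lborel (\<lambda>x. (norm (f x))\<^sup>2)"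

definition ip :: "('a::euclidean_space \<Rightarrow> 'b::euclidean_space) \<Rightarrow> ('a \<Rightarrow> 'b) \<Rightarrow> real" where
  "ip f g = (LBINT x. f x \<bullet> g x)"

text \<open>Functions are not identified up to null sets, so this is only a seminorm;
  \<open>nrm_zero_AE\<close> recovers equality almost everywhere.\<close>

definition nrm :: "('a::euclidean_space \<Rightarrow> 'b::euclidean_space) \<Rightarrow> real" where
  "nrm f = sqrt (ip f f)"

lemma L2v_measurable [measurable_dest]: "L2v f \<Longrightarrow> f \<in> borel_measurable borel"
  by (simp add: L2v_def)

lemma L2v_bound:
  assumes "g \<in> borel_measurable borel" "L2v f" "\<And>x. norm (g x) \<le> c * norm (f x)"
  shows "L2v g"
  unfolding L2v_def
proof
  show "integrable lborel (\<lambda>x. (norm (g x))\<^sup>2)"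
  proof (rule Bochner_Integration.integrable_bound)
    show "integrable lborel (\<lambda>x. c\<^sup>2 * (norm (f x))\<^sup>2)" using assms(2) by (simp add: L2v_def)
    have "(norm (g x))\<^sup>2 \<le> (c * norm (f x))\<^sup>2" for x by (rule power_mono[OF assms(3)]) simp
    then show "AE x in lborel. norm ((norm (g x))\<^sup>2) \<le> norm (c\<^sup>2 * (norm (f x))\<^sup>2)"
      by (simp add: power_mult_distrib)
  qed (use assms in simp)
qed (fact assms(1))

lemma L2v_zero [simp]: "L2v (\<lambda>x. 0)" by (simp add: L2v_def)

lemma sq_sum_bound: "(a + b)\<^sup>2 \<le> 2 * a\<^sup>2 + 2 * (b::real)\<^sup>2"
  using sum_squares_bound[of a b] by (simp add: power2_sum)

lemma L2v_add: assumes "L2v f" "L2v g" shows "L2v (\<lambda>x. f x + g x)"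
  unfolding L2v_def
proof
  show "integrable lborel (\<lambda>x. (norm (f x + g x))\<^sup>2)"
  proof (rule Bochner_Integration.integrable_bound)
    show "integrable lborel (\<lambda>x. 2 * (norm (f x))\<^sup>2 + 2 * (norm (g x))\<^sup>2)"
      using assms by (simp add: L2v_def)
    have "(norm (f x + g x))\<^sup>2 \<le> 2 * (norm (f x))\<^sup>2 + 2 * (norm (g x))\<^sup>2" for x
      by (rule order_trans[OF power_mono[OF norm_triangle_ineq] sq_sum_bound]) simp
    then show "AE x in lborel. norm ((norm (f x + g x))\<^sup>2) \<le> norm (2 * (norm (f x))\<^sup>2 + 2 * (norm (g x))\<^sup>2)"
      by simp
  qed (use assms in \<open>auto simp: L2v_def\<close>)
qed (use assms in \<open>auto simp: L2v_def\<close>)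

lemma L2v_scaleR: "L2v f \<Longrightarrow> L2v (\<lambda>x. c *\<^sub>R f x)"
  by (rule L2v_bound[of _ f "\<bar>c\<bar>"]) (auto simp: L2v_def)

lemma L2v_minus: "L2v f \<Longrightarrow> L2v (\<lambda>x. - f x)"
  using L2v_scaleR[of f "-1"] by simp

lemma L2v_diff: "L2v f \<Longrightarrow> L2v g \<Longrightarrow> L2v (\<lambda>x. f x - g x)"
  using L2v_add[OF _ L2v_minus, of f g] by simp

lemma L2v_indicator: "L2v f \<Longrightarrow> A \<in> sets borel \<Longrightarrow> L2v (\<lambda>x. indicator A x *\<^sub>R f x)"
  by (rule L2v_bound[of _ f 1]) (auto simp: L2v_def indicator_def)

lemma L2v_inner: "L2v f \<Longrightarrow> L2v (\<lambda>x. f x \<bullet> c)"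
  by (rule L2v_bound[of _ f "norm c"])
     (use Cauchy_Schwarz_ineq2 in \<open>auto simp: L2v_def mult.commute[of "norm c"]\<close>)

lemma L2v_sum: "(\<And>i. i \<in> I \<Longrightarrow> L2v (f i)) \<Longrightarrow> L2v (\<lambda>x. \<Sum>i\<in>I. f i x)"
  by (induction I rule: infinite_finite_induct) (auto intro: L2v_add)

section \<open>Invariance of Lebesgue integrals under translation and reflection\<close>

lemma borel_measurable_translate:
  fixes f :: "'a::euclidean_space \<Rightarrow> 'b::euclidean_space"
  assumes [measurable]: "f \<in> borel_measurable borel"
  shows "(\<lambda>x. f (x + z)) \<in> borel_measurable borel"
  by measurable

lemma integrable_translate:
  fixes f :: "'a::euclidean_space \<Rightarrow> 'b::euclidean_space"
  assumes "integrable lborel f" shows "integrable lborel (\<lambda>x. f (x + z))"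
proof -
  have "integrable (distr lborel borel ((+) z)) f" using assms by (simp add: lborel_distr_plus)
  then show ?thesis by (subst (asm) integrable_distr_eq) (use assms in \<open>auto simp: add.commute\<close>)
qed

lemma integral_translate:
  fixes f :: "'a::euclidean_space \<Rightarrow> 'b::euclidean_space"
  assumes [measurable]: "f \<in> borel_measurable borel"
  shows "(LBINT x. f (x + z)) = (LBINT x. f x)"
proof -
  have "(LBINT x. f x) = (LINT x|distr lborel borel ((+) z). f x)"
    by (simp add: lborel_distr_plus)
  also have "\<dots> = (LBINT x. f (x + z))" by (subst integral_distr) (auto simp: add.commute)
  finally show ?thesis ..
qed

lemma lborel_distr_minus: "distr lborel borel (\<lambda>x. - x) = (lborel :: 'a::euclidean_space measure)"
  using lborel_affine[of "-1" "0::'a"] by (simp add: density_1 one_ennreal_def[symmetric])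

lemma integral_reflect:
  fixes f :: "'a::euclidean_space \<Rightarrow> 'b::euclidean_space"
  assumes [measurable]: "f \<in> borel_measurable borel"
  shows "(LBINT y. f (x - y)) = (LBINT y. f y)"
proof -
  have "(LBINT y. f (x - y)) = (LINT y|distr lborel borel (\<lambda>x. - x). f (y + x))"
    by (subst integral_distr) (auto simp: algebra_simps)
  then show ?thesis by (simp add: lborel_distr_minus integral_translate)
qed

lemma integrable_reflect:
  fixes f :: "'a::euclidean_space \<Rightarrow> 'b::euclidean_space"
  assumes "integrable lborel f" shows "integrable lborel (\<lambda>y. f (x - y))"
proof -
  have "integrable (distr lborel borel (\<lambda>x. - x)) (\<lambda>y. f (y + x))"
    using integrable_translate[OF assms] by (simp add: lborel_distr_minus)
  then show ?thesis by (subst (asm) integrable_distr_eq) (use assms in \<open>auto simp: algebra_simps\<close>)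
qed

lemma L2v_translate: "L2v f \<Longrightarrow> L2v (\<lambda>x. f (x + z))"
  using integrable_translate[of "\<lambda>x. (norm (f x))\<^sup>2" z]
  by (simp add: L2v_def borel_measurable_translate)

lemma inner_bound_sq: "\<bar>x \<bullet> y\<bar> \<le> (norm x)\<^sup>2 + (norm y)\<^sup>2"
  and norm_mult_bound_sq: "norm x * norm y \<le> (norm x)\<^sup>2 + (norm y)\<^sup>2"
  using Cauchy_Schwarz_ineq2[of x y] sum_squares_bound[of "norm x" "norm y"]
    mult_nonneg_nonneg[OF norm_ge_zero[of x] norm_ge_zero[of y]] by linarith+

lemma ip_integrable: assumes "L2v f" "L2v g" shows "integrable lborel (\<lambda>x. f x \<bullet> g x)"
proof (rule Bochner_Integration.integrable_bound)
  show "integrable lborel (\<lambda>x. (norm (f x))\<^sup>2 + (norm (g x))\<^sup>2)" using assms by (simp add: L2v_def)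
  show "AE x in lborel. norm (f x \<bullet> g x) \<le> norm ((norm (f x))\<^sup>2 + (norm (g x))\<^sup>2)"
    by (simp add: inner_bound_sq)
qed (use assms in \<open>auto simp: L2v_def\<close>)

lemma ip_commute: "ip f g = ip g f" by (simp add: ip_def inner_commute)

lemma ip_add_left: "L2v f \<Longrightarrow> L2v g \<Longrightarrow> L2v h \<Longrightarrow> ip (\<lambda>x. f x + g x) h = ip f h + ip g h"
  by (simp add: ip_def inner_add_left ip_integrable)

lemma ip_diff_left: "L2v f \<Longrightarrow> L2v g \<Longrightarrow> L2v h \<Longrightarrow> ip (\<lambda>x. f x - g x) h = ip f h - ip g h"
  by (simp add: ip_def inner_diff_left ip_integrable)

lemma ip_add_right: "L2v f \<Longrightarrow> L2v g \<Longrightarrow> L2v h \<Longrightarrow> ip h (\<lambda>x. f x + g x) = ip h f + ip h g"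
  by (simp add: ip_def inner_add_right ip_integrable)

lemma ip_diff_right: "L2v f \<Longrightarrow> L2v g \<Longrightarrow> L2v h \<Longrightarrow> ip h (\<lambda>x. f x - g x) = ip h f - ip h g"
  by (simp add: ip_def inner_diff_right ip_integrable)

lemma ip_scale_left: "ip (\<lambda>x. c *\<^sub>R f x) g = c * ip f g" by (simp add: ip_def)
lemma ip_scale_right: "ip f (\<lambda>x. c *\<^sub>R g x) = c * ip f g" by (simp add: ip_def)

lemma ip_self_nonneg: "0 \<le> ip f f" by (simp add: ip_def)

lemma ip_cong_AE: 
  assumes "AE x in lborel. f x = f' x" "AE x in lborel. g x = g' x" "L2v f" "L2v g" "L2v f'" "L2v g'"
  shows "ip f g = ip f' g'"
  unfolding ip_def
  by (rule integral_cong_AE) (use assms in \<open>auto simp: L2v_def\<close>)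

lemma nrm_nonneg [simp]: "0 \<le> nrm f" by (simp add: nrm_def ip_self_nonneg)

lemma nrm_sq: "(nrm f)\<^sup>2 = ip f f" by (simp add: nrm_def ip_self_nonneg)

lemma nrm_scale: "nrm (\<lambda>x. c *\<^sub>R f x) = \<bar>c\<bar> * nrm f"
proof -
  have "ip (\<lambda>x. c *\<^sub>R f x) (\<lambda>x. c *\<^sub>R f x) = c\<^sup>2 * ip f f"
    by (simp only: ip_scale_left ip_scale_right power2_eq_square mult.assoc)
  then show ?thesis by (simp add: nrm_def real_sqrt_mult)
qed

lemma nrm_minus_commute: "nrm (\<lambda>x. f x - g x) = nrm (\<lambda>x. g x - f x)"
  by (simp add: nrm_def ip_def inner_diff_left inner_diff_right algebra_simps)

text \<open>The square of the seminorm of \<open>f - s g\<close> is a nonnegative quadratic in s, so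
  its discriminant is not positive. The case \<open>a = 0\<close> is separate because a nonzero g
  may have seminorm zero.\<close>

lemma ip_CS: assumes "L2v f" "L2v g" shows "\<bar>ip f g\<bar> \<le> nrm f * nrm g"
proof -
  define a b c where "a = ip g g" and "b = ip f g" and "c = ip f f"
  have q: "0 \<le> c - 2 * s * b + s\<^sup>2 * a" for s
  proof -
    have "0 \<le> ip (\<lambda>x. f x - s *\<^sub>R g x) (\<lambda>x. f x - s *\<^sub>R g x)" by (rule ip_self_nonneg)
    also have "\<dots> = c - 2 * s * b + s\<^sup>2 * a"
      using assms by (simp add: ip_diff_left ip_diff_right L2v_diff L2v_scaleR ip_scale_left ip_scale_right
        a_def b_def c_def ip_commute[of g f] power2_eq_square algebra_simps)
    finally show ?thesis .
  qed
  have a0: "a \<ge> 0" and c0: "c \<ge> 0" by (auto simp: a_def c_def ip_self_nonneg)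
  have "b\<^sup>2 \<le> c * a"
  proof (cases "a = 0")
    case True
    have "b = 0"
    proof (rule ccontr)
      assume "b \<noteq> 0"
      \<comment> \<open>At this s the remaining affine function \<open>c - 2 * s * b\<close> takes
        the value -1.\<close>
      then show False using q[of "(c + 1) / (2 * b)"] True by (simp add: field_simps)
    qed
    then show ?thesis using True by simp
  next
    case False
    then show ?thesis using q[of "b / a"] a0 by (simp add: field_simps power2_eq_square)
  qed
  then have "sqrt (b\<^sup>2) \<le> sqrt (c * a)" by (rule real_sqrt_le_mono)
  then show ?thesis by (simp add: a_def b_def c_def nrm_def real_sqrt_mult)
qed

lemma nrm_triangle: assumes "L2v f" "L2v g" shows "nrm (\<lambda>x. f x + g x) \<le> nrm f + nrm g"
proof (rule power2_le_imp_le)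
  have "(nrm (\<lambda>x. f x + g x))\<^sup>2 = (nrm f)\<^sup>2 + 2 * ip f g + (nrm g)\<^sup>2"
    using assms by (simp add: nrm_sq ip_add_left ip_add_right L2v_add ip_commute[of g f])
  also have "\<dots> \<le> (nrm f + nrm g)\<^sup>2" using ip_CS[OF assms] by (simp add: power2_sum)
  finally show "(nrm (\<lambda>x. f x + g x))\<^sup>2 \<le> (nrm f + nrm g)\<^sup>2" .
qed simp

lemma nrm_zero_AE: assumes "L2v f" "nrm f = 0" shows "AE x in lborel. f x = 0"
proof -
  have "(LBINT x. (norm (f x))\<^sup>2) = 0"
    using assms(2) by (simp add: nrm_def ip_def power2_norm_eq_inner)
  then have "AE x in lborel. (norm (f x))\<^sup>2 = 0"
    using assms(1) by (subst (asm) integral_nonneg_eq_0_iff_AE) (auto simp: L2v_def)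
  then show ?thesis by simp
qed

lemma nrm_indicator_le: assumes "L2v f" "A \<in> sets borel"
  shows "nrm (\<lambda>x. indicator A x *\<^sub>R f x) \<le> nrm f"
  unfolding nrm_def ip_def
  by (intro real_sqrt_le_mono integral_mono ip_integrable L2v_indicator assms) (auto simp: indicator_def)

lemma nrm_translate: assumes "L2v f" shows "nrm (\<lambda>x. f (x + z)) = nrm f"
  using integral_translate[of "\<lambda>x. f x \<bullet> f x" z] L2v_measurable[OF assms]
  by (simp add: nrm_def ip_def)

text \<open>An arbitrary filter covers both sequences and one-sided limits in time. Membership is
  asked only eventually, since a filter \<open>at t within S\<close> sees only times in S.\<close>

definition L2_lim ::
    "('c \<Rightarrow> 'a::euclidean_space \<Rightarrow> 'b::euclidean_space) \<Rightarrow> ('a \<Rightarrow> 'b) \<Rightarrow> 'c filter \<Rightarrow> bool" where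
  "L2_lim u l F \<longleftrightarrow> L2v l \<and> (\<forall>\<^sub>F s in F. L2v (u s)) \<and> ((\<lambda>s. nrm (\<lambda>x. u s x - l x)) \<longlongrightarrow> 0) F"

lemma L2_limI:
  assumes "L2v l" "\<forall>\<^sub>F s in F. L2v (u s) \<and> nrm (\<lambda>x. u s x - l x) \<le> c s" "(c \<longlongrightarrow> 0) F"
  shows "L2_lim u l F"
  unfolding L2_lim_def
proof (intro conjI assms(1))
  show "\<forall>\<^sub>F s in F. L2v (u s)" using assms(2) by eventually_elim simp
  show "((\<lambda>s. nrm (\<lambda>x. u s x - l x)) \<longlongrightarrow> 0) F"
    by (rule Lim_null_comparison[OF _ assms(3)]) (use assms(2) in eventually_elim, simp)
qed

lemma L2_lim_const: "L2v l \<Longrightarrow> L2_lim (\<lambda>_. l) l F"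
  by (simp add: L2_lim_def nrm_def ip_def)

lemma L2_lim_add:
  assumes "L2_lim u l F" "L2_lim v m F" shows "L2_lim (\<lambda>s x. u s x + v s x) (\<lambda>x. l x + m x) F"
proof (rule L2_limI)
  have ev: "\<forall>\<^sub>F s in F. L2v (u s)" "\<forall>\<^sub>F s in F. L2v (v s)" and L: "L2v l" "L2v m"
    using assms by (auto simp: L2_lim_def)
  show "L2v (\<lambda>x. l x + m x)" by (rule L2v_add[OF L])
  show "((\<lambda>s. nrm (\<lambda>x. u s x - l x) + nrm (\<lambda>x. v s x - m x)) \<longlongrightarrow> 0) F"
    using assms by (intro tendsto_add_zero) (auto simp: L2_lim_def)
  show "\<forall>\<^sub>F s in F. L2v (\<lambda>x. u s x + v s x) \<and>
      nrm (\<lambda>x. u s x + v s x - (l x + m x)) \<le> nrm (\<lambda>x. u s x - l x) + nrm (\<lambda>x. v s x - m x)"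
    using ev
  proof eventually_elim
    case (elim s)
    then show ?case using nrm_triangle[OF L2v_diff[OF elim(1) L(1)] L2v_diff[OF elim(2) L(2)]]
      by (simp add: L2v_add algebra_simps)
  qed
qed

lemma L2_lim_scale: assumes "L2_lim u l F" shows "L2_lim (\<lambda>s x. c *\<^sub>R u s x) (\<lambda>x. c *\<^sub>R l x) F"
proof -
  have "\<forall>\<^sub>F s in F. L2v (\<lambda>x. c *\<^sub>R u s x)"
    using assms unfolding L2_lim_def by (auto elim!: eventually_mono intro: L2v_scaleR)
  moreover have "((\<lambda>s. \<bar>c\<bar> * nrm (\<lambda>x. u s x - l x)) \<longlongrightarrow> 0) F"
    using assms by (intro tendsto_mult_right_zero) (simp add: L2_lim_def)
  moreover have "nrm (\<lambda>x. c *\<^sub>R u s x - c *\<^sub>R l x) = \<bar>c\<bar> * nrm (\<lambda>x. u s x - l x)" for s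
    using nrm_scale[of c "\<lambda>x. u s x - l x"] by (simp add: scaleR_diff_right)
  ultimately show ?thesis using assms by (simp add: L2_lim_def L2v_scaleR)
qed

lemma L2_lim_diff:
  assumes "L2_lim u l F" "L2_lim v m F" shows "L2_lim (\<lambda>s x. u s x - v s x) (\<lambda>x. l x - m x) F"
  using L2_lim_add[OF assms(1) L2_lim_scale[OF assms(2), of "- 1"]] by simp

lemma L2_lim_indicator:
  assumes "L2_lim u l F" "A \<in> sets borel"
  shows "L2_lim (\<lambda>s x. indicator A x *\<^sub>R u s x) (\<lambda>x. indicator A x *\<^sub>R l x) F"
proof (rule L2_limI)
  show "L2v (\<lambda>x. indicator A x *\<^sub>R l x)" using assms by (simp add: L2_lim_def L2v_indicator)
  show "((\<lambda>s. nrm (\<lambda>x. u s x - l x)) \<longlongrightarrow> 0) F" using assms by (simp add: L2_lim_def)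
  have "\<forall>\<^sub>F s in F. L2v (u s)" "L2v l" using assms by (auto simp: L2_lim_def)
  then show "\<forall>\<^sub>F s in F. L2v (\<lambda>x. indicator A x *\<^sub>R u s x) \<and>
      nrm (\<lambda>x. indicator A x *\<^sub>R u s x - indicator A x *\<^sub>R l x) \<le> nrm (\<lambda>x. u s x - l x)"
    using nrm_indicator_le[OF L2v_diff assms(2), of _ l]
    by (auto elim!: eventually_mono simp: L2v_indicator assms(2) scaleR_diff_right)
qed

text \<open>Both arguments may vary: the error splits into the product of the two deviations and two
  terms with one deviation each, all controlled by Cauchy-Schwarz.\<close>

lemma ip_tendsto:
  assumes "L2_lim u l F" "L2_lim v m F" shows "((\<lambda>s. ip (u s) (v s)) \<longlongrightarrow> ip l m) F"
proof (rule Lim_transform[OF tendsto_const])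
  have u: "((\<lambda>s. nrm (\<lambda>x. u s x - l x)) \<longlongrightarrow> 0) F" "\<forall>\<^sub>F s in F. L2v (u s)" "L2v l"
    and v: "((\<lambda>s. nrm (\<lambda>x. v s x - m x)) \<longlongrightarrow> 0) F" "\<forall>\<^sub>F s in F. L2v (v s)" "L2v m"
    using assms by (auto simp: L2_lim_def)
  define b where "b s = nrm (\<lambda>x. u s x - l x) * nrm (\<lambda>x. v s x - m x)
      + nrm (\<lambda>x. u s x - l x) * nrm m + nrm l * nrm (\<lambda>x. v s x - m x)" for s
  have b0: "(b \<longlongrightarrow> 0) F" unfolding b_def
    by (auto intro!: tendsto_eq_intros u v)
  show "((\<lambda>s. ip (u s) (v s) - ip l m) \<longlongrightarrow> 0) F"
  proof (rule Lim_null_comparison[OF _ b0])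
    show "\<forall>\<^sub>F s in F. norm (ip (u s) (v s) - ip l m) \<le> b s"
      using u(2) v(2)
    proof eventually_elim
      case (elim s)
      have "ip (u s) (v s) - ip l m = ip (\<lambda>x. u s x - l x) (\<lambda>x. v s x - m x)
          + ip (\<lambda>x. u s x - l x) m + ip l (\<lambda>x. v s x - m x)"
        using elim u(3) v(3) by (simp add: ip_diff_left ip_diff_right L2v_diff)
      moreover have "\<bar>ip (\<lambda>x. u s x - l x) (\<lambda>x. v s x - m x)\<bar> \<le> nrm (\<lambda>x. u s x - l x) * nrm (\<lambda>x. v s x - m x)"
        "\<bar>ip (\<lambda>x. u s x - l x) m\<bar> \<le> nrm (\<lambda>x. u s x - l x) * nrm m"
        "\<bar>ip l (\<lambda>x. v s x - m x)\<bar> \<le> nrm l * nrm (\<lambda>x. v s x - m x)"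
        using elim u(3) v(3) by (auto intro!: ip_CS L2v_diff)
      ultimately show ?case by (simp add: b_def)
    qed
  qed
qed

subsection \<open>Continuity of translations in \<open>L\<^sup>2\<close>\<close>

text \<open>Stated with sequences so that dominated convergence applies directly.\<close>

definition trans_cont :: "('a::euclidean_space \<Rightarrow> 'b::euclidean_space) \<Rightarrow> bool" where
  "trans_cont f \<longleftrightarrow> L2v f \<and> (\<forall>z. z \<longlonglongrightarrow> 0 \<longrightarrow> (\<lambda>n. nrm (\<lambda>x. f (x + z n) - f x)) \<longlonglongrightarrow> 0)"

lemma trans_cont_add:
  assumes "trans_cont f" "trans_cont g" shows "trans_cont (\<lambda>x. f x + g x)"
  unfolding trans_cont_def
proof (intro conjI allI impI)
  show "L2v (\<lambda>x. f x + g x)" using assms by (simp add: trans_cont_def L2v_add)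
  fix z :: "nat \<Rightarrow> 'a" assume "z \<longlonglongrightarrow> 0"
  then have "L2_lim (\<lambda>n x. w (x + z n)) w sequentially" if "trans_cont w" for w :: "'a \<Rightarrow> 'b"
    using that by (simp add: trans_cont_def L2_lim_def L2v_translate)
  from L2_lim_add[OF this[OF assms(1)] this[OF assms(2)]]
  show "(\<lambda>n. nrm (\<lambda>x. f (x + z n) + g (x + z n) - (f x + g x))) \<longlonglongrightarrow> 0" by (simp add: L2_lim_def)
qed

lemma trans_cont_zero: "trans_cont (\<lambda>x. 0)"
  by (simp add: trans_cont_def nrm_def ip_def)

lemma trans_cont_sum: "(\<And>i. i \<in> I \<Longrightarrow> trans_cont (f i)) \<Longrightarrow> trans_cont (\<lambda>x. \<Sum>i\<in>I. f i x)"
  by (induction I rule: infinite_finite_induct) (auto intro: trans_cont_add trans_cont_zero)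

text \<open>A three-epsilon argument: translation preserves the seminorm, so the error of the
  approximation is the same before and after the shift.\<close>

lemma trans_cont_limit:
  assumes "L2v f" "\<And>e. e > 0 \<Longrightarrow> \<exists>g. trans_cont g \<and> nrm (\<lambda>x. f x - g x) < e"
  shows "trans_cont f"
  unfolding trans_cont_def
proof (intro conjI allI impI)
  fix z :: "nat \<Rightarrow> 'a" assume z: "z \<longlonglongrightarrow> 0"
  show "(\<lambda>n. nrm (\<lambda>x. f (x + z n) - f x)) \<longlonglongrightarrow> 0"
  proof (rule LIMSEQ_I)
    fix r :: real assume "0 < r"
    then obtain g where g: "trans_cont g" "nrm (\<lambda>x. f x - g x) < r / 3" using assms(2)[of "r/3"] by auto
    then have Lg: "L2v g" by (simp add: trans_cont_def)
    have "(\<lambda>n. nrm (\<lambda>x. g (x + z n) - g x)) \<longlonglongrightarrow> 0" using g(1) z by (simp add: trans_cont_def)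
    then obtain N where N: "nrm (\<lambda>x. g (x + z n) - g x) < r / 3" if "n \<ge> N" for n
      using LIMSEQ_D[of _ 0 "r/3"] \<open>0 < r\<close> by fastforce
    have "nrm (\<lambda>x. f (x + z n) - f x) < r" if "n \<ge> N" for n
    proof -
      have "nrm (\<lambda>x. f (x + z n) - f x)
        = nrm (\<lambda>x. (f (x + z n) - g (x + z n)) + ((g (x + z n) - g x) + (g x - f x)))" by simp
      also have "\<dots> \<le> nrm (\<lambda>x. f (x + z n) - g (x + z n)) + nrm (\<lambda>x. (g (x + z n) - g x) + (g x - f x))"
        using assms(1) Lg by (intro nrm_triangle L2v_add L2v_diff L2v_translate)
      also have "nrm (\<lambda>x. (g (x + z n) - g x) + (g x - f x)) \<le> nrm (\<lambda>x. g (x + z n) - g x) + nrm (\<lambda>x. g x - f x)"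
        using assms(1) Lg by (intro nrm_triangle L2v_add L2v_diff L2v_translate)
      also have "nrm (\<lambda>x. f (x + z n) - g (x + z n)) = nrm (\<lambda>x. f x - g x)"
        using nrm_translate[OF L2v_diff[OF assms(1) Lg], of "z n"] .
      finally show ?thesis using g(2) N[OF that] nrm_minus_commute[of g f] by linarith
    qed
    then show "\<exists>N. \<forall>n\<ge>N. norm (nrm (\<lambda>x. f (x + z n) - f x) - 0) < r" by auto
  qed
qed (fact assms(1))

lemma L2v_indicator_const:
  assumes "A \<in> sets borel" "emeasure lborel A < \<infinity>"
  shows "L2v (\<lambda>x. indicator A x *\<^sub>R c)"
proof -
  have "integrable lborel (\<lambda>x. indicator A x *\<^sub>R ((norm c)\<^sup>2))"
    using assms by (intro integrable_indicator) auto
  moreover have "(norm (indicator A x *\<^sub>R c))\<^sup>2 = indicator A x *\<^sub>R ((norm c)\<^sup>2)" for x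
    by (auto simp: indicator_def)
  ultimately show ?thesis using assms by (simp add: L2v_def)
qed

text \<open>A point of an open set stays in it under small shifts, so dominated convergence handles
  the points that leave U. The points that enter U are reduced to this case by the opposite shift,
  \<open>- z n\<close>.\<close>

lemma trans_cont_open:
  assumes "open U" "emeasure lborel U < \<infinity>"
  shows "trans_cont (\<lambda>x. indicator U x *\<^sub>R c)"
  unfolding trans_cont_def
proof (intro conjI allI impI)
  have U: "U \<in> sets borel" using assms(1) by simp
  show L: "L2v (\<lambda>x. indicator U x *\<^sub>R c)" using L2v_indicator_const[OF U assms(2)] .
  fix z :: "nat \<Rightarrow> 'a" assume z: "z \<longlonglongrightarrow> 0"
  have int: "integrable lborel (indicator U :: 'a \<Rightarrow> real)"
    using assms U by (intro integrable_real_indicator) auto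
  have lim: "(\<lambda>n. LBINT x. indicator U x * (1 - indicator U (x + w n))) \<longlonglongrightarrow> (0::real)"
    if w: "w \<longlonglongrightarrow> 0" for w :: "nat \<Rightarrow> 'a"
  proof -
    have "(\<lambda>n. LBINT x. indicator U x * (1 - indicator U (x + w n))) \<longlonglongrightarrow> (LINT x|(lborel::'a measure). (0::real))"
    proof (rule integral_dominated_convergence[where w="indicator U"])
      show "AE x in lborel. (\<lambda>n. indicator U x * (1 - indicator U (x + w n))) \<longlonglongrightarrow> (0::real)"
      proof (rule AE_I2)
        fix x show "(\<lambda>n. indicator U x * (1 - indicator U (x + w n))) \<longlonglongrightarrow> (0::real)"
        proof (cases "x \<in> U")
          case True
          have "(\<lambda>n. x + w n) \<longlonglongrightarrow> x" using tendsto_add[OF tendsto_const w, of x] by simp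
          then have "\<forall>\<^sub>F n in sequentially. x + w n \<in> U"
            using assms(1) True by (simp add: tendsto_def)
          then show ?thesis
            by (intro tendsto_eventually) (simp add: eventually_mono)
        qed simp
      qed
    qed (use int U in \<open>auto simp: indicator_def\<close>)
    then show ?thesis by simp
  qed
  have eq: "(nrm (\<lambda>x. indicator U (x + z n) *\<^sub>R c - indicator U x *\<^sub>R c))\<^sup>2 =
      (norm c)\<^sup>2 * ((LBINT x. indicator U x * (1 - indicator U (x + z n)))
        + (LBINT x. indicator U x * (1 - indicator U (x + - z n))))" for n
  proof -
    have i1: "integrable lborel (\<lambda>x. indicator U x * (1 - indicator U (x + w)) :: real)" for w
      by (rule Bochner_Integration.integrable_bound[OF int]) (use U in \<open>auto simp: indicator_def\<close>)
    have "(LBINT x. indicator U x * (1 - indicator U (x + - z n)) :: real)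
        = (LBINT x. indicator U (x + z n) * (1 - indicator U x))"
      using integral_translate[of "\<lambda>x. indicator U x * (1 - indicator U (x + - z n)) :: real" "z n"] U
      by (simp add: add.assoc)
    moreover have "integrable lborel (\<lambda>x. indicator U (x + z n) * (1 - indicator U x) :: real)"
      using integrable_translate[OF i1[of "- z n"], of "z n"] by (simp add: add.assoc)
    moreover have "(nrm (\<lambda>x. indicator U (x + z n) *\<^sub>R c - indicator U x *\<^sub>R c))\<^sup>2 = (LBINT x. 
        (norm c)\<^sup>2 * (indicator U x * (1 - indicator U (x + z n)) + indicator U (x + z n) * (1 - indicator U x)))"
      unfolding nrm_sq ip_def
      by (rule Bochner_Integration.integral_cong) (auto simp: indicator_def power2_norm_eq_inner)
    ultimately show ?thesis using i1[of "z n"] by simp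
  qed
  have "(\<lambda>n. (nrm (\<lambda>x. indicator U (x + z n) *\<^sub>R c - indicator U x *\<^sub>R c))\<^sup>2) \<longlonglongrightarrow> (norm c)\<^sup>2 * (0 + 0)"
    unfolding eq by (intro tendsto_intros lim z) (use tendsto_minus[OF z] in simp)
  then have "(\<lambda>n. sqrt ((nrm (\<lambda>x. indicator U (x + z n) *\<^sub>R c - indicator U x *\<^sub>R c))\<^sup>2)) \<longlonglongrightarrow> sqrt 0"
    by (intro tendsto_real_sqrt) simp
  then show "(\<lambda>n. nrm (\<lambda>x. indicator U (x + z n) *\<^sub>R c - indicator U x *\<^sub>R c)) \<longlonglongrightarrow> 0" by simp
qed

lemma trans_cont_indicator:
  assumes "A \<in> sets borel" "emeasure lborel A < \<infinity>"
  shows "trans_cont (\<lambda>x. indicator A x *\<^sub>R c)"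
proof (rule trans_cont_limit)
  show "L2v (\<lambda>x. indicator A x *\<^sub>R c)" by (rule L2v_indicator_const[OF assms])
  fix e :: real assume e: "e > 0"
  \<comment> \<open>Adding 1 in the denominator covers \<open>c = 0\<close> and makes the final
    bound \<open>norm c * e / (norm c + 1)\<close> strictly smaller than e.\<close>
  define d where "d = (e / (norm c + 1))\<^sup>2"
  have np: "norm c + 1 > 0" by (simp add: add_nonneg_pos)
  then have "d > 0" using e by (simp add: d_def)
  then obtain U where U: "open U" "A \<subseteq> U" "emeasure lborel (U - A) < ennreal d"
    using outer_regular_lborel[of A d] assms(1) by auto
  have UA: "U - A \<in> sets borel" using U assms by auto
  have "emeasure lborel U \<le> emeasure lborel A + emeasure lborel (U - A)"
  proof -
    have "U = A \<union> (U - A)" using U by auto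
    then show ?thesis using emeasure_subadditive[of A lborel "U - A"] assms UA by auto
  qed
  then have fU: "emeasure lborel U < \<infinity>"
    using assms(2) order.strict_trans[OF U(3) ennreal_less_top] by (simp add: order.strict_trans1)
  have "(nrm (\<lambda>x. indicator A x *\<^sub>R c - indicator U x *\<^sub>R c))\<^sup>2 = (LBINT x. (norm c)\<^sup>2 * indicator (U - A) x)"
    unfolding nrm_sq ip_def
    by (rule Bochner_Integration.integral_cong) (use U(2) in \<open>auto simp: indicator_def power2_norm_eq_inner\<close>)
  also have "\<dots> = (norm c)\<^sup>2 * measure lborel (U - A)" using UA by simp
  also have "\<dots> \<le> (norm c)\<^sup>2 * d"
    using U(3) \<open>d > 0\<close> by (intro mult_left_mono) (auto simp: measure_def enn2real_leI less_imp_le)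
  also have "\<dots> = (norm c * e / (norm c + 1))\<^sup>2" by (simp add: d_def power_mult_distrib power_divide)
  also have "\<dots> < e\<^sup>2" using e np by (intro power_strict_mono) (auto simp: field_simps)
  finally have "nrm (\<lambda>x. indicator A x *\<^sub>R c - indicator U x *\<^sub>R c) < e"
    using e by (simp add: power2_less_imp_less)
  then show "\<exists>g. trans_cont g \<and> nrm (\<lambda>x. indicator A x *\<^sub>R c - g x) < e"
    using trans_cont_open[OF U(1) fU] by blast
qed

text \<open>Density carries the property from open sets to Borel sets of finite measure, then to
  simple functions, then to all square integrable functions.\<close>

lemma L2v_trans_cont:
  fixes f :: "'a::euclidean_space \<Rightarrow> 'b::euclidean_space"
  assumes "L2v f" shows "trans_cont f"
proof (rule trans_cont_limit[OF assms])
  fix e :: real assume e: "e > 0"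
  have fm: "f \<in> borel_measurable lborel" using assms by (simp add: L2v_def)
  obtain s where s: "\<And>i. simple_function lborel (s i)" "\<And>x. (\<lambda>i. s i x) \<longlonglongrightarrow> f x"
    "\<And>i x. dist (s i x) 0 \<le> 2 * dist (f x) 0"
    using borel_measurable_implies_sequence_metric[OF fm, of 0] by auto
  have sm: "s i \<in> borel_measurable borel" for i
    using borel_measurable_simple_function[OF s(1)] by simp
  have Ls: "L2v (s i)" for i by (rule L2v_bound[OF sm assms, of i 2]) (use s(3) in auto)
  \<comment> \<open>The constant 9 below is the square of 3: \<open>s i\<close> is bounded by twice
    the norm of f, hence the difference by three times.\<close>
  have "(\<lambda>i. LBINT x. (f x - s i x) \<bullet> (f x - s i x)) \<longlonglongrightarrow> (LINT x|(lborel::'a measure). (0::real))"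
  proof (rule integral_dominated_convergence[where w="\<lambda>x. 9 * (norm (f x))\<^sup>2"])
    show "integrable lborel (\<lambda>x. 9 * (norm (f x))\<^sup>2)" using assms by (simp add: L2v_def)
    have "(\<lambda>i. f x - s i x) \<longlonglongrightarrow> 0" for x
      using tendsto_diff[OF tendsto_const s(2), of "f x" x] by simp
    then show "AE x in lborel. (\<lambda>i. (f x - s i x) \<bullet> (f x - s i x)) \<longlonglongrightarrow> 0"
      using tendsto_inner[of "\<lambda>i. f x - s i x" 0 _ "\<lambda>i. f x - s i x" 0 for x] by auto
    show "AE x in lborel. norm ((f x - s i x) \<bullet> (f x - s i x)) \<le> 9 * (norm (f x))\<^sup>2" for i
    proof (rule AE_I2)
      fix x
      have "norm (f x - s i x) \<le> 3 * norm (f x)" using s(3)[of i x] norm_triangle_ineq4[of "f x" "s i x"] by simp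
      then have "(norm (f x - s i x))\<^sup>2 \<le> (3 * norm (f x))\<^sup>2" by (rule power_mono) simp
      then show "norm ((f x - s i x) \<bullet> (f x - s i x)) \<le> 9 * (norm (f x))\<^sup>2"
        by (simp add: power2_norm_eq_inner[symmetric] power_mult_distrib)
    qed
  qed (use fm sm in auto)
  then have "(\<lambda>i. sqrt (ip (\<lambda>x. f x - s i x) (\<lambda>x. f x - s i x))) \<longlonglongrightarrow> sqrt 0"
    by (intro tendsto_real_sqrt) (simp add: ip_def)
  then have "(\<lambda>i. nrm (\<lambda>x. f x - s i x)) \<longlonglongrightarrow> 0" by (simp add: nrm_def)
  then obtain i where i: "nrm (\<lambda>x. f x - s i x) < e" using LIMSEQ_D[of _ 0 e] e by fastforce
  have fin: "finite (range (s i))" using simple_functionD(1)[OF s(1)[of i]] by simp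
  have rep: "s i = (\<lambda>x. \<Sum>c\<in>range (s i). indicator (s i -` {c}) x *\<^sub>R c)"
  proof
    fix x
    have "(\<Sum>c\<in>range (s i). indicator (s i -` {c}) x *\<^sub>R c) = (\<Sum>c\<in>range (s i). if c = s i x then c else 0)"
      by (rule sum.cong) (auto simp: indicator_def)
    then show "s i x = (\<Sum>c\<in>range (s i). indicator (s i -` {c}) x *\<^sub>R c)" using fin by simp
  qed
  \<comment> \<open>The level set of 0 may have infinite measure but contributes nothing. Every
    other level set has finite measure by Chebyshev's inequality.\<close>
  have "trans_cont (\<lambda>x. indicator (s i -` {c}) x *\<^sub>R c)" for c
  proof (cases "c = 0")
    case True
    then show ?thesis by (simp add: trans_cont_zero)
  next
    case False
    have m: "s i -` {c} \<in> sets borel" using measurable_sets[OF sm[of i], of "{c}"] by simp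
    have "integrable lborel (\<lambda>x. indicator (s i -` {c}) x * (norm c)\<^sup>2)"
    proof (rule Bochner_Integration.integrable_bound)
      show "integrable lborel (\<lambda>x. (norm (s i x))\<^sup>2)" using Ls[of i] by (simp add: L2v_def)
      show "(\<lambda>x. indicator (s i -` {c}) x * (norm c)\<^sup>2) \<in> borel_measurable lborel" using m by simp
    qed (auto simp: indicator_def)
    then have "integrable lborel (\<lambda>x. inverse ((norm c)\<^sup>2) * (indicator (s i -` {c}) x * (norm c)\<^sup>2))"
      by (rule integrable_mult_right)
    then have "integrable lborel (indicator (s i -` {c}) :: 'a \<Rightarrow> real)"
      using False by (simp add: field_simps)
    then have "emeasure lborel (s i -` {c}) < \<infinity>" using m by (simp add: integrable_indicator_iff)
    then show ?thesis using trans_cont_indicator[OF m] by blast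
  qed
  then have "trans_cont (s i)" by (subst rep) (rule trans_cont_sum)
  then show "\<exists>g. trans_cont g \<and> nrm (\<lambda>x. f x - g x) < e" using i by blast
qed

subsection \<open>Gradients and test functions\<close>

definition grad :: "('a::euclidean_space \<Rightarrow> real) \<Rightarrow> 'a \<Rightarrow> 'a" where
  "grad f x = (\<Sum>b\<in>Basis. partial b f x *\<^sub>R b)"

lemma grad_inner: "b \<in> Basis \<Longrightarrow> grad f x \<bullet> b = partial b f x"
  by (simp add: grad_def inner_sum_left inner_Basis if_distrib cong: if_cong)

lemma grad_eqI: assumes "(f has_derivative (\<lambda>h. w \<bullet> h)) (at x)" shows "grad f x = w"
  by (rule euclidean_eqI) (simp add: grad_inner partial_eqI[OF assms])

lemma has_derivative_grad:
  assumes "Ck (Suc k) f" shows "(f has_derivative (\<lambda>h. grad f x \<bullet> h)) (at x)"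
proof -
  have d: "(f has_derivative (\<lambda>b. partial b f x)) (at x)" by (rule Ck_has_derivative[OF assms])
  then have lin: "linear (\<lambda>b. partial b f x)" by (simp add: has_derivative_linear)
  have "partial h f x = grad f x \<bullet> h" for h
  proof -
    have "partial h f x = partial (\<Sum>b\<in>Basis. (h \<bullet> b) *\<^sub>R b) f x" by (simp only: euclidean_representation)
    also have "\<dots> = (\<Sum>b\<in>Basis. (h \<bullet> b) * partial b f x)"
      using linear_sum[OF lin, of "\<lambda>b. (h \<bullet> b) *\<^sub>R b" Basis] by (simp add: linear_scale[OF lin])
    also have "\<dots> = grad f x \<bullet> h"
      unfolding grad_def inner_sum_left by (rule sum.cong) (auto simp: inner_commute)
    finally show ?thesis .
  qed
  then show ?thesis using d by simp
qed

lemma grad_mult: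
  assumes "Ck (Suc k) f" "Ck (Suc k) g"
  shows "grad (\<lambda>x. f x * g x) x = f x *\<^sub>R grad g x + g x *\<^sub>R grad f x"
proof (rule grad_eqI)
  show "((\<lambda>x. f x * g x) has_derivative (\<lambda>h. (f x *\<^sub>R grad g x + g x *\<^sub>R grad f x) \<bullet> h)) (at x)"
    using has_derivative_mult[OF has_derivative_grad[OF assms(1), of x] has_derivative_grad[OF assms(2), of x]]
    by (simp add: inner_add_left mult.commute)
qed

lemma grad_compose:
  assumes "smooth_seq D" "(g has_derivative (\<lambda>h. w \<bullet> h)) (at x)"
  shows "grad (\<lambda>x. D n (g x)) x = D (Suc n) (g x) *\<^sub>R w"
proof (rule grad_eqI)
  show "((\<lambda>x. D n (g x)) has_derivative (\<lambda>h. (D (Suc n) (g x) *\<^sub>R w) \<bullet> h)) (at x)"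
    using has_derivative_compose[OF assms(2) smooth_seqD[OF assms(1), unfolded has_field_derivative_def]] by simp
qed

lemma Ck_affine:
  assumes "Ck k f" shows "Ck k (\<lambda>x. f (s *\<^sub>R x + c))"
  using assms
proof (induction k arbitrary: f)
  case 0
  have "continuous_on UNIV (\<lambda>x. s *\<^sub>R x + c)" by (intro continuous_intros)
  then show ?case using 0 continuous_on_compose2[of UNIV f UNIV "\<lambda>x. s *\<^sub>R x + c"] by simp
next
  case (Suc k)
  have lin: "linear (\<lambda>b. partial b f x)" for x
    using Ck_has_derivative[OF Suc.prems] has_derivative_linear by blast
  have "((\<lambda>x. f (s *\<^sub>R x + c)) has_derivative (\<lambda>b. s * partial b f (s *\<^sub>R x + c))) (at x)" for x
  proof -
    have g: "((\<lambda>x. s *\<^sub>R x + c) has_derivative (\<lambda>h. s *\<^sub>R h)) (at x)"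
      by (auto intro!: derivative_eq_intros)
    show ?thesis
      using has_derivative_compose[OF g Ck_has_derivative[OF Suc.prems]]
      by (simp add: linear_scale[OF lin])
  qed
  moreover have "Ck k (\<lambda>x. s * partial b f (s *\<^sub>R x + c))" if "b \<in> Basis" for b
    using Suc that by (intro Ck_mult Ck_const) auto
  ultimately show ?case by (rule Ck_SucI)
qed

lemma grad_affine:
  assumes "Ck (Suc k) f" shows "grad (\<lambda>x. f (s *\<^sub>R x + c)) x = s *\<^sub>R grad f (s *\<^sub>R x + c)"
proof (rule grad_eqI)
  have g: "((\<lambda>x. s *\<^sub>R x + c) has_derivative (\<lambda>h. s *\<^sub>R h)) (at x)"
    by (auto intro!: derivative_eq_intros)
  show "((\<lambda>x. f (s *\<^sub>R x + c)) has_derivative (\<lambda>h. (s *\<^sub>R grad f (s *\<^sub>R x + c)) \<bullet> h)) (at x)"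
    using has_derivative_compose[OF g has_derivative_grad[OF assms]] by simp
qed

lemma Ck_norm_sq: "Ck k (\<lambda>x::'a::euclidean_space. x \<bullet> x)"
proof (cases k)
  case 0
  then show ?thesis by (auto intro!: continuous_intros)
next
  case (Suc n)
  have "((\<lambda>x::'a. x \<bullet> x) has_derivative (\<lambda>h. (2 *\<^sub>R x) \<bullet> h)) (at x)" for x
    by (auto intro!: derivative_eq_intros simp: inner_commute)
  then show ?thesis unfolding Suc
    by (rule Ck_SucI) (intro Ck_linear bounded_linear_intros)
qed

section \<open>Test functions and mollifiers\<close>

lemma fsuppI: "f x \<noteq> 0 \<Longrightarrow> x \<in> fsupp f"
  using closure_subset[of "{x. f x \<noteq> 0}"] by (auto simp: fsupp_def)

lemma test_functionI:
  assumes "\<And>k. Ck k f" "\<And>x. norm x > r \<Longrightarrow> f x = 0"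
  shows "test_function f"
proof -
  have "fsupp f \<subseteq> cball 0 r" unfolding fsupp_def
    by (rule closure_minimal) (use assms(2) in \<open>force simp: not_less[symmetric]\<close>, simp)
  then have "compact (fsupp f)"
    using compact_Int_closed[OF compact_cball[of "0::'a" r], of "fsupp f"]
    by (simp add: fsupp_def Int_absorb1)
  then show ?thesis using assms(1) by (simp add: test_function_def)
qed

lemma test_function_Ck: "test_function f \<Longrightarrow> Ck k f" by (simp add: test_function_def)

lemma test_function_bounded_support:
  assumes "test_function f" obtains r where "r > 0" "\<And>x. norm x > r \<Longrightarrow> f x = 0"
proof -
  have "bounded (fsupp f)" using assms compact_imp_bounded by (auto simp: test_function_def)
  then obtain r where "r > 0" "\<And>x. x \<in> fsupp f \<Longrightarrow> norm x \<le> r" by (auto simp: bounded_pos)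
  then show thesis using that[of r] fsuppI[of f] by force
qed

lemma test_function_continuous: "test_function f \<Longrightarrow> continuous_on S f"
  using Ck_continuous test_function_Ck continuous_on_subset by blast

lemma test_function_mult:
  assumes "\<And>k. Ck k g" "test_function f" shows "test_function (\<lambda>x. g x * f x)"
proof -
  obtain r where "\<And>x. norm x > r \<Longrightarrow> f x = 0" using test_function_bounded_support[OF assms(2)] by metis
  then show ?thesis
    by (intro test_functionI[of _ r] Ck_mult assms(1) test_function_Ck[OF assms(2)]) auto
qed

lemma compact_image_bound:
  fixes f :: "'a::topological_space \<Rightarrow> 'b::real_normed_vector"
  assumes "compact K" "continuous_on K f" obtains c where "\<And>x. x \<in> K \<Longrightarrow> norm (f x) \<le> c"
  using compact_imp_bounded[OF compact_continuous_image[OF assms(2,1)]] unfolding bounded_iff by blast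

lemma test_function_bounded:
  assumes "test_function f" obtains c where "\<And>x. \<bar>f x\<bar> \<le> c"
proof -
  obtain r where r: "\<And>x. norm x > r \<Longrightarrow> f x = 0" using test_function_bounded_support[OF assms] by metis
  obtain c where c: "\<And>x. x \<in> cball 0 r \<Longrightarrow> norm (f x) \<le> c"
    by (rule compact_image_bound[OF compact_cball test_function_continuous[OF assms]]) blast
  have "\<bar>f x\<bar> \<le> max c 0" for x using r[of x] c[of x] by (cases "norm x > r") auto
  then show thesis by (rule that)
qed

lemma has_derivative_outside_ball:
  fixes f :: "'a::euclidean_space \<Rightarrow> real"
  assumes "\<And>x. norm x > r \<Longrightarrow> f x = 0" "norm x > r" shows "(f has_derivative (\<lambda>h. 0)) (at x)"
proof -
  have "open {x::'a. norm x > r}" by (intro open_Collect_less continuous_intros)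
  then show ?thesis
    using has_derivative_transform_within_open[of "\<lambda>_. 0" "\<lambda>_. 0" x UNIV "{x. norm x > r}" f] assms by auto
qed

lemma test_function_partial:
  assumes "test_function f" "b \<in> Basis" shows "test_function (partial b f)"
proof -
  obtain r where r: "\<And>x. norm x > r \<Longrightarrow> f x = 0" using test_function_bounded_support[OF assms(1)] by metis
  have "partial b f x = 0" if "norm x > r" for x
    using partial_eqI[OF has_derivative_outside_ball[OF r that]] .
  then show ?thesis
    using assms(2) test_function_Ck[OF assms(1), of "Suc k" for k] by (intro test_functionI[of _ r]) auto
qed

lemma test_function_affine:
  fixes f :: "'a::euclidean_space \<Rightarrow> real"
  assumes "test_function f" "s \<noteq> 0" shows "test_function (\<lambda>x. f (s *\<^sub>R x + c))"
proof -
  obtain r where r: "\<And>x. norm x > r \<Longrightarrow> f x = 0" using test_function_bounded_support[OF assms(1)] by metis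
  show ?thesis
  proof (rule test_functionI[of _ "(\<bar>r\<bar> + norm c) / \<bar>s\<bar>"])
    fix x :: 'a assume "(\<bar>r\<bar> + norm c) / \<bar>s\<bar> < norm x"
    then have "\<bar>r\<bar> + norm c < norm (s *\<^sub>R x)" using assms(2) by (simp add: field_simps)
    then have "norm (s *\<^sub>R x + c) > r" using norm_diff_ineq[of "s *\<^sub>R x" c] by simp
    then show "f (s *\<^sub>R x + c) = 0" by (rule r)
  qed (intro Ck_affine test_function_Ck assms)
qed

lemma continuous_bounded_support_integrable:
  fixes f :: "'a::euclidean_space \<Rightarrow> real"
  assumes "continuous_on UNIV f" "\<And>x. norm x > r \<Longrightarrow> f x = 0"
  shows "integrable lborel f"
proof -
  have "set_integrable lborel (cball 0 r) f"
    unfolding set_integrable_def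
    by (rule borel_integrable_compact) (use assms(1) continuous_on_subset in auto)
  then show ?thesis unfolding set_integrable_def
    by (rule Bochner_Integration.integrable_cong[THEN iffD1, rotated 2])
      (use assms(2) in \<open>auto simp: indicator_def not_le\<close>)
qed

lemma test_function_measurable: "test_function f \<Longrightarrow> f \<in> borel_measurable borel"
  using test_function_continuous borel_measurable_continuous_onI by blast

lemma test_function_integrable: "test_function f \<Longrightarrow> integrable lborel f"
  using test_function_bounded_support continuous_bounded_support_integrable test_function_continuous by metis

lemma test_function_L2v: assumes "test_function f" shows "L2v f"
proof -
  obtain r where r: "\<And>x. norm x > r \<Longrightarrow> f x = 0" using test_function_bounded_support[OF assms] by metis
  have "integrable lborel (\<lambda>x. (f x)\<^sup>2)"
    by (rule continuous_bounded_support_integrable[of _ r])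
       (use r test_function_continuous[OF assms] in \<open>auto intro!: continuous_intros\<close>)
  then show ?thesis by (simp add: L2v_def test_function_measurable[OF assms])
qed

lemma grad_continuous: assumes "Ck (Suc k) f" shows "continuous_on S (grad f)"
proof -
  have "continuous_on S (partial b f)" if "b \<in> Basis" for b
    using assms that Ck_continuous[of k "partial b f"] continuous_on_subset by auto
  then have "continuous_on S (\<lambda>x. \<Sum>b\<in>Basis. partial b f x *\<^sub>R b)" by (intro continuous_intros)
  then show ?thesis by (simp add: grad_def[abs_def])
qed

lemma test_function_grad_L2v: assumes "test_function f" shows "L2v (grad f)"
proof -
  have "L2v (\<lambda>x. partial b f x *\<^sub>R b)" if "b \<in> Basis" for b
    by (rule L2v_bound[OF _ test_function_L2v[OF test_function_partial[OF assms that]], of _ 1])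
       (use that test_function_measurable[OF test_function_partial[OF assms that]] in auto)
  then have "L2v (\<lambda>x. \<Sum>b\<in>Basis. partial b f x *\<^sub>R b)" by (rule L2v_sum)
  then show ?thesis by (simp add: grad_def[abs_def])
qed

lemma continuous_AE_zero:
  fixes f :: "'a::euclidean_space \<Rightarrow> 'b::euclidean_space"
  assumes "continuous_on UNIV f" "AE x in lborel. f x = 0"
  shows "f x = 0"
proof (rule ccontr)
  assume "f x \<noteq> 0"
  have o: "open {x. f x \<noteq> 0}" by (intro open_Collect_neq assms continuous_intros)
  have "emeasure lborel {x. f x \<noteq> 0} = 0"
    using assms(2) by (subst (asm) AE_iff_measurable[OF _ refl]) (use o in auto)
  then have "negligible {x. f x \<noteq> 0}"
    using o by (simp add: negligible_iff_null_sets null_sets_def emeasure_completion)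
  then show False using open_not_negligible[OF o] \<open>f x \<noteq> 0\<close> by blast
qed

lemma mollifier_exists:
  fixes d :: real assumes "d > 0"
  obtains r :: "'a::euclidean_space \<Rightarrow> real" where "test_function r" "\<And>x. r x \<ge> 0"
    "\<And>x. norm x \<ge> d \<Longrightarrow> r x = 0" "(LBINT x. r x) = 1"
proof -
  obtain D where D: "smooth_seq D" "\<And>n x. x \<le> 0 \<Longrightarrow> D n x = 0" "\<And>x. x \<ge> 1 \<Longrightarrow> D 0 x = 1" "\<And>x. 0 \<le> D 0 x"
    by (rule smooth_step) blast
  \<comment> \<open>The argument of the step is 1 at the origin and nonpositive outside the ball of
    radius d. Working with \<open>x \<bullet> x\<close> keeps s smooth at the origin.\<close>
  define s where "s x = D 0 (1 - inverse (d\<^sup>2) * (x \<bullet> x))" for x :: 'a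
  have k: "Ck k s" for k
    unfolding s_def
    using Ck_compose[OF D(1) Ck_add[OF Ck_const[of k 1] Ck_mult[OF Ck_const[of k "- inverse (d\<^sup>2)"] Ck_norm_sq]], of 0]
    by simp
  have z: "s x = 0" if "norm x \<ge> d" for x
  proof -
    have "d\<^sup>2 \<le> x \<bullet> x" using power_mono[OF that, of 2] assms by (simp add: power2_norm_eq_inner)
    then show ?thesis unfolding s_def by (intro D(2)) (use assms in \<open>simp add: field_simps\<close>)
  qed
  have t: "test_function s" by (rule test_functionI[OF k, of d]) (use z in auto)
  have nn: "s x \<ge> 0" for x by (simp add: s_def D(4))
  have "(LBINT x. s x) \<noteq> 0"
  proof
    assume "(LBINT x. s x) = 0"
    then have "AE x in lborel. s x = 0"
      using integral_nonneg_eq_0_iff_AE[OF test_function_integrable[OF t]] nn by simp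
    then have "s 0 = 0" using continuous_AE_zero[OF test_function_continuous[OF t]] by blast
    then show False using D(3)[of 1] by (simp add: s_def)
  qed
  moreover have "(LBINT x. s x) \<ge> 0" using nn by simp
  ultimately have pos: "(LBINT x. s x) > 0" by simp
  show thesis
  proof (rule that[of "\<lambda>x. inverse (LBINT x. s x) * s x"])
    show "test_function (\<lambda>x. inverse (LBINT x. s x) * s x)" by (rule test_function_mult[OF Ck_const t])
  qed (use pos nn z in auto)
qed

subsection \<open>Convolution kernels\<close>

text \<open>Each kernel has one factor in \<open>x - y\<close> and one in a single variable, so
  integrating the absolute value in the other variable first leaves a product of finite
  integrals.\<close>

lemma integrable_kernel:
  fixes p q :: "'a::euclidean_space \<Rightarrow> real"
  assumes p: "integrable lborel p" and q: "integrable lborel q"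
  shows "integrable (lborel \<Otimes>\<^sub>M lborel) (\<lambda>(x, y). p (x - y) * q x)"
    and "integrable (lborel \<Otimes>\<^sub>M lborel) (\<lambda>(x, y). p (x - y) * q y)"
proof -
  have [measurable]: "p \<in> borel_measurable borel" "q \<in> borel_measurable borel" using p q by auto
  show "integrable (lborel \<Otimes>\<^sub>M lborel) (\<lambda>(x, y). p (x - y) * q x)"
  proof (rule lborel_pair.Fubini_integrable)
    have "(\<lambda>x. LBINT y. norm (case (x, y) of (x, y) \<Rightarrow> p (x - y) * q x))
        = (\<lambda>x. (LBINT y. \<bar>p y\<bar>) * \<bar>q x\<bar>)"
      using integral_reflect[of "\<lambda>y. \<bar>p y\<bar>"] by (simp add: abs_mult)
    then show "integrable lborel (\<lambda>x. LBINT y. norm (case (x, y) of (x, y) \<Rightarrow> p (x - y) * q x))"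
      using q by simp
    show "AE x in lborel. integrable lborel (\<lambda>y. case (x, y) of (x, y) \<Rightarrow> p (x - y) * q x)"
      using integrable_reflect[OF p] by simp
  qed measurable
  have "integrable (lborel \<Otimes>\<^sub>M lborel) (\<lambda>(y, x). p (x - y) * q y)"
  proof (rule lborel_pair.Fubini_integrable)
    have "(\<lambda>y. LBINT x. norm (case (y, x) of (y, x) \<Rightarrow> p (x - y) * q y))
        = (\<lambda>y. (LBINT x. \<bar>p x\<bar>) * \<bar>q y\<bar>)"
      using integral_translate[of "\<lambda>y. \<bar>p y\<bar>" "- x" for x] by (simp add: abs_mult)
    then show "integrable lborel (\<lambda>y. LBINT x. norm (case (y, x) of (y, x) \<Rightarrow> p (x - y) * q y))"
      using q by simp
    show "AE y in lborel. integrable lborel (\<lambda>x. case (y, x) of (y, x) \<Rightarrow> p (x - y) * q y)"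
      using integrable_translate[OF p, of "- y" for y] by simp
  qed measurable
  then show "integrable (lborel \<Otimes>\<^sub>M lborel) (\<lambda>(x, y). p (x - y) * q y)"
    using lborel_pair.integrable_product_swap[of "\<lambda>(y, x). p (x - y) * q y"] by simp
qed

text \<open>The product of the two norms is at most the sum of their squares, which separates the
  variables and reduces the bound to the two forms of \<open>integrable_kernel\<close>. It justifies
  Fubini in the mollified Green identity.\<close>

lemma integrable_kernel_L2v:
  fixes f g :: "'a::euclidean_space \<Rightarrow> 'b::euclidean_space"
  assumes "L2v f" "L2v g" "integrable lborel k" "\<And>x. 0 \<le> k x"
    and [measurable]: "F \<in> borel_measurable (lborel \<Otimes>\<^sub>M lborel)"
    and b: "\<And>x y. \<bar>F (x, y)\<bar> \<le> k (x - y) * (norm (f x) * norm (g y))"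
  shows "integrable (lborel \<Otimes>\<^sub>M lborel) F"
proof (rule Bochner_Integration.integrable_bound)
  show "integrable (lborel \<Otimes>\<^sub>M lborel) (\<lambda>z. (case z of (x, y) \<Rightarrow> k (x - y) * (norm (f x))\<^sup>2)
      + (case z of (x, y) \<Rightarrow> k (x - y) * (norm (g y))\<^sup>2))"
    using assms by (intro Bochner_Integration.integrable_add integrable_kernel) (auto simp: L2v_def)
  have "\<bar>F (x, y)\<bar> \<le> k (x - y) * (norm (f x))\<^sup>2 + k (x - y) * (norm (g y))\<^sup>2" for x y
  proof -
    have "k (x - y) * (norm (f x) * norm (g y)) \<le> k (x - y) * ((norm (f x))\<^sup>2 + (norm (g y))\<^sup>2)"
      by (intro mult_left_mono norm_mult_bound_sq assms(4))
    then show ?thesis using b[of x y] by (simp add: algebra_simps)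
  qed
  then show "AE z in lborel \<Otimes>\<^sub>M lborel. norm (F z) \<le> norm ((case z of (x, y) \<Rightarrow> k (x - y) * (norm (f x))\<^sup>2)
      + (case z of (x, y) \<Rightarrow> k (x - y) * (norm (g y))\<^sup>2))"
    using assms(4) by (intro AE_I2) (auto intro: order_trans[OF _ abs_ge_self])
qed measurable

lemma trans_cont_small:
  assumes "L2v f" "e > 0"
  obtains d where "d > 0" "\<And>z. norm z < d \<Longrightarrow> nrm (\<lambda>x. f (x + z) - f x) < e"
proof (rule ccontr)
  assume "\<not> thesis"
  then have "\<exists>z. norm z < inverse (real (Suc n)) \<and> \<not> nrm (\<lambda>x. f (x + z) - f x) < e" for n
    using that[of "inverse (real (Suc n))"] by force
  then obtain z where z: "\<And>n. norm (z n) < inverse (real (Suc n))" "\<And>n. \<not> nrm (\<lambda>x. f (x + z n) - f x) < e"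
    by metis
  have "z \<longlonglongrightarrow> 0"
    by (rule Lim_null_comparison[OF _ LIMSEQ_inverse_real_of_nat])
       (use z(1) in \<open>simp add: less_imp_le del: of_nat_Suc\<close>)
  then have "(\<lambda>n. nrm (\<lambda>x. f (x + z n) - f x)) \<longlonglongrightarrow> 0"
    using L2v_trans_cont[OF assms(1)] by (simp add: trans_cont_def)
  then show False using LIMSEQ_D[of _ 0 e] assms(2) z(2) by fastforce
qed

text \<open>With \<open>z = x - y\<close> the double integral becomes an average over z of the
  pairing of f with g translated by z. The weights concentrate at 0, where translation is
  continuous.\<close>

lemma mollify_tendsto:
  fixes f g :: "'a::euclidean_space \<Rightarrow> 'b::euclidean_space"
  assumes f: "L2v f" and g: "L2v g" and r: "\<And>n. integrable lborel (r n)" "\<And>n x. (0::real) \<le> r n x"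
    "\<And>n x. norm x \<ge> d n \<Longrightarrow> r n x = 0" "\<And>n. (LBINT x. r n x) = 1" and d: "d \<longlonglongrightarrow> 0"
  shows "(\<lambda>n. LBINT x. LBINT y. r n (x - y) * (f x \<bullet> g y)) \<longlonglongrightarrow> ip f g"
proof -
  have [measurable]: "f \<in> borel_measurable borel" "g \<in> borel_measurable borel" "r n \<in> borel_measurable borel" for n
    using f g r(1) by (auto simp: L2v_def)
  have gz: "L2v (\<lambda>x. g (x - z))" for z using L2v_translate[OF g, of "- z"] by simp
  have I: "integrable (lborel \<Otimes>\<^sub>M lborel) (\<lambda>(x, z). r n z * (f x \<bullet> g (x - z)))" for n
  proof (rule Bochner_Integration.integrable_bound)
    have "integrable (lborel \<Otimes>\<^sub>M lborel) (\<lambda>(x, z). (norm (g (x - z)))\<^sup>2 * r n z)"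
      using integrable_kernel(2)[of "\<lambda>x. (norm (g x))\<^sup>2" "r n"] g r(1) by (simp add: L2v_def)
    moreover have "integrable (lborel \<Otimes>\<^sub>M lborel) (\<lambda>(x, z). (norm (f x))\<^sup>2 * r n z)"
    proof (rule lborel_pair.Fubini_integrable)
      show "integrable lborel (\<lambda>x. LBINT z. norm (case (x, z) of (x, z) \<Rightarrow> (norm (f x))\<^sup>2 * r n z))"
        using f by (simp add: abs_mult L2v_def)
    qed (use r(1) in simp_all)
    ultimately show "integrable (lborel \<Otimes>\<^sub>M lborel)
        (\<lambda>w. (case w of (x, z) \<Rightarrow> (norm (f x))\<^sup>2 * r n z) + (case w of (x, z) \<Rightarrow> (norm (g (x - z)))\<^sup>2 * r n z))"
      by (intro Bochner_Integration.integrable_add)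
    have "\<bar>r n z * (f x \<bullet> g (x - z))\<bar> \<le> (norm (f x))\<^sup>2 * r n z + (norm (g (x - z)))\<^sup>2 * r n z" for x z
    proof -
      have "r n z * \<bar>f x \<bullet> g (x - z)\<bar> \<le> r n z * ((norm (f x))\<^sup>2 + (norm (g (x - z)))\<^sup>2)"
        by (intro mult_left_mono inner_bound_sq r(2))
      then show ?thesis using r(2)[of n z] by (simp add: abs_mult algebra_simps)
    qed
    then show "AE w in lborel \<Otimes>\<^sub>M lborel. norm (case w of (x, z) \<Rightarrow> r n z * (f x \<bullet> g (x - z))) \<le>
       norm ((case w of (x, z) \<Rightarrow> (norm (f x))\<^sup>2 * r n z) + (case w of (x, z) \<Rightarrow> (norm (g (x - z)))\<^sup>2 * r n z))"
      by (intro AE_I2) (auto intro: order_trans[OF _ abs_ge_self])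
  qed measurable
  have eq: "(LBINT x. LBINT y. r n (x - y) * (f x \<bullet> g y))
      = (LBINT z. r n z * ip f (\<lambda>x. g (x - z)))" for n
  proof -
    have "(LBINT x. LBINT y. r n (x - y) * (f x \<bullet> g y))
        = (LBINT x. LBINT z. r n z * (f x \<bullet> g (x - z)))"
      using integral_reflect[of "\<lambda>z. r n z * (f x \<bullet> g (x - z))" x for x] by simp
    also have "\<dots> = (LBINT z. LBINT x. r n z * (f x \<bullet> g (x - z)))"
      using lborel_pair.Fubini_integral[OF I[of n]] by simp
    finally show ?thesis by (simp add: ip_def)
  qed
  have int: "integrable lborel (\<lambda>z. r n z * ip f (\<lambda>x. g (x - z)))" for n
    using lborel_pair.integrable_snd[OF I[of n]] by (simp add: ip_def)
  show ?thesis
  proof (rule LIMSEQ_I)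
    fix e :: real assume e: "e > 0"
    define e' where "e' = e / (2 * (nrm f + 1))"
    have e': "e' > 0" using e by (simp add: e'_def add_nonneg_pos)
    have "nrm f * e' \<le> (nrm f + 1) * e'" using e' by simp
    also have "\<dots> = e / 2"
    proof -
      have "nrm f + 1 \<noteq> 0" using nrm_nonneg[of f] by linarith
      moreover have "A * (e / (2 * A)) = e / 2" if "A \<noteq> 0" for A :: real using that by simp
      ultimately show ?thesis unfolding e'_def by blast
    qed
    finally have ee: "nrm f * e' \<le> e / 2" .
    obtain \<delta> where \<delta>: "\<delta> > 0" "\<And>z. norm z < \<delta> \<Longrightarrow> nrm (\<lambda>x. g (x + z) - g x) < e'"
      by (rule trans_cont_small[OF g e']) blast
    obtain N where N: "\<And>n. n \<ge> N \<Longrightarrow> d n < \<delta>" using LIMSEQ_D[OF d \<delta>(1)] by force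
    have "norm ((LBINT x. LBINT y. r n (x - y) * (f x \<bullet> g y)) - ip f g) < e" if n: "n \<ge> N" for n
    proof -
      have "(LBINT x. LBINT y. r n (x - y) * (f x \<bullet> g y)) - ip f g
          = (LBINT z. r n z * ip f (\<lambda>x. g (x - z)) - r n z * ip f g)"
        using int r(1,4) by (simp add: eq)
      also have "norm \<dots> \<le> (LBINT z. r n z * (e / 2))"
      proof (rule order_trans[OF integral_norm_bound integral_mono])
        fix z
        show "norm (r n z * ip f (\<lambda>x. g (x - z)) - r n z * ip f g) \<le> r n z * (e / 2)"
        proof (cases "norm z < \<delta>")
          case True
          have "ip f (\<lambda>x. g (x - z)) - ip f g = ip f (\<lambda>x. g (x - z) - g x)"
            using ip_diff_right[OF gz[of z] g f] by simp
          also have "\<bar>\<dots>\<bar> \<le> nrm f * nrm (\<lambda>x. g (x - z) - g x)"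
            by (intro ip_CS f L2v_diff gz g)
          also have "\<dots> \<le> nrm f * e'" using \<delta>(2)[of "- z"] True by (intro mult_left_mono) auto
          finally have "\<bar>ip f (\<lambda>x. g (x - z)) - ip f g\<bar> \<le> e / 2" using ee by simp
          then have "r n z * \<bar>ip f (\<lambda>x. g (x - z)) - ip f g\<bar> \<le> r n z * (e / 2)"
            using r(2) by (rule mult_left_mono)
          then show ?thesis using r(2)[of n z] by (simp add: abs_mult right_diff_distrib[symmetric])
        next
          case False
          then show ?thesis using r(3)[of n z] N[OF n] by simp
        qed
      qed (use int r(1) in auto)
      also have "\<dots> = e / 2" using r(4)[of n] by simp
      finally show ?thesis using e by simp
    qed
    then show "\<exists>N. \<forall>n\<ge>N. norm ((LBINT x. LBINT y. r n (x - y) * (f x \<bullet> g y)) - ip f g) < e" by blast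
  qed
qed

subsection \<open>Weak curls and tangential traces\<close>

text \<open>The identity comes from integrating curl (\<psi> u) = \<psi> curl u - u \<times> grad
  \<psi>. As a single vector identity it can survive truncation at a sphere where only the
  tangential part of u vanishes; separate weak partial derivatives need not, because the normal part
  may jump.\<close>

definition weak_curl :: "(real^3 \<Rightarrow> real^3) \<Rightarrow> (real^3 \<Rightarrow> real^3) \<Rightarrow> bool" where
  "weak_curl u B \<longleftrightarrow> L2v u \<and> L2v B \<and> (\<forall>\<psi>. test_function \<psi> \<longrightarrow>
     (LBINT x. cross3 (u x) (grad \<psi> x)) = (LBINT x. \<psi> x *\<^sub>R B x))"

lemma norm_cross_le: "norm (cross3 x y) \<le> norm x * norm y"
proof (rule power2_le_imp_le)
  show "(norm (cross3 x y))\<^sup>2 \<le> (norm x * norm y)\<^sup>2"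
    using norm_cross_dot[of x y] zero_le_power2[of "x \<bullet> y"] by linarith
qed simp

lemma cross_triple: "a \<bullet> cross3 b c = b \<bullet> cross3 c a"
  by (simp add: cross3_simps)

lemma borel_measurable_cross3 [measurable]:
  assumes "f \<in> borel_measurable M" "g \<in> borel_measurable M"
  shows "(\<lambda>x. cross3 (f x) (g x)) \<in> borel_measurable M"
  by (rule borel_measurable_continuous_Pair[OF assms]) (intro continuous_on_cross continuous_intros)

lemma integrable_L2v_bound:
  fixes F :: "'a::euclidean_space \<Rightarrow> 'c::euclidean_space"
  assumes "F \<in> borel_measurable borel" "L2v f" "L2v g" "\<And>x. norm (F x) \<le> norm (f x) * norm (g x)"
  shows "integrable lborel F"
proof (rule Bochner_Integration.integrable_bound)
  have "L2v (\<lambda>x. norm (f x))" "L2v (\<lambda>x. norm (g x))" using assms by (auto simp: L2v_def)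
  then show "integrable lborel (\<lambda>x. norm (f x) * norm (g x))" using ip_integrable by fastforce
qed (use assms in auto)

lemma integrable_cross: "L2v u \<Longrightarrow> L2v v \<Longrightarrow> integrable lborel (\<lambda>x. cross3 (u x) (v x))"
  by (rule integrable_L2v_bound[of _ u v]) (auto simp: norm_cross_le L2v_def)

lemma integrable_scaleR_L2v: "L2v p \<Longrightarrow> L2v u \<Longrightarrow> integrable lborel (\<lambda>x. p x *\<^sub>R u x)" for p :: "'a::euclidean_space \<Rightarrow> real"
  by (rule integrable_L2v_bound[of _ p u]) (auto simp: L2v_def)

lemma weak_curl_diff:
  assumes "weak_curl u B" "weak_curl v A" shows "weak_curl (\<lambda>x. u x - v x) (\<lambda>x. B x - A x)"
  unfolding weak_curl_def
proof (intro conjI allI impI)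
  fix \<psi> :: "real^3 \<Rightarrow> real" assume t: "test_function \<psi>"
  show "(LBINT x. cross3 (u x - v x) (grad \<psi> x)) = (LBINT x. \<psi> x *\<^sub>R (B x - A x))"
    using assms t test_function_L2v[OF t] test_function_grad_L2v[OF t]
    by (simp add: weak_curl_def Cross3.left_diff_distrib scaleR_diff_right integrable_cross integrable_scaleR_L2v)
qed (use assms in \<open>auto simp: weak_curl_def intro: L2v_diff\<close>)

definition exterior :: "real \<Rightarrow> (real^3) set" where
  "exterior R = {x. norm x > R}"

lemma exterior_borel [measurable, simp]: "exterior R \<in> sets borel"
  unfolding exterior_def by measurable

text \<open>The shell \<open>R\<^sup>2 < \<bar>x\<bar>\<^sup>2 < R\<^sup>2 + 1 / n\<close> has volume of order \<open>1 / n\<close>, which balances the factor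
  \<open>n\<close>, and \<open>w\<close> is uniformly small there.\<close>

lemma shell_integral_tendsto_0:
  fixes w :: "real^3 \<Rightarrow> real^3"
  assumes R: "R > 0" and w: "continuous_on UNIV w" "\<And>x. norm x = R \<Longrightarrow> w x = 0"
    and k: "\<And>s. \<bar>k s\<bar> \<le> M" "\<And>s. s \<le> 0 \<or> 1 \<le> s \<Longrightarrow> k s = 0" and \<psi>: "\<And>x. \<bar>\<psi> x\<bar> \<le> S"
  shows "(\<lambda>n. LBINT x. (\<psi> x * (real (Suc n) * k (real (Suc n) * (x \<bullet> x - R\<^sup>2)))) *\<^sub>R w x) \<longlonglongrightarrow> 0"
    (is "?I \<longlonglongrightarrow> 0")
proof (rule LIMSEQ_I)
  fix e :: real assume e: "e > 0"
  define V where "V = unit_ball_vol 3"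
  \<comment> \<open>S and M bound \<psi> and k. The remaining factors bound m times the volume of
    the shell, since \<open>r ^ 3 - R ^ 3\<close> is \<open>r - R\<close> times a sum of at most
    \<open>3 * (R\<^sup>2 + 1)\<close>, and \<open>r - R\<close> is at most
    \<open>1 / m / R\<close>.\<close>
  define C where "C = S * M * V * (3 * (R\<^sup>2 + 1) / R)"
  have nn: "V > 0" "M \<ge> 0" "S \<ge> 0"
    using k(1)[of 0] \<psi>[of 0] abs_ge_zero[of "k 0"] abs_ge_zero[of "\<psi> 0"] by (auto simp: V_def simp del: abs_ge_zero)
  then have C: "C \<ge> 0" using R by (simp add: C_def)
  define e' where "e' = e / (C + 1)"
  have e': "e' > 0" using e C by (simp add: e'_def)
  have "uniformly_continuous_on (cball 0 (sqrt (R\<^sup>2 + 1))) w"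
    by (intro compact_uniformly_continuous continuous_on_subset[OF w(1)]) auto
  then obtain d where d: "d > 0" "\<And>x y. x \<in> cball 0 (sqrt (R\<^sup>2 + 1)) \<Longrightarrow> y \<in> cball 0 (sqrt (R\<^sup>2 + 1)) \<Longrightarrow>
      dist y x < d \<Longrightarrow> dist (w y) (w x) < e'"
    unfolding uniformly_continuous_on_def using e' by metis
  \<comment> \<open>This makes the thickness of the shell smaller than the modulus of continuity
    d.\<close>
  obtain N where N: "real N > 1 / (d * R)" using reals_Archimedean2 by blast
  have "norm (?I n) < e" if n: "n \<ge> N" for n
  proof -
    define m where "m = real (Suc n)"
    define r where "r = sqrt (R\<^sup>2 + 1 / m)"
    define A where "A = cball (0::real^3) r - cball 0 R"
    have m: "m \<ge> 1" "1 / (d * R) < m" using n N by (auto simp: m_def)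
    have r2: "r\<^sup>2 = R\<^sup>2 + 1 / m" using m by (simp add: r_def add_nonneg_nonneg)
    have "1 / m \<le> 1" using m(1) by simp
    then have rle: "r \<le> sqrt (R\<^sup>2 + 1)" "r\<^sup>2 \<le> R\<^sup>2 + 1" unfolding r2 unfolding r_def by (auto intro: real_sqrt_le_mono)
    have "sqrt (R\<^sup>2) < r" unfolding r_def using m by (intro real_sqrt_less_mono) simp
    then have rR: "R < r" using R by simp
    have "(r - R) * R \<le> (r - R) * (r + R)" using rR R by (intro mult_left_mono) auto
    also have "\<dots> = 1 / m" using r2 by (simp add: power2_eq_square algebra_simps)
    finally have gap: "r - R \<le> 1 / m / R" by (subst pos_le_divide_eq[OF R])
    also have "\<dots> < d" using m(2) R d(1) m(1) by (simp add: field_simps)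
    finally have rd: "r - R < d" .
    have small: "norm (w x) \<le> e'" if x: "x \<in> A" for x
    proof -
      have nx: "R < norm x" "norm x \<le> r" using x by (auto simp: A_def)
      \<comment> \<open>The radial projection to the sphere, where w vanishes; its distance from x
        is \<open>norm x - R\<close>.\<close>
      define y where "y = (R / norm x) *\<^sub>R x"
      have nx0: "norm x > 0" using nx R by linarith
      then have ny: "norm y = R" using R by (simp add: y_def)
      have "x - y = (1 - R / norm x) *\<^sub>R x" by (simp add: y_def algebra_simps)
      then have "norm (x - y) = \<bar>1 - R / norm x\<bar> * norm x" by simp
      also have "\<bar>1 - R / norm x\<bar> = 1 - R / norm x" using nx nx0 by (simp add: abs_of_nonneg divide_le_eq)
      also have "(1 - R / norm x) * norm x = norm x - R" using nx0 by (simp add: algebra_simps)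
      finally have "dist x y < d" using nx rd by (simp add: dist_norm)
      then have "dist (w x) (w y) < e'" using d(2)[of y x] nx rle(1) rR ny by simp
      then show ?thesis using w(2)[OF ny] by simp
    qed
    define b where "b = S * (m * M) * e'"
    have b: "b \<ge> 0" using nn m e' by (simp add: b_def)
    have pt: "norm ((\<psi> x * (m * k (m * (x \<bullet> x - R\<^sup>2)))) *\<^sub>R w x) \<le> b * indicator A x" for x
    proof (cases "x \<in> A")
      case True
      have "norm ((\<psi> x * (m * k (m * (x \<bullet> x - R\<^sup>2)))) *\<^sub>R w x)
          = \<bar>\<psi> x\<bar> * (m * \<bar>k (m * (x \<bullet> x - R\<^sup>2))\<bar>) * norm (w x)"
        using m by (simp add: abs_mult)
      also have "\<dots> \<le> S * (m * M) * e'"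
        using m nn small[OF True] \<psi> k(1) by (intro mult_mono) auto
      finally show ?thesis using True by (simp add: b_def)
    next
      case False
      then have "norm x \<le> R \<or> r \<le> norm x" by (auto simp: A_def)
      then have "(norm x)\<^sup>2 \<le> R\<^sup>2 \<or> r\<^sup>2 \<le> (norm x)\<^sup>2" using rR R by (auto intro: power_mono)
      then have "x \<bullet> x - R\<^sup>2 \<le> 0 \<or> 1 / m \<le> x \<bullet> x - R\<^sup>2" unfolding r2 power2_norm_eq_inner by linarith
      then have "m * (x \<bullet> x - R\<^sup>2) \<le> 0 \<or> 1 \<le> m * (x \<bullet> x - R\<^sup>2)"
        using m by (auto simp: mult_le_0_iff pos_divide_le_eq mult.commute)
      then show ?thesis using False k(2) by simp
    qed
    have mA: "measure lborel A = V * (r ^ 3 - R ^ 3)"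
    proof -
      have "measure lborel A = measure lborel (cball (0::real^3) r) - measure lborel (cball (0::real^3) R)"
        unfolding A_def using rR emeasure_lborel_cball_finite[of "0::real^3" r]
        by (intro measure_Diff) auto
      then show ?thesis using R rR by (simp add: content_cball V_def right_diff_distrib)
    qed
    have iA: "integrable lborel (\<lambda>x. b * indicator A x)"
      using emeasure_bounded_finite[of A]
      by (intro integrable_mult_right integrable_real_indicator) (auto simp: A_def intro: bounded_diff)
    have "r ^ 3 - R ^ 3 = (r - R) * (r\<^sup>2 + r * R + R\<^sup>2)"
      by (simp add: power2_eq_square power3_eq_cube algebra_simps)
    also have "\<dots> \<le> (1 / m / R) * (3 * (R\<^sup>2 + 1))"
    proof (rule mult_mono[OF gap])
      have "r * R \<le> r * r" using rR R by (intro mult_left_mono) auto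
      moreover have "R\<^sup>2 \<le> r\<^sup>2" using m by (simp add: r2)
      ultimately show "r\<^sup>2 + r * R + R\<^sup>2 \<le> 3 * (R\<^sup>2 + 1)" using rle(2) by (simp add: power2_eq_square)
    qed (use R rR m in auto)
    finally have vol: "r ^ 3 - R ^ 3 \<le> (1 / m / R) * (3 * (R\<^sup>2 + 1))" .
    have "norm (?I n) \<le> (LBINT x. norm ((\<psi> x * (m * k (m * (x \<bullet> x - R\<^sup>2)))) *\<^sub>R w x))"
      unfolding m_def by (rule integral_norm_bound)
    also have "\<dots> \<le> (LBINT x. b * indicator A x)"
      by (rule integral_mono_AE'[OF iA]) (use pt b in auto)
    also have "\<dots> = b * (V * (r ^ 3 - R ^ 3))"
    proof -
      have "A \<in> sets lborel" by (simp add: A_def)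
      then show ?thesis by (simp add: mA)
    qed
    also have "\<dots> \<le> b * (V * ((1 / m / R) * (3 * (R\<^sup>2 + 1))))"
      using b nn vol by (intro mult_left_mono) auto
    also have "\<dots> = e' * C" using m R by (simp add: b_def C_def)
    also have "\<dots> < e" using e C by (simp add: e'_def field_simps)
    finally show ?thesis .
  qed
  then show "\<exists>N. \<forall>n\<ge>N. norm (?I n - 0) < e" by auto
qed

text \<open>The tangential part of \<open>u\<close> vanishes on the sphere and the gradient of a radial cutoff is radial, so no
  trace theorem is needed.\<close>

lemma weak_curl_exterior:
  assumes wc: "weak_curl u B" and cont: "continuous_on UNIV u" and R: "R > 0"
    and tang: "\<And>x. norm x = R \<Longrightarrow> cross3 (u x) x = 0" and t: "test_function \<psi>"
  shows "(LBINT x. cross3 (indicator (exterior R) x *\<^sub>R u x) (grad \<psi> x))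
       = (LBINT x. \<psi> x *\<^sub>R (indicator (exterior R) x *\<^sub>R B x))"
proof -
  obtain D where D: "smooth_seq D" "\<And>n x. x \<le> 0 \<Longrightarrow> D n x = 0" "\<And>x. x \<ge> 1 \<Longrightarrow> D 0 x = 1"
    "\<And>x. 0 \<le> D 0 x" "\<And>x. D 0 x \<le> 1" "\<And>n x. x \<ge> 1 \<Longrightarrow> D (Suc n) x = 0"
    by (rule smooth_step) blast
  obtain M where M: "\<And>x. x \<in> {0..1} \<Longrightarrow> norm (D 1 x) \<le> M"
    by (rule compact_image_bound[OF compact_Icc smooth_seq_continuous[OF D(1)]]) blast
  have k2: "2 * D 1 x = 0" if "x \<le> 0 \<or> 1 \<le> x" for x using that D(2)[of x 1] D(6)[of x 0] by auto
  have k1: "\<bar>2 * D 1 x\<bar> \<le> 2 * M" for x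
    using M[of x] M[of 0] k2[of x] norm_ge_zero[of "D 1 0"] by (cases "x \<in> {0..1}") auto
  obtain S where S: "\<And>x. \<bar>\<psi> x\<bar> \<le> S" by (rule test_function_bounded[OF t]) blast
  define q where "q n x = real (Suc n) * (x \<bullet> x - R\<^sup>2)" for n and x :: "real^3"
  have qCk: "Ck k (q n)" for k n
  proof -
    have "q n = (\<lambda>x. real (Suc n) * (x \<bullet> x + - R\<^sup>2))" by (simp add: q_def[abs_def])
    then show ?thesis by (simp only:) (intro Ck_mult Ck_add Ck_const Ck_norm_sq)
  qed
  \<comment> \<open>A radial cutoff whose transition layer shrinks to the sphere from outside. Its
    limit is the indicator of the exterior everywhere, with the value 0 on the sphere
    itself.\<close>
  define c where "c n x = D 0 (q n x)" for n x
  have cCk: "Ck k (c n)" for k n unfolding c_def[abs_def] by (rule Ck_compose[OF D(1) qCk])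
  have c01: "0 \<le> c n x" "c n x \<le> 1" for n x using D by (auto simp: c_def)
  have gc: "grad (c n) x = (real (Suc n) * (2 * D 1 (q n x))) *\<^sub>R x" for n x
  proof -
    have "(q n has_derivative (\<lambda>h. ((2 * real (Suc n)) *\<^sub>R x) \<bullet> h)) (at x)"
      unfolding q_def[abs_def] by (auto intro!: derivative_eq_intros simp: inner_commute algebra_simps)
    from grad_compose[OF D(1) this, of 0] show ?thesis by (simp add: c_def[abs_def] mult_ac)
  qed
  have L: "L2v u" "L2v B" using wc by (auto simp: weak_curl_def)
  note Lt = test_function_L2v[OF t] test_function_grad_L2v[OF t]
  have m[measurable]: "u \<in> borel_measurable borel" "B \<in> borel_measurable borel" "\<psi> \<in> borel_measurable borel"
    "grad \<psi> \<in> borel_measurable borel" "\<And>n. c n \<in> borel_measurable borel"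
    using L Lt borel_measurable_continuous_onI[OF Ck_continuous[OF cCk[of 0]]] by (auto simp: L2v_def)
  define I where "I n = (LBINT x. \<psi> x *\<^sub>R cross3 (u x) (grad (c n) x))" for n
  have bound_cu: "L2v (\<lambda>x. c n x *\<^sub>R w x)" if "L2v w" for n and w :: "real^3 \<Rightarrow> real^3"
    by (rule L2v_bound[OF _ that, of _ 1])
       (use that c01[of n] in \<open>auto simp: L2v_def abs_le_iff intro!: mult_left_le_one_le borel_measurable_scaleR\<close>)
  have id: "(LBINT x. cross3 (c n x *\<^sub>R u x) (grad \<psi> x)) + I n
      = (LBINT x. \<psi> x *\<^sub>R (c n x *\<^sub>R B x))" for n
  proof -
    have tc: "test_function (\<lambda>x. c n x * \<psi> x)" by (rule test_function_mult[OF cCk t])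
    have g: "grad (\<lambda>x. c n x * \<psi> x) x = c n x *\<^sub>R grad \<psi> x + \<psi> x *\<^sub>R grad (c n) x" for x
      by (rule grad_mult[OF cCk test_function_Ck[OF t]])
    have i1: "integrable lborel (\<lambda>x. cross3 (c n x *\<^sub>R u x) (grad \<psi> x))"
      by (intro integrable_cross bound_cu L Lt)
    have "integrable lborel (\<lambda>x. cross3 (u x) (grad (\<lambda>x. c n x * \<psi> x) x))"
      by (intro integrable_cross L test_function_grad_L2v tc)
    then have "integrable lborel (\<lambda>x. cross3 (c n x *\<^sub>R u x) (grad \<psi> x) + \<psi> x *\<^sub>R cross3 (u x) (grad (c n) x))"
      by (simp add: g cross_add_right cross_mult_right cross_mult_left)
    from Bochner_Integration.integrable_diff[OF this i1]
    have i2: "integrable lborel (\<lambda>x. \<psi> x *\<^sub>R cross3 (u x) (grad (c n) x))" by simp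
    have "(LBINT x. cross3 (u x) (grad (\<lambda>x. c n x * \<psi> x) x)) = (LBINT x. (c n x * \<psi> x) *\<^sub>R B x)"
      using wc tc by (simp add: weak_curl_def)
    then have "(LBINT x. cross3 (c n x *\<^sub>R u x) (grad \<psi> x) + \<psi> x *\<^sub>R cross3 (u x) (grad (c n) x))
        = (LBINT x. (c n x * \<psi> x) *\<^sub>R B x)"
      by (simp add: g cross_add_right cross_mult_right cross_mult_left)
    then show ?thesis using i1 i2 by (simp add: I_def mult.commute)
  qed
  have clim: "(\<lambda>n. c n x) \<longlonglongrightarrow> indicator (exterior R) x" for x
  proof (cases "norm x > R")
    case True
    then have p: "x \<bullet> x - R\<^sup>2 > 0" using power_strict_mono[of R "norm x" 2] R by (simp add: power2_norm_eq_inner)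
    obtain N where N: "real N > 1 / (x \<bullet> x - R\<^sup>2)" using reals_Archimedean2 by blast
    have "c n x = 1" if "n \<ge> N" for n
    proof -
      have "1 / (x \<bullet> x - R\<^sup>2) \<le> real (Suc n)" using N that by simp
      then show ?thesis unfolding c_def using p by (intro D(3)) (simp add: q_def pos_divide_le_eq del: of_nat_Suc)
    qed
    then have "\<forall>\<^sub>F n in sequentially. c n x = 1" by (auto simp: eventually_sequentially)
    then show ?thesis using True by (simp add: exterior_def tendsto_eventually)
  next
    case False
    then have "x \<bullet> x - R\<^sup>2 \<le> 0" using power_mono[of "norm x" R 2] by (simp add: power2_norm_eq_inner)
    then have "c n x = 0" for n
      unfolding c_def by (intro D(2)) (simp add: q_def mult_nonneg_nonpos del: of_nat_Suc)
    then show ?thesis using False by (simp add: exterior_def)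
  qed
  have lim1: "(\<lambda>n. LBINT x. cross3 (c n x *\<^sub>R u x) (grad \<psi> x))
      \<longlonglongrightarrow> (LBINT x. cross3 (indicator (exterior R) x *\<^sub>R u x) (grad \<psi> x))"
  proof (rule integral_dominated_convergence[where w="\<lambda>x. norm (cross3 (u x) (grad \<psi> x))"])
    show "AE x in lborel. (\<lambda>n. cross3 (c n x *\<^sub>R u x) (grad \<psi> x))
        \<longlonglongrightarrow> cross3 (indicator (exterior R) x *\<^sub>R u x) (grad \<psi> x)"
      unfolding cross_mult_left by (intro AE_I2 tendsto_scaleR clim tendsto_const)
    show "AE x in lborel. norm (cross3 (c n x *\<^sub>R u x) (grad \<psi> x)) \<le> norm (cross3 (u x) (grad \<psi> x))" for n
      using c01[of n] by (simp add: cross_mult_left mult_left_le_one_le)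
  qed (use integrable_cross[OF L(1) Lt(2)] in \<open>auto intro!: borel_measurable_cross3\<close>)
  have lim2: "(\<lambda>n. LBINT x. \<psi> x *\<^sub>R (c n x *\<^sub>R B x))
      \<longlonglongrightarrow> (LBINT x. \<psi> x *\<^sub>R (indicator (exterior R) x *\<^sub>R B x))"
  proof (rule integral_dominated_convergence[where w="\<lambda>x. norm (\<psi> x *\<^sub>R B x)"])
    show "AE x in lborel. (\<lambda>n. \<psi> x *\<^sub>R (c n x *\<^sub>R B x)) \<longlonglongrightarrow> \<psi> x *\<^sub>R (indicator (exterior R) x *\<^sub>R B x)"
      by (intro AE_I2 tendsto_scaleR clim tendsto_const)
    show "AE x in lborel. norm (\<psi> x *\<^sub>R (c n x *\<^sub>R B x)) \<le> norm (\<psi> x *\<^sub>R B x)" for n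
    proof (rule AE_I2)
      fix x show "norm (\<psi> x *\<^sub>R (c n x *\<^sub>R B x)) \<le> norm (\<psi> x *\<^sub>R B x)"
        using c01[of n x] mult_left_le_one_le[of "norm (B x)" "c n x"]
        by (simp add: abs_mult mult.assoc mult_left_mono)
    qed
  qed (use integrable_norm[OF integrable_scaleR_L2v[OF Lt(1) L(2)]] in auto)
  have "I \<longlonglongrightarrow> 0"
    using shell_integral_tendsto_0[where w = "\<lambda>x. cross3 (u x) x" and k = "\<lambda>s. 2 * D 1 s", OF R _ tang k1 k2 S] cont
    by (simp add: I_def[abs_def] gc q_def cross_mult_right continuous_on_cross del: of_nat_Suc)
  from tendsto_add[OF lim1 this] have
    "(\<lambda>n. LBINT x. \<psi> x *\<^sub>R (c n x *\<^sub>R B x))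
      \<longlonglongrightarrow> (LBINT x. cross3 (indicator (exterior R) x *\<^sub>R u x) (grad \<psi> x))"
    by (simp add: id)
  then show ?thesis using lim2 LIMSEQ_unique by blast
qed

lemma test_function_grad_norm_integrable:
  assumes "test_function f" shows "integrable lborel (\<lambda>x. norm (grad f x))"
proof -
  obtain r where r: "\<And>x. norm x > r \<Longrightarrow> f x = 0" using test_function_bounded_support[OF assms] by metis
  have "grad f x = 0" if "norm x > r" for x
    using has_derivative_outside_ball[OF r that] by (intro grad_eqI) simp
  then show ?thesis
    by (intro continuous_bounded_support_integrable[of _ r] continuous_on_norm
        grad_continuous[OF test_function_Ck[OF assms]]) auto
qed

text \<open>Green's formula in the exterior domain: the test function in \<open>weak_curl_exterior\<close> is taken to be
  a mollifier centred at \<open>y\<close>, the identity is tested against \<open>A y\<close>, and Fubini moves the gradient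
  over to \<open>A\<close>.\<close>

lemma exterior_Green:
  assumes u: "weak_curl u B" and A: "weak_curl A C" and cont: "continuous_on UNIV u" and R: "R > 0"
    and tang: "\<And>x. norm x = R \<Longrightarrow> cross3 (u x) x = 0"
  shows "ip (\<lambda>x. indicator (exterior R) x *\<^sub>R u x) C = ip (\<lambda>x. indicator (exterior R) x *\<^sub>R B x) A"
proof -
  define U where "U x = indicator (exterior R) x *\<^sub>R u x" for x
  define V where "V x = indicator (exterior R) x *\<^sub>R B x" for x
  have L: "L2v U" "L2v V" "L2v A" "L2v C"
    using u A by (auto simp: weak_curl_def U_def[abs_def] V_def[abs_def] L2v_indicator)
  note [measurable] = L[THEN L2v_measurable]
  have "\<exists>r :: real^3 \<Rightarrow> real. test_function r \<and> (\<forall>x. r x \<ge> 0) \<and> (\<forall>x. norm x \<ge> inverse (real (Suc n)) \<longrightarrow> r x = 0) \<and>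
      (LBINT x. r x) = 1" for n
    using mollifier_exists[of "inverse (real (Suc n))"] by (metis inverse_positive_iff_positive of_nat_0_less_iff zero_less_Suc)
  then obtain r :: "nat \<Rightarrow> real^3 \<Rightarrow> real" where r: "\<And>n. test_function (r n)" "\<And>n x. r n x \<ge> 0"
    "\<And>n x. norm x \<ge> inverse (real (Suc n)) \<Longrightarrow> r n x = 0" "\<And>n. (LBINT x. r n x) = 1"
    by metis
  have ri: "integrable lborel (r n)" for n by (rule test_function_integrable[OF r(1)])
  have lim: "(\<lambda>n. LBINT x. LBINT y. r n (x - y) * (f x \<bullet> g y)) \<longlonglongrightarrow> ip f g"
    if "L2v f" "L2v g" for f g :: "real^3 \<Rightarrow> real^3"
    by (rule mollify_tendsto[OF that ri r(2,3,4) LIMSEQ_inverse_real_of_nat])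
  have "(LBINT x. LBINT y. r n (x - y) * (U x \<bullet> C y))
      = (LBINT x. LBINT y. r n (x - y) * (V x \<bullet> A y))" for n
  proof -
    have [measurable]: "r n \<in> borel_measurable borel" "grad (r n) \<in> borel_measurable borel"
      using test_function_measurable[OF r(1)] test_function_grad_L2v[OF r(1)] by (auto simp: L2v_def)
    have t1: "test_function (\<lambda>x. r n (x - y))" for y
      using test_function_affine[OF r(1), of 1 n "- y"] by simp
    have g1: "grad (\<lambda>x. r n (x - y)) x = grad (r n) (x - y)" for x y
      using grad_affine[OF test_function_Ck[OF r(1)], of n 1 "- y" x] by simp
    have t2: "test_function (\<lambda>y. r n (x - y))" for x
      using test_function_affine[OF r(1), of "-1" n x] by simp
    have g2: "grad (\<lambda>y. r n (x - y)) y = - grad (r n) (x - y)" for x y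
      using grad_affine[OF test_function_Ck[OF r(1)], of n "-1" x y] by simp
    have I1: "integrable lborel (\<lambda>x. cross3 (U x) (grad (r n) (x - y)))" for y
      using integrable_cross[OF L(1) test_function_grad_L2v[OF t1]] by (simp add: g1)
    have I2: "integrable lborel (\<lambda>x. r n (x - y) *\<^sub>R V x)" for y
      by (rule integrable_scaleR_L2v[OF test_function_L2v[OF t1] L(2)])
    have I3: "integrable lborel (\<lambda>y. cross3 (A y) (- grad (r n) (x - y)))" for x
      using integrable_cross[OF L(3) test_function_grad_L2v[OF t2]] by (simp add: g2)
    have I4: "integrable lborel (\<lambda>y. r n (x - y) *\<^sub>R C y)" for x
      by (rule integrable_scaleR_L2v[OF test_function_L2v[OF t2] L(4)])
    have P1: "integrable (lborel \<Otimes>\<^sub>M lborel) (\<lambda>(x, y). A y \<bullet> cross3 (U x) (grad (r n) (x - y)))"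
    proof (rule integrable_kernel_L2v[OF L(1,3) test_function_grad_norm_integrable[OF r(1)]])
      fix x y
      have "\<bar>A y \<bullet> cross3 (U x) (grad (r n) (x - y))\<bar> \<le> norm (A y) * (norm (U x) * norm (grad (r n) (x - y)))"
        by (rule order_trans[OF Cauchy_Schwarz_ineq2]) (intro mult_left_mono norm_cross_le norm_ge_zero)
      then show "\<bar>case (x, y) of (x, y) \<Rightarrow> A y \<bullet> cross3 (U x) (grad (r n) (x - y))\<bar>
          \<le> norm (grad (r n) (x - y)) * (norm (U x) * norm (A y))" by (simp add: mult_ac)
    qed simp_all
    have P2: "integrable (lborel \<Otimes>\<^sub>M lborel) (\<lambda>(x, y). r n (x - y) * (V x \<bullet> A y))"
    proof (rule integrable_kernel_L2v[OF L(2,3) ri r(2)])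
      fix x y
      have "r n (x - y) * \<bar>V x \<bullet> A y\<bar> \<le> r n (x - y) * (norm (V x) * norm (A y))"
        by (intro mult_left_mono Cauchy_Schwarz_ineq2 r(2))
      then show "\<bar>case (x, y) of (x, y) \<Rightarrow> r n (x - y) * (V x \<bullet> A y)\<bar> \<le> r n (x - y) * (norm (V x) * norm (A y))"
        using r(2)[of n "x - y"] by (simp add: abs_mult)
    qed simp
    have "(LBINT x. LBINT y. r n (x - y) * (V x \<bullet> A y))
        = (LBINT y. LBINT x. r n (x - y) * (V x \<bullet> A y))"
      using lborel_pair.Fubini_integral[OF P2] by simp
    also have "\<dots> = (LBINT y. LBINT x. A y \<bullet> cross3 (U x) (grad (r n) (x - y)))"
    proof (rule Bochner_Integration.integral_cong[OF refl])
      fix y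
      have "(LBINT x. r n (x - y) * (V x \<bullet> A y)) = (LBINT x. (r n (x - y) *\<^sub>R V x) \<bullet> A y)" by simp
      also have "\<dots> = (LBINT x. r n (x - y) *\<^sub>R V x) \<bullet> A y"
        by (rule integral_inner_left) (use I2 in simp)
      also have "(LBINT x. r n (x - y) *\<^sub>R V x) = (LBINT x. cross3 (U x) (grad (r n) (x - y)))"
        using weak_curl_exterior[OF u cont R tang t1, of y] by (simp add: g1 U_def V_def)
      also have "\<dots> \<bullet> A y = (LBINT x. cross3 (U x) (grad (r n) (x - y)) \<bullet> A y)"
        by (rule integral_inner_left[symmetric]) (use I1 in simp)
      finally show "(LBINT x. r n (x - y) * (V x \<bullet> A y))
          = (LBINT x. A y \<bullet> cross3 (U x) (grad (r n) (x - y)))" by (simp add: inner_commute)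
    qed
    also have "\<dots> = (LBINT x. LBINT y. A y \<bullet> cross3 (U x) (grad (r n) (x - y)))"
      using lborel_pair.Fubini_integral[OF P1] by simp
    also have "\<dots> = (LBINT x. LBINT y. r n (x - y) * (U x \<bullet> C y))"
    proof (rule Bochner_Integration.integral_cong[OF refl])
      fix x
      \<comment> \<open>Cyclic invariance of the triple product exchanges the two fields. The sign
        that appears is the one in the gradient of the mollifier with respect to y.\<close>
      have "A y \<bullet> cross3 (U x) (grad (r n) (x - y)) = U x \<bullet> cross3 (A y) (- grad (r n) (x - y))" for y
        using cross_triple[of "A y" "U x"] cross_skew[of "A y" "grad (r n) (x - y)"] by simp
      then have "(LBINT y. A y \<bullet> cross3 (U x) (grad (r n) (x - y)))
          = (LBINT y. U x \<bullet> cross3 (A y) (- grad (r n) (x - y)))" by simp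
      also have "\<dots> = U x \<bullet> (LBINT y. cross3 (A y) (- grad (r n) (x - y)))"
        by (rule integral_inner_right) (use I3 in simp)
      also have "(LBINT y. cross3 (A y) (- grad (r n) (x - y))) = (LBINT y. r n (x - y) *\<^sub>R C y)"
        using A t2[of x] by (simp add: weak_curl_def g2[symmetric])
      also have "U x \<bullet> \<dots> = (LBINT y. U x \<bullet> (r n (x - y) *\<^sub>R C y))"
        by (rule integral_inner_right[symmetric]) (use I4 in simp)
      finally show "(LBINT y. A y \<bullet> cross3 (U x) (grad (r n) (x - y)))
          = (LBINT y. r n (x - y) * (U x \<bullet> C y))" by simp
    qed
    finally show ?thesis ..
  qed
  then have "ip U C = ip V A" using LIMSEQ_unique[OF lim[OF L(1,4)]] lim[OF L(2,3)] by simp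
  then show ?thesis by (simp add: U_def[abs_def] V_def[abs_def])
qed

subsection \<open>Calculus of functions of time with values in \<open>L\<^sup>2\<close>\<close>

definition L2_deriv ::
    "real set \<Rightarrow> (real \<Rightarrow> 'a::euclidean_space \<Rightarrow> 'b::euclidean_space) \<Rightarrow> ('a \<Rightarrow> 'b) \<Rightarrow> real \<Rightarrow> bool" where
  "L2_deriv S u u' t \<longleftrightarrow> t \<in> S \<and> (\<forall>s\<in>S. L2v (u s)) \<and>
     L2_lim (\<lambda>s x. inverse (s - t) *\<^sub>R (u s x - u t x)) u' (at t within S)"

lemma eventually_at_within_all: "(\<And>s. s \<in> S \<Longrightarrow> P s) \<Longrightarrow> \<forall>\<^sub>F s in at t within S. P s"
  by (simp add: eventually_at_filter)

lemma L2_derivI: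
  assumes "t \<in> S" "\<And>s. s \<in> S \<Longrightarrow> L2v (u s)" "L2v u'"
    and "((\<lambda>s. nrm (\<lambda>x. inverse (s - t) *\<^sub>R (u s x - u t x) - u' x)) \<longlongrightarrow> 0) (at t within S)"
  shows "L2_deriv S u u' t"
  using assms unfolding L2_deriv_def L2_lim_def
  by (auto intro!: eventually_at_within_all L2v_scaleR L2v_diff)

lemma L2_deriv_L2v: "L2_deriv S u u' t \<Longrightarrow> L2v (u t)" "L2_deriv S u u' t \<Longrightarrow> L2v u'"
  by (auto simp: L2_deriv_def L2_lim_def)

lemma L2_deriv_tendsto:
  assumes "L2_deriv S u u' t" shows "L2_lim u (u t) (at t within S)"
proof (rule L2_limI[OF L2_deriv_L2v(1)[OF assms]])
  let ?q = "\<lambda>s x. inverse (s - t) *\<^sub>R (u s x - u t x)"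
  have q: "((\<lambda>s. nrm (\<lambda>x. ?q s x - u' x)) \<longlongrightarrow> 0) (at t within S)"
    using assms by (simp add: L2_deriv_def L2_lim_def)
  have "((\<lambda>s. \<bar>s - t\<bar> * (nrm (\<lambda>x. ?q s x - u' x) + nrm u')) \<longlongrightarrow> \<bar>t - t\<bar> * (0 + nrm u')) (at t within S)"
    by (intro tendsto_intros q)
  then show "((\<lambda>s. \<bar>s - t\<bar> * (nrm (\<lambda>x. ?q s x - u' x) + nrm u')) \<longlongrightarrow> 0) (at t within S)" by simp
  show "\<forall>\<^sub>F s in at t within S. L2v (u s) \<and>
      nrm (\<lambda>x. u s x - u t x) \<le> \<bar>s - t\<bar> * (nrm (\<lambda>x. ?q s x - u' x) + nrm u')"
    unfolding eventually_at_filter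
  proof (intro always_eventually allI impI conjI)
    fix s assume s: "s \<noteq> t" "s \<in> S"
    show L: "L2v (u s)" using assms s by (auto simp: L2_deriv_def)
    have "nrm (\<lambda>x. u s x - u t x) = nrm (\<lambda>x. (s - t) *\<^sub>R ?q s x)" using s by simp
    also have "\<dots> = \<bar>s - t\<bar> * nrm (?q s)" by (rule nrm_scale)
    also have "nrm (?q s) \<le> nrm (\<lambda>x. ?q s x - u' x) + nrm u'"
      using nrm_triangle[of "\<lambda>x. ?q s x - u' x" u'] L L2_deriv_L2v[OF assms] by (simp add: L2v_diff L2v_scaleR)
    finally show "nrm (\<lambda>x. u s x - u t x) \<le> \<bar>s - t\<bar> * (nrm (\<lambda>x. ?q s x - u' x) + nrm u')"
      by (simp add: mult_left_mono)
  qed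
qed

text \<open>The difference quotient splits exactly, with v taken at s in one term and u at t in the
  other; the limit then needs only joint continuity of \<open>ip\<close> and continuity of
  v.\<close>

lemma ip_has_derivative:
  assumes u: "L2_deriv S u u' t" and v: "L2_deriv S v v' t"
  shows "((\<lambda>s. ip (u s) (v s)) has_real_derivative (ip u' (v t) + ip (u t) v')) (at t within S)"
  unfolding has_field_derivative_iff
proof (rule Lim_transform_eventually)
  let ?q = "\<lambda>w s x. inverse (s - t) *\<^sub>R (w s x - w t x)"
  have L: "L2v (u t)" "L2v (v t)" "\<And>s. s \<in> S \<Longrightarrow> L2v (u s)" "\<And>s. s \<in> S \<Longrightarrow> L2v (v s)"
    using u v by (auto simp: L2_deriv_def)
  show "((\<lambda>s. ip (?q u s) (v s) + ip (u t) (?q v s)) \<longlongrightarrow> ip u' (v t) + ip (u t) v') (at t within S)"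
    using u v by (intro tendsto_add ip_tendsto L2_lim_const L2_deriv_tendsto[OF v] L) (simp_all add: L2_deriv_def)
  show "\<forall>\<^sub>F s in at t within S. ip (?q u s) (v s) + ip (u t) (?q v s)
      = (ip (u s) (v s) - ip (u t) (v t)) / (s - t)"
  proof (rule eventually_at_within_all)
    fix s assume "s \<in> S"
    then have a: "ip (?q u s) (v s) = inverse (s - t) * (ip (u s) (v s) - ip (u t) (v s))"
      and b: "ip (u t) (?q v s) = inverse (s - t) * (ip (u t) (v s) - ip (u t) (v t))"
      unfolding ip_scale_left ip_scale_right by (simp_all add: ip_diff_left ip_diff_right L)
    show "ip (?q u s) (v s) + ip (u t) (?q v s) = (ip (u s) (v s) - ip (u t) (v t)) / (s - t)"
      unfolding a b by (simp add: divide_inverse algebra_simps)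
  qed
qed

lemma L2_deriv_indicator:
  assumes "L2_deriv S u u' t" "A \<in> sets borel"
  shows "L2_deriv S (\<lambda>s x. indicator A x *\<^sub>R u s x) (\<lambda>x. indicator A x *\<^sub>R u' x) t"
  using assms(1) L2_lim_indicator[OF _ assms(2)] unfolding L2_deriv_def
  by (fastforce simp: scaleR_diff_right mult.commute intro: L2v_indicator assms(2))

lemma L2_deriv_diff:
  assumes "L2_deriv S u u' t" "L2_deriv S v v' t"
  shows "L2_deriv S (\<lambda>s x. u s x - v s x) (\<lambda>x. u' x - v' x) t"
proof -
  have "inverse (s - t) *\<^sub>R (u s x - u t x) - inverse (s - t) *\<^sub>R (v s x - v t x)
      = inverse (s - t) *\<^sub>R (u s x - v s x - (u t x - v t x))" for s x
    by (simp add: algebra_simps)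
  then have "L2_lim (\<lambda>s x. inverse (s - t) *\<^sub>R (u s x - v s x - (u t x - v t x))) (\<lambda>x. u' x - v' x) (at t within S)"
    using L2_lim_diff[of "\<lambda>s x. inverse (s - t) *\<^sub>R (u s x - u t x)" u' _ "\<lambda>s x. inverse (s - t) *\<^sub>R (v s x - v t x)" v'] assms
    unfolding L2_deriv_def by simp
  then show ?thesis using assms by (simp add: L2_deriv_def L2v_diff)
qed

subsection \<open>The Maxwell system in weak form\<close>

lemma L2v_componentwise: "L2v f \<longleftrightarrow> (\<forall>i. L2 (\<lambda>x. f x $ i))" for f :: "'a::euclidean_space \<Rightarrow> real^'n"
proof
  assume f: "L2v f"
  then have [measurable]: "f \<in> borel_measurable borel" by (simp add: L2v_def)
  have "L2v (\<lambda>x. f x $ i)" for i using L2v_inner[OF f, of "axis i 1"] by (simp add: inner_axis)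
  then show "\<forall>i. L2 (\<lambda>x. f x $ i)" by (simp add: L2v_def L2_def)
next
  assume *: "\<forall>i. L2 (\<lambda>x. f x $ i)"
  then have m: "f \<in> borel_measurable borel"
    by (subst borel_measurable_euclidean_space) (auto simp: Basis_vec_def inner_axis L2_def)
  have "(norm (f x))\<^sup>2 = (\<Sum>i\<in>UNIV. (f x $ i)\<^sup>2)" for x
    unfolding power2_norm_eq_inner inner_vec_def by (simp add: power2_eq_square)
  then show "L2v f" using * m by (simp add: L2v_def L2_def)
qed

lemma nrm_componentwise:
  fixes f :: "'a::euclidean_space \<Rightarrow> real^'n"
  assumes "\<And>i. L2 (\<lambda>x. f x $ i)"
  shows "nrm f = sqrt (\<Sum>i\<in>UNIV. (L2_norm (\<lambda>x. f x $ i))\<^sup>2)"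
proof -
  have "ip f f = (LBINT x. (\<Sum>i\<in>UNIV. (f x $ i)\<^sup>2))"
    by (simp add: ip_def inner_vec_def power2_eq_square)
  also have "\<dots> = (\<Sum>i\<in>UNIV. (LBINT x. (f x $ i)\<^sup>2))"
    using assms by (intro Bochner_Integration.integral_sum) (auto simp: L2_def)
  also have "\<dots> = (\<Sum>i\<in>UNIV. (L2_norm (\<lambda>x. f x $ i))\<^sup>2)"
    by (simp add: L2_norm_def)
  finally show ?thesis by (simp add: nrm_def)
qed

lemma nrm_tendsto_componentwise:
  fixes f :: "'c \<Rightarrow> 'a::euclidean_space \<Rightarrow> real^'n"
  assumes "\<And>i. \<forall>\<^sub>F s in F. L2 (\<lambda>x. f s x $ i)" "\<And>i. ((\<lambda>s. L2_norm (\<lambda>x. f s x $ i)) \<longlongrightarrow> 0) F"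
  shows "((\<lambda>s. nrm (f s)) \<longlongrightarrow> 0) F"
proof (rule Lim_transform_eventually)
  have "((\<lambda>s. sqrt (\<Sum>i\<in>UNIV. (L2_norm (\<lambda>x. f s x $ i))\<^sup>2)) \<longlongrightarrow> sqrt (\<Sum>i\<in>(UNIV::'n set). 0\<^sup>2)) F"
    by (intro tendsto_intros assms)
  then show "((\<lambda>s. sqrt (\<Sum>i\<in>UNIV. (L2_norm (\<lambda>x. f s x $ i))\<^sup>2)) \<longlongrightarrow> 0) F" by simp
  have "\<forall>\<^sub>F s in F. \<forall>i. L2 (\<lambda>x. f s x $ i)" using assms(1) by (simp add: eventually_all_finite)
  then show "\<forall>\<^sub>F s in F. sqrt (\<Sum>i\<in>UNIV. (L2_norm (\<lambda>x. f s x $ i))\<^sup>2) = nrm (f s)"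
    by eventually_elim (simp add: nrm_componentwise)
qed

lemma L2_deriv_componentwise:
  fixes u :: "real \<Rightarrow> 'a::euclidean_space \<Rightarrow> real^'n"
  assumes "\<And>i. has_time_derivative_L2 S (\<lambda>t x. u t x $ i) (\<lambda>t x. u' t x $ i)" "t \<in> S"
  shows "L2_deriv S u (u' t) t"
proof -
  have L: "L2v (u s)" "L2v (u' s)" if "s \<in> S" for s
    using assms that by (auto simp: L2v_componentwise has_time_derivative_L2_def)
  show ?thesis
  proof (rule L2_derivI)
    show "((\<lambda>s. nrm (\<lambda>x. inverse (s - t) *\<^sub>R (u s x - u t x) - u' t x)) \<longlongrightarrow> 0) (at t within S)"
    proof (rule nrm_tendsto_componentwise)
      fix i
      have "L2v (\<lambda>x. inverse (s - t) *\<^sub>R (u s x - u t x) - u' t x)" if "s \<in> S" for s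
        using that assms(2) by (intro L2v_diff L2v_scaleR L)
      then show "\<forall>\<^sub>F s in at t within S. L2 (\<lambda>x. (inverse (s - t) *\<^sub>R (u s x - u t x) - u' t x) $ i)"
        by (intro eventually_at_within_all) (simp add: L2v_componentwise)
      show "((\<lambda>s. L2_norm (\<lambda>x. (inverse (s - t) *\<^sub>R (u s x - u t x) - u' t x) $ i)) \<longlongrightarrow> 0) (at t within S)"
        using assms by (simp add: has_time_derivative_L2_def divide_inverse mult.commute)
    qed
  qed (use assms L in auto)
qed

lemma Hk_L2: "Hk k f \<Longrightarrow> L2 f" by (cases k) auto

lemma Hk_weak_partial:
  assumes "Hk (Suc k) f" "b \<in> Basis"
  shows "has_weak_partial b f (weak_partial b f)" "Hk k (weak_partial b f)"
proof -
  show "has_weak_partial b f (weak_partial b f)"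
    unfolding weak_partial_def by (rule someI_ex[of "has_weak_partial b f"]) (use assms in auto)
  show "Hk k (weak_partial b f)" using assms by auto
qed

lemma locally_integrable_mult_test:
  assumes f: "locally_integrable f" and t: "test_function \<psi>"
  shows "integrable lborel (\<lambda>x. f x * \<psi> x)"
proof -
  obtain r where r: "\<And>x. norm x > r \<Longrightarrow> \<psi> x = 0" using test_function_bounded_support[OF t] by metis
  obtain c where c: "\<And>x. \<bar>\<psi> x\<bar> \<le> c" by (rule test_function_bounded[OF t]) blast
  have "integrable lborel (\<lambda>x. indicator (cball 0 r) x *\<^sub>R f x)"
    using f by (auto simp: locally_integrable_def set_integrable_def)
  then have i: "integrable lborel (\<lambda>x. c * \<bar>indicator (cball 0 r) x *\<^sub>R f x\<bar>)" by (intro integrable_mult_right integrable_abs)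
  have [measurable]: "f \<in> borel_measurable borel" "\<psi> \<in> borel_measurable borel"
    using f test_function_measurable[OF t] by (auto simp: locally_integrable_def)
  show ?thesis
  proof (rule Bochner_Integration.integrable_bound[OF i])
    have "\<bar>f x * \<psi> x\<bar> \<le> c * \<bar>indicator (cball 0 r) x *\<^sub>R f x\<bar>" for x
    proof (cases "norm x \<le> r")
      case True
      then show ?thesis using mult_right_mono[OF c[of x], of "\<bar>f x\<bar>"] by (simp add: abs_mult mult.commute)
    qed (use r[of x] in simp)
    then show "AE x in lborel. norm (f x * \<psi> x) \<le> norm (c * \<bar>indicator (cball 0 r) x *\<^sub>R f x\<bar>)"
      by (intro AE_I2) (simp add: order_trans[OF _ abs_ge_self])
  qed simp
qed

lemma has_weak_partial_diff:
  assumes "has_weak_partial b f f'" "has_weak_partial b g g'" "b \<in> Basis"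
  shows "has_weak_partial b (\<lambda>x. f x - g x) (\<lambda>x. f' x - g' x)"
  unfolding has_weak_partial_def
proof (intro conjI allI impI)
  note l = assms(1,2)[unfolded has_weak_partial_def]
  show "locally_integrable (\<lambda>x. f x - g x)" "locally_integrable (\<lambda>x. f' x - g' x)"
    using l by (auto simp: locally_integrable_def)
  fix \<psi> :: "'a \<Rightarrow> real" assume t: "test_function \<psi>"
  have "integrable lborel (\<lambda>x. w x * \<psi> x)" "integrable lborel (\<lambda>x. w x * partial b \<psi> x)"
    if "locally_integrable w" for w
    using that t by (auto intro: locally_integrable_mult_test test_function_partial assms(3))
  then show "(LBINT x. (f x - g x) * partial b \<psi> x) = - (LBINT x. (f' x - g' x) * \<psi> x)"
    using l t by (simp add: left_diff_distrib)
qed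

lemma weak_curlI:
  assumes u: "L2v u" and B: "L2v B"
    and D: "\<And>i j. has_weak_partial (axis i 1) (\<lambda>y. u y $ j) (D i j)"
    and BD: "\<And>x. B x = vector [D 2 3 x - D 3 2 x, D 3 1 x - D 1 3 x, D 1 2 x - D 2 1 x]"
  shows "weak_curl u B"
  unfolding weak_curl_def
proof (intro conjI u B allI impI)
  fix \<psi> :: "real^3 \<Rightarrow> real" assume t: "test_function \<psi>"
  have ax: "axis i 1 \<in> (Basis :: (real^3) set)" for i by (simp add: axis_in_Basis_iff)
  have g: "grad \<psi> x $ i = partial (axis i 1) \<psi> x" for x i
    using grad_inner[OF ax, of \<psi> x i] by (simp add: inner_axis)
  have l: "locally_integrable (\<lambda>y. u y $ j)" "locally_integrable (D i j)" for i j
    using D[of i j] by (auto simp: has_weak_partial_def)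
  have i1: "integrable lborel (\<lambda>x. u x $ j * partial (axis i 1) \<psi> x)" for i j
    by (rule locally_integrable_mult_test[OF l(1) test_function_partial[OF t ax]])
  have i2: "integrable lborel (\<lambda>x. \<psi> x * D i j x)" for i j
    using locally_integrable_mult_test[OF l(2) t] by (simp add: mult.commute)
  have e: "(LBINT x. u x $ j * partial (axis i 1) \<psi> x) = - (LBINT x. \<psi> x * D i j x)" for i j
    using D[of i j] t by (simp add: has_weak_partial_def mult.commute)
  have I: "integrable lborel (\<lambda>x. cross3 (u x) (grad \<psi> x))" "integrable lborel (\<lambda>x. \<psi> x *\<^sub>R B x)"
    using integrable_cross[OF u test_function_grad_L2v[OF t]] integrable_scaleR_L2v[OF test_function_L2v[OF t] B] .
  have c: "(LBINT x. f x) $ i = (LBINT x. f x $ i)"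
    if "integrable lborel f" for f :: "real^3 \<Rightarrow> real^3" and i
    using integral_bounded_linear[OF bounded_linear_vec_nth that, of i] by simp
  show "(LBINT x. cross3 (u x) (grad \<psi> x)) = (LBINT x. \<psi> x *\<^sub>R B x)"
    unfolding vec_eq_iff forall_3 c[OF I(1)] c[OF I(2)]
    by (simp add: cross3_def BD g i1 i2 e right_diff_distrib)
qed

text \<open>Components of \<open>curl u\<close> are differences of functions with weak derivatives,
  so the derivatives chosen inside \<open>curl (curl u)\<close> exist. Square integrability of the
  second curl is left as a premise: a chosen derivative of a difference is the difference of the
  chosen ones only up to null sets, and the equation supplies the premise without that
  argument.\<close>

lemma curl_weak_curl:
  assumes H: "\<And>i. Hk 2 (\<lambda>x. u x $ i)"
  shows "weak_curl u (curl u)"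
    and "L2v (curl (curl u)) \<Longrightarrow> weak_curl (curl u) (curl (curl u))"
    and "curl (curl u) \<in> borel_measurable borel"
proof -
  have ax: "axis i 1 \<in> (Basis :: (real^3) set)" for i by (simp add: axis_in_Basis_iff)
  define D where "D i j = weak_partial (axis i 1) (\<lambda>y. u y $ j)" for i j :: 3
  have D: "has_weak_partial (axis i 1) (\<lambda>y. u y $ j) (D i j)" "Hk 1 (D i j)" for i j
    using Hk_weak_partial[of 1 "\<lambda>y. u y $ j" "axis i 1"] H[of j] ax by (auto simp: D_def numeral_2_eq_2)
  have LD: "L2 (D i j)" for i j using Hk_L2[OF D(2)] .
  have cu: "curl u x = vector [D 2 3 x - D 3 2 x, D 3 1 x - D 1 3 x, D 1 2 x - D 2 1 x]" for x
    by (simp add: curl_def D_def)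
  have Ld: "L2 (\<lambda>x. D i j x - D k l x)" for i j k l
    using L2v_diff[of "D i j" "D k l"] LD by (simp add: L2v_def L2_def)
  have Lc: "L2v (curl u)" unfolding L2v_componentwise forall_3 cu[abs_def] by (simp add: Ld)
  have Lu: "L2v u" using Hk_L2[OF H] by (simp add: L2v_componentwise)
  show "weak_curl u (curl u)" by (rule weak_curlI[OF Lu Lc D(1) cu])
  have DD: "has_weak_partial (axis m 1) (D i j) (weak_partial (axis m 1) (D i j))" for m i j
    using Hk_weak_partial(1)[of 0 "D i j" "axis m 1"] D(2)[of i j] ax by simp
  have ex: "\<exists>g. has_weak_partial (axis m 1) (\<lambda>x. curl u x $ j) g" for m j
  proof -
    have "\<forall>j. \<exists>g. has_weak_partial (axis m 1) (\<lambda>x. curl u x $ j) g"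
      unfolding forall_3 cu by (auto intro!: exI has_weak_partial_diff DD ax)
    then show ?thesis by blast
  qed
  define D' where "D' i j = weak_partial (axis i 1) (\<lambda>y. curl u y $ j)" for i j :: 3
  have D': "has_weak_partial (axis i 1) (\<lambda>y. curl u y $ j) (D' i j)" for i j
    unfolding D'_def weak_partial_def by (rule someI_ex[OF ex])
  have cc: "curl (curl u) x = vector [D' 2 3 x - D' 3 2 x, D' 3 1 x - D' 1 3 x, D' 1 2 x - D' 2 1 x]" for x
    by (subst curl_def) (simp add: D'_def)
  show "weak_curl (curl u) (curl (curl u))" if "L2v (curl (curl u))"
    by (rule weak_curlI[OF Lc that D' cc])
  have [measurable]: "D' i j \<in> borel_measurable borel" for i j
    using D'[of i j] by (simp add: has_weak_partial_def locally_integrable_def)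
  have "\<forall>i. (\<lambda>x. curl (curl u) x $ i) \<in> borel_measurable borel" unfolding forall_3 cc by simp
  then show "curl (curl u) \<in> borel_measurable borel"
    by (subst borel_measurable_euclidean_space) (auto simp: Basis_vec_def inner_axis)
qed

text \<open>The two curls are carried along as explicit fields B and C. \<open>curl\<close> rests on
  a choice of derivatives and is not literally linear, whereas this form can be subtracted
  directly.\<close>

definition maxwell_weak where
  "maxwell_weak T F E E' E'' B C \<longleftrightarrow>
     (\<forall>t. 0 \<le> t \<longrightarrow> t \<le> T \<longrightarrow> continuous_on UNIV (E t) \<and> L2_deriv {0..T} E (E' t) t \<and>
        L2_deriv {0..T} E' (E'' t) t \<and> L2_lim E'' (E'' t) (at t within {0..T})) \<and>
     (\<forall>t. 0 < t \<longrightarrow> t \<le> T \<longrightarrow> weak_curl (E t) (B t) \<and> weak_curl (B t) (C t) \<and>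
        (AE x in lborel. E'' t x + C t x = F t x)) \<and>
     (\<forall>x. E 0 x = 0) \<and> (AE x in lborel. E' 0 x = 0)"

lemma maxwell_weak_diff:
  assumes "maxwell_weak T F E E' E'' B C" "maxwell_weak T G D D' D'' A A'"
  shows "maxwell_weak T (\<lambda>t x. F t x - G t x) (\<lambda>t x. E t x - D t x) (\<lambda>t x. E' t x - D' t x)
    (\<lambda>t x. E'' t x - D'' t x) (\<lambda>t x. B t x - A t x) (\<lambda>t x. C t x - A' t x)"
  unfolding maxwell_weak_def
proof (intro conjI allI impI)
  note a = assms[unfolded maxwell_weak_def]
  fix t assume t: "0 < t" "t \<le> T"
  then have "AE x in lborel. E'' t x + C t x = F t x" "AE x in lborel. D'' t x + A' t x = G t x"
    using a by auto
  then show "AE x in lborel. E'' t x - D'' t x + (C t x - A' t x) = F t x - G t x"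
    by eventually_elim (simp add: algebra_simps)
next
  note a = assms[unfolded maxwell_weak_def]
  have "AE x in lborel. E' 0 x = 0" "AE x in lborel. D' 0 x = 0" using a by auto
  then show "AE x in lborel. E' 0 x - D' 0 x = 0" by eventually_elim simp
qed (use assms in \<open>auto simp: maxwell_weak_def
  intro!: continuous_on_diff L2_deriv_diff L2_lim_diff weak_curl_diff\<close>)

lemma maxwell_solution_weak:
  assumes sol: "maxwell_solution F E" and F: "\<And>t. t > 0 \<Longrightarrow> L2v (F t)" and T: "T > 0"
  obtains E' E'' B C where "maxwell_weak T F E E' E'' B C"
proof -
  from sol obtain E' E'' where c: "\<And>t. t \<ge> 0 \<Longrightarrow> continuous_on UNIV (E t)"
    and H: "\<And>\<tau> i. \<tau> > 0 \<Longrightarrow> continuous_in_Hk 2 {0..\<tau>} (\<lambda>t x. E t x $ i)"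
    and C2: "\<And>\<tau> i. \<tau> > 0 \<Longrightarrow> C2_in_L2 {0..\<tau>} (\<lambda>t x. E t x $ i) (\<lambda>t x. E' t x $ i) (\<lambda>t x. E'' t x $ i)"
    and eq: "\<And>t. t > 0 \<Longrightarrow> AE x in lborel. E'' t x + curl (curl (E t)) x = F t x"
    and ini: "\<And>x. E 0 x = 0" "AE x in lborel. E' 0 x = 0"
    unfolding maxwell_solution_def by blast
  have Hk: "Hk 2 (\<lambda>x. E t x $ i)" if "t > 0" for t i
    using H[of t i] that by (auto simp: continuous_in_Hk_def)
  have L'': "L2v (E'' t)" if "t \<ge> 0" for t
    using C2[of "t + 1"] that by (auto simp: C2_in_L2_def continuous_in_Hk_def L2v_componentwise)
  \<comment> \<open>The equation identifies the second curl almost everywhere with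
    \<open>F t - E'' t\<close>, both terms of which are square integrable.\<close>
  have LC: "L2v (curl (curl (E t)))" if t: "t > 0" for t
  proof -
    have m: "curl (curl (E t)) \<in> borel_measurable borel" by (rule curl_weak_curl(3)[OF Hk[OF t]])
    have d: "L2v (\<lambda>x. F t x - E'' t x)" using F[OF t] L''[of t] t by (intro L2v_diff) auto
    have "AE x in lborel. (norm (F t x - E'' t x))\<^sup>2 = (norm (curl (curl (E t)) x))\<^sup>2"
      using eq[OF t]
    proof eventually_elim
      case (elim x)
      then have "F t x - E'' t x = curl (curl (E t)) x" by (metis add_diff_cancel_left')
      then show ?case by simp
    qed
    then have "integrable lborel (\<lambda>x. (norm (curl (curl (E t)) x))\<^sup>2)"
      by (rule integrable_cong_AE_imp[rotated 2]) (use d m in \<open>auto simp: L2v_def\<close>)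
    then show ?thesis using m by (simp add: L2v_def)
  qed
  show thesis
  proof (rule that[of E' E'' "\<lambda>t. curl (E t)" "\<lambda>t. curl (curl (E t))"], unfold maxwell_weak_def, intro conjI allI impI)
    fix t :: real assume t: "0 \<le> t" "t \<le> T"
    show "L2_deriv {0..T} E (E' t) t" "L2_deriv {0..T} E' (E'' t) t"
      using C2[OF T] t by (auto intro!: L2_deriv_componentwise simp: C2_in_L2_def)
    have "((\<lambda>s. nrm (\<lambda>x. E'' s x - E'' t x)) \<longlongrightarrow> 0) (at t within {0..T})"
    proof (rule nrm_tendsto_componentwise)
      fix i
      have "L2v (\<lambda>x. E'' s x - E'' t x)" if "s \<in> {0..T}" for s
        using that t by (intro L2v_diff L'') auto
      then show "\<forall>\<^sub>F s in at t within {0..T}. L2 (\<lambda>x. (E'' s x - E'' t x) $ i)"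
        by (intro eventually_at_within_all) (simp add: L2v_componentwise)
      have "((\<lambda>s. Hk_norm 0 (\<lambda>x. E'' s x $ i - E'' t x $ i)) \<longlongrightarrow> 0) (at t within {0..T})"
        using C2[OF T, of i] t by (auto simp: C2_in_L2_def continuous_in_Hk_def)
      moreover have "L2_norm f \<ge> 0" for f :: "real^3 \<Rightarrow> real" by (simp add: L2_norm_def)
      ultimately show "((\<lambda>s. L2_norm (\<lambda>x. (E'' s x - E'' t x) $ i)) \<longlongrightarrow> 0) (at t within {0..T})"
        by (simp add: Hk_norm_def)
    qed
    then show "L2_lim E'' (E'' t) (at t within {0..T})"
      using L'' t by (auto simp: L2_lim_def intro!: eventually_at_within_all)
  qed (use c eq ini curl_weak_curl(1)[OF Hk] curl_weak_curl(2)[OF Hk LC] in auto)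
qed

subsection \<open>The energy argument outside the sphere\<close>

text \<open>Since \<open>\<langle>W'' t, W s\<rangle>\<close> is symmetric in \<open>s\<close> and \<open>t\<close>, the function \<open>\<langle>W'' t, W t\<rangle>\<close> can be
  differentiated without differentiating \<open>W''\<close>.\<close>

lemma energy_vanishes:
  fixes W W' W'' :: "real \<Rightarrow> 'a::euclidean_space \<Rightarrow> 'b::euclidean_space"
  assumes T: "T > 0"
    and d1: "\<And>t. 0 \<le> t \<Longrightarrow> t \<le> T \<Longrightarrow> L2_deriv {0..T} W (W' t) t"
    and d2: "\<And>t. 0 \<le> t \<Longrightarrow> t \<le> T \<Longrightarrow> L2_deriv {0..T} W' (W'' t) t"
    and c: "\<And>t. 0 \<le> t \<Longrightarrow> t \<le> T \<Longrightarrow> L2_lim W'' (W'' t) (at t within {0..T})"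
    and sym: "\<And>s t. 0 < s \<Longrightarrow> s < T \<Longrightarrow> 0 < t \<Longrightarrow> t < T \<Longrightarrow> ip (W'' s) (W t) = ip (W'' t) (W s)"
    and neg: "\<And>t. 0 < t \<Longrightarrow> t < T \<Longrightarrow> ip (W'' t) (W t) \<le> 0"
    and z: "nrm (W 0) = 0" "nrm (W' 0) = 0"
    and t: "0 \<le> t" "t \<le> T"
  shows "nrm (W t) = 0" and "nrm (W' t) = 0"
proof -
  define q where "q s = ip (W'' s) (W s)" for s
  have L: "L2v (W s)" "L2v (W' s)" "L2v (W'' s)" if "0 \<le> s" "s \<le> T" for s
    using L2_deriv_L2v d1[OF that] d2[OF that] by (blast+)
  have cq: "continuous_on {0..T} q"
    unfolding continuous_on_def q_def
  proof
    fix r assume "r \<in> {0..T}"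
    then have r: "0 \<le> r" "r \<le> T" by auto
    show "((\<lambda>s. ip (W'' s) (W s)) \<longlongrightarrow> ip (W'' r) (W r)) (at r within {0..T})"
      by (intro ip_tendsto c L2_deriv_tendsto[OF d1] r)
  qed
  have dq: "(q has_real_derivative 2 * ip (W'' r) (W' r)) (at r)" if r: "0 < r" "r < T" for r
  proof -
    have aw: "at r within {0..T} = at r" using r by (intro at_within_interior) auto
    have r': "0 \<le> r" "r \<le> T" using r by auto
    \<comment> \<open>Pairing the sum of \<open>W''\<close> at s and r with this quotient gives
      exactly the difference quotient of q, because the two mixed terms cancel by
      \<open>sym\<close>.\<close>
    let ?s = "\<lambda>s x. inverse (s - r) *\<^sub>R (W s x - W r x)"
    have "((\<lambda>s. ip (\<lambda>x. W'' s x + W'' r x) (?s s)) \<longlongrightarrow> ip (\<lambda>x. W'' r x + W'' r x) (W' r)) (at r)"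
      using L2_lim_add[OF c[OF r'] L2_lim_const[OF L(3)[OF r']]] d1[OF r'] unfolding aw
      by (intro ip_tendsto) (simp_all add: L2_deriv_def aw)
    moreover have "\<forall>\<^sub>F s in at r. ip (\<lambda>x. W'' s x + W'' r x) (?s s) = (q s - q r) / (s - r)"
    proof -
      have "\<forall>\<^sub>F s in at r. s \<in> {0<..<T}" using r by (intro eventually_at_in_open') auto
      then show ?thesis
      proof eventually_elim
        case (elim s)
        then have s: "0 \<le> s" "s \<le> T" "0 < s" "s < T" by auto
        have "ip (\<lambda>x. W'' s x + W'' r x) (?s s) = inverse (s - r) * ip (\<lambda>x. W'' s x + W'' r x) (\<lambda>x. W s x - W r x)"
          by (rule ip_scale_right)
        also have "ip (\<lambda>x. W'' s x + W'' r x) (\<lambda>x. W s x - W r x) = q s - q r"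
          using sym[OF s(3,4) r] s(1,2) r' by (simp add: q_def ip_add_left ip_diff_right L L2v_diff)
        finally show ?case by (simp add: divide_inverse mult.commute)
      qed
    qed
    ultimately have "((\<lambda>s. (q s - q r) / (s - r)) \<longlongrightarrow> ip (\<lambda>x. W'' r x + W'' r x) (W' r)) (at r)"
      by (rule Lim_transform_eventually)
    then show ?thesis using r' by (simp add: has_field_derivative_iff ip_add_left L)
  qed
  have di: "((\<lambda>s. ip (u s) (u s)) has_real_derivative 2 * ip (u' r) (u r)) (at r within {0..T})"
    if "L2_deriv {0..T} u (u' r) r" for u u' :: "real \<Rightarrow> 'a \<Rightarrow> 'b" and r
    using ip_has_derivative[OF that that] by (simp add: ip_commute[of "u r"])
  have const: "f s = f 0" if "continuous_on {0..T} f" "\<And>r. 0 < r \<Longrightarrow> r < T \<Longrightarrow> (f has_real_derivative 0) (at r)"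
    "0 \<le> s" "s \<le> T" for f s
  proof (cases "s = 0")
    case False
    then show ?thesis
      using that by (intro DERIV_isconst_end[of 0 s f]) (auto intro: continuous_on_subset)
  qed simp
  have cont_ip: "continuous_on {0..T} (\<lambda>s. ip (u s) (u s))"
    if du: "\<And>r. 0 \<le> r \<Longrightarrow> r \<le> T \<Longrightarrow> L2_deriv {0..T} u (u' r) r" for u u' :: "real \<Rightarrow> 'a \<Rightarrow> 'b"
  proof (rule DERIV_continuous_on)
    fix r assume "r \<in> {0..T}"
    then show "((\<lambda>s. ip (u s) (u s)) has_real_derivative 2 * ip (u' r) (u r)) (at r within {0..T})"
      by (intro di du) auto
  qed
  have at: "at r within {0..T} = at r" if "0 < r" "r < T" for r
    using that by (intro at_within_interior) auto
  \<comment> \<open>The conserved energy: for the Maxwell field, \<open>- q s\<close> will be the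
    squared norm of the curl in the exterior.\<close>
  define e where "e s = ip (W' s) (W' s) - q s" for s
  have qz: "q s = 0" if "nrm (W s) = 0" "0 \<le> s" "s \<le> T" for s
    using ip_CS[OF L(3,1)[OF that(2,3)]] that(1) by (simp add: q_def)
  have e0: "e s = 0" if "0 \<le> s" "s \<le> T" for s
  proof -
    have "e s = e 0"
    proof (rule const[OF _ _ that])
      show "continuous_on {0..T} e"
        unfolding e_def by (intro continuous_on_diff cont_ip[OF d2] cq)
      fix r assume r: "0 < r" "r < T"
      have "((\<lambda>s. ip (W' s) (W' s)) has_real_derivative 2 * ip (W'' r) (W' r)) (at r)"
        using di[of W' W'' r, OF d2[of r]] r at[OF r] by simp
      from DERIV_diff[OF this dq[OF r]] show "(e has_real_derivative 0) (at r)"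
        by (simp add: e_def[abs_def])
    qed
    also have "\<dots> = 0" using qz[OF z(1)] z(2) T nrm_sq[of "W' 0"] by (simp add: e_def)
    finally show ?thesis .
  qed
  \<comment> \<open>Both parts of the energy are nonnegative at interior times, so zero energy kills
    each of them.\<close>
  have W'0: "nrm (W' r) = 0" if "0 < r" "r < T" for r
    using e0[of r] neg[OF that] that ip_self_nonneg[of "W' r"] by (simp add: e_def q_def nrm_def)
  have W0: "nrm (W s) = 0" if "0 \<le> s" "s \<le> T" for s
  proof -
    have "ip (W s) (W s) = ip (W 0) (W 0)"
    proof (rule const[OF cont_ip[OF d1] _ that])
      fix r assume r: "0 < r" "r < T"
      have "ip (W' r) (W r) = 0" using ip_CS[of "W' r" "W r"] L[of r] W'0[OF r] r by simp
      then show "((\<lambda>s. ip (W s) (W s)) has_real_derivative 0) (at r)"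
        using di[of W W' r, OF d1[of r]] r at[OF r] by simp
    qed
    then show ?thesis using z(1) by (simp add: nrm_def)
  qed
  show "nrm (W t) = 0" by (rule W0[OF t])
  \<comment> \<open>This reaches the endpoints too: once W vanishes there, so does q, and the energy
    reduces to the norm of \<open>W'\<close>.\<close>
  show "nrm (W' t) = 0" using e0[OF t] qz[OF W0[OF t] t] by (simp add: e_def nrm_def)
qed

subsection \<open>Testing with plane waves\<close>

lemma smooth_seq_Lipschitz:
  assumes "smooth_seq k" obtains c where "\<And>s t. \<bar>s\<bar> \<le> r \<Longrightarrow> \<bar>t\<bar> \<le> r \<Longrightarrow> \<bar>k n s - k n t\<bar> \<le> c * \<bar>s - t\<bar>"
proof -
  obtain c where c: "\<And>x. x \<in> {-r..r} \<Longrightarrow> norm (k (Suc n) x) \<le> c"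
    by (rule compact_image_bound[OF compact_Icc smooth_seq_continuous[OF assms]]) blast
  have "norm (k n s - k n t) \<le> c * norm (s - t)" if "\<bar>s\<bar> \<le> r" "\<bar>t\<bar> \<le> r" for s t
  proof (rule field_differentiable_bound[of "{-r..r}" "k n" "k (Suc n)"])
    show "(k n has_real_derivative k (Suc n) z) (at z within {-r..r})" for z
      by (rule has_field_derivative_at_within[OF smooth_seqD[OF assms]])
  qed (use c that in auto)
  then show thesis by (intro that[of c]) simp
qed

text \<open>The cutoff c turns the plane wave into a test function. Taking one profile rather than a
  sequence makes the time derivatives waves of the same form.\<close>

definition wave :: "('a::euclidean_space \<Rightarrow> real) \<Rightarrow> (real \<Rightarrow> real) \<Rightarrow> 'a \<Rightarrow> real \<Rightarrow> 'a \<Rightarrow> real" where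
  "wave c k d t x = c x * k (t + x \<bullet> d)"

lemma test_function_wave:
  assumes "test_function c" "smooth_seq k" shows "test_function (wave c (k n) d t)"
proof -
  have "Ck m (\<lambda>x. t + x \<bullet> d)" for m
    by (intro Ck_add Ck_const Ck_linear bounded_linear_inner_left)
  then have "Ck m (\<lambda>x. k n (t + x \<bullet> d))" for m by (rule Ck_compose[OF assms(2)])
  from test_function_mult[OF this assms(1)] show ?thesis
    by (simp add: wave_def[abs_def] mult.commute)
qed

lemma grad_wave:
  fixes x :: "'a::euclidean_space"
  assumes "test_function c" "smooth_seq k" and c1: "\<And>y. norm y < r \<Longrightarrow> c y = 1" and x: "norm x < r"
  shows "grad (wave c (k n) d t) x = wave c (k (Suc n)) d t x *\<^sub>R d"
proof (rule grad_eqI)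
  have "((\<lambda>x. t + x \<bullet> d) has_derivative (\<lambda>h. h \<bullet> d)) (at x)" by (auto intro!: derivative_eq_intros)
  from has_derivative_compose[OF this smooth_seqD[OF assms(2), unfolded has_field_derivative_def]]
  have "((\<lambda>x. k n (t + x \<bullet> d)) has_derivative (\<lambda>h. (wave c (k (Suc n)) d t x *\<^sub>R d) \<bullet> h)) (at x)"
    using c1[OF x] by (simp add: wave_def inner_commute)
  then show "(wave c (k n) d t has_derivative (\<lambda>h. (wave c (k (Suc n)) d t x *\<^sub>R d) \<bullet> h)) (at x)"
  proof (rule has_derivative_transform_within_open)
    show "open (ball (0::'a) r)" "x \<in> ball 0 r" using x by auto
    show "k n (t + y \<bullet> d) = wave c (k n) d t y" if "y \<in> ball 0 r" for y
      using c1[of y] that by (simp add: wave_def)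
  qed
qed

text \<open>The Taylor remainder of the profile is quadratic in \<open>s - t\<close>, uniformly on
  the bounded support of c, by a Lipschitz bound for the next derivative.\<close>

lemma L2_deriv_wave:
  assumes c: "test_function c" and k: "smooth_seq k" and t: "t \<in> {0..T}"
  shows "L2_deriv {0..T} (\<lambda>t x. wave c (k n) d t x *\<^sub>R p) (\<lambda>x. wave c (k (Suc n)) d t x *\<^sub>R p) t"
proof -
  have Lw: "L2v (\<lambda>x. wave c (k n) d s x *\<^sub>R p)" for n s
    by (rule L2v_bound[OF _ test_function_L2v[OF test_function_wave[OF c k]], of _ "norm p"])
       (use test_function_measurable[OF test_function_wave[OF c k]] in \<open>auto simp: mult.commute\<close>)
  have Lc: "L2v (\<lambda>x. c x *\<^sub>R p)"
    by (rule L2v_bound[OF _ test_function_L2v[OF c], of _ "norm p"])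
       (use test_function_measurable[OF c] in \<open>auto simp: mult.commute\<close>)
  obtain \<rho> where \<rho>: "\<rho> > 0" "\<And>x. norm x > \<rho> \<Longrightarrow> c x = 0" using test_function_bounded_support[OF c] by metis
  \<comment> \<open>This bounds the phase \<open>t + x \<bullet> d\<close> for times in the interval
    and x in the support of c.\<close>
  define r where "r = \<bar>T\<bar> + \<rho> * norm d"
  obtain M where M: "\<And>s t. \<bar>s\<bar> \<le> r \<Longrightarrow> \<bar>t\<bar> \<le> r \<Longrightarrow> \<bar>k (Suc n) s - k (Suc n) t\<bar> \<le> M * \<bar>s - t\<bar>"
    by (rule smooth_seq_Lipschitz[OF k]) blast
  show ?thesis
  proof (rule L2_derivI[OF t Lw Lw Lim_null_comparison])
    have "((\<lambda>s. \<bar>M\<bar> * \<bar>s - t\<bar> * nrm (\<lambda>x. c x *\<^sub>R p)) \<longlongrightarrow> \<bar>M\<bar> * \<bar>t - t\<bar> * nrm (\<lambda>x. c x *\<^sub>R p)) (at t within {0..T})"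
      by (intro tendsto_intros)
    then show "((\<lambda>s. \<bar>M\<bar> * \<bar>s - t\<bar> * nrm (\<lambda>x. c x *\<^sub>R p)) \<longlongrightarrow> 0) (at t within {0..T})" by simp
    show "\<forall>\<^sub>F s in at t within {0..T}. norm (nrm (\<lambda>x. inverse (s - t) *\<^sub>R (wave c (k n) d s x *\<^sub>R p - wave c (k n) d t x *\<^sub>R p)
      - wave c (k (Suc n)) d t x *\<^sub>R p)) \<le> \<bar>M\<bar> * \<bar>s - t\<bar> * nrm (\<lambda>x. c x *\<^sub>R p)"
      unfolding eventually_at_filter
    proof (intro always_eventually allI impI)
      fix s assume s: "s \<noteq> t" "s \<in> {0..T}"
      let ?w = "\<lambda>x. inverse (s - t) *\<^sub>R (wave c (k n) d s x *\<^sub>R p - wave c (k n) d t x *\<^sub>R p)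
        - wave c (k (Suc n)) d t x *\<^sub>R p"
      have Lq: "L2v ?w" by (intro L2v_diff L2v_scaleR Lw)
      have pt: "norm (?w x) \<le> norm ((\<bar>M\<bar> * \<bar>s - t\<bar>) *\<^sub>R (c x *\<^sub>R p))" for x
      proof (cases "norm x > \<rho>")
        case True
        then show ?thesis using \<rho>(2) by (simp add: wave_def)
      next
        case False
        define y where "y = x \<bullet> d"
        have "\<bar>y\<bar> \<le> \<rho> * norm d"
          unfolding y_def by (rule order_trans[OF Cauchy_Schwarz_ineq2]) (use False in \<open>auto intro!: mult_right_mono\<close>)
        then have b: "\<bar>\<tau> + y\<bar> \<le> r" if "\<tau> \<in> {0..T}" for \<tau> using that by (auto simp: r_def)
        \<comment> \<open>Subtracting the linear part makes the derivative of \<phi> vanish at t, so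
          the mean value inequality yields a second factor \<open>s - t\<close>.\<close>
        define \<phi> where "\<phi> v = k n (v + y) - v * k (Suc n) (t + y)" for v
        have "\<bar>\<phi> s - \<phi> t\<bar> \<le> (\<bar>M\<bar> * \<bar>s - t\<bar>) * \<bar>s - t\<bar>"
        proof -
          define I where "I = closed_segment s t"
          have I: "convex I" "s \<in> I" "t \<in> I" by (auto simp: I_def)
          have sub: "I \<subseteq> {0..T}" unfolding I_def using s t by (intro closed_segment_subset) auto
          have "norm (\<phi> s - \<phi> t) \<le> (\<bar>M\<bar> * \<bar>s - t\<bar>) * norm (s - t)"
          proof (rule field_differentiable_bound[OF I(1), of \<phi> "\<lambda>v. k (Suc n) (v + y) - k (Suc n) (t + y)"])
            fix v assume v: "v \<in> I"
            have "((\<lambda>v. v + y) has_real_derivative 1) (at v within I)" by (auto intro!: derivative_eq_intros)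
            from DERIV_chain2[OF smooth_seqD[OF k] this]
            have "((\<lambda>v. k n (v + y)) has_real_derivative k (Suc n) (v + y)) (at v within I)" by simp
            moreover have "((\<lambda>v. v * k (Suc n) (t + y)) has_real_derivative k (Suc n) (t + y)) (at v within I)"
              by (auto intro!: derivative_eq_intros)
            ultimately show "(\<phi> has_real_derivative k (Suc n) (v + y) - k (Suc n) (t + y)) (at v within I)"
              unfolding \<phi>_def[abs_def] by (rule DERIV_diff)
            have "\<bar>v - t\<bar> \<le> \<bar>s - t\<bar>" using v by (auto simp: I_def closed_segment_eq_real_ivl split: if_splits)
            then have "M * \<bar>v - t\<bar> \<le> \<bar>M\<bar> * \<bar>s - t\<bar>" by (intro mult_mono) auto
            then show "norm (k (Suc n) (v + y) - k (Suc n) (t + y)) \<le> \<bar>M\<bar> * \<bar>s - t\<bar>"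
              using M[OF b b, of v t] subsetD[OF sub v] t by (simp del: atLeastAtMost_iff)
          qed (use I in auto)
          then show ?thesis by simp
        qed
        then have *: "\<bar>\<phi> s - \<phi> t\<bar> / \<bar>s - t\<bar> \<le> \<bar>M\<bar> * \<bar>s - t\<bar>" using s by (simp add: field_simps)
        have "?w x = (inverse (s - t) * (c x * k n (s + y) - c x * k n (t + y)) - c x * k (Suc n) (t + y)) *\<^sub>R p"
          by (simp add: wave_def y_def scaleR_diff_left right_diff_distrib scaleR_diff_right)
        also have "inverse (s - t) * (c x * k n (s + y) - c x * k n (t + y)) - c x * k (Suc n) (t + y)
            = c x * ((\<phi> s - \<phi> t) / (s - t))"
          using s(1) by (simp add: \<phi>_def divide_simps) (simp add: algebra_simps)
        finally have "?w x = (c x * ((\<phi> s - \<phi> t) / (s - t))) *\<^sub>R p" .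
        then have "norm (?w x) = (\<bar>c x\<bar> * (\<bar>\<phi> s - \<phi> t\<bar> / \<bar>s - t\<bar>)) * norm p" by (simp add: abs_mult)
        also have "\<dots> \<le> (\<bar>c x\<bar> * (\<bar>M\<bar> * \<bar>s - t\<bar>)) * norm p" by (intro mult_right_mono mult_left_mono * norm_ge_zero abs_ge_zero)
        finally show ?thesis by (simp add: abs_mult mult_ac)
      qed
      have "nrm ?w \<le> nrm (\<lambda>x. (\<bar>M\<bar> * \<bar>s - t\<bar>) *\<^sub>R (c x *\<^sub>R p))"
        unfolding nrm_def ip_def
      proof (intro real_sqrt_le_mono integral_mono ip_integrable Lq L2v_scaleR Lc)
        fix x show "?w x \<bullet> ?w x \<le> ((\<bar>M\<bar> * \<bar>s - t\<bar>) *\<^sub>R (c x *\<^sub>R p)) \<bullet> ((\<bar>M\<bar> * \<bar>s - t\<bar>) *\<^sub>R (c x *\<^sub>R p))"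
          using power_mono[OF pt[of x], of 2] unfolding power2_norm_eq_inner by simp
      qed
      also have "\<dots> = \<bar>M\<bar> * \<bar>s - t\<bar> * nrm (\<lambda>x. c x *\<^sub>R p)" by (subst nrm_scale) simp
      finally show "norm (nrm ?w) \<le> \<bar>M\<bar> * \<bar>s - t\<bar> * nrm (\<lambda>x. c x *\<^sub>R p)" by simp
    qed
  qed
qed

text \<open>With \<open>d\<close> a unit vector and \<open>p\<close> orthogonal to \<open>d\<close>, the plane wave \<open>k (t + x \<bullet> d) p\<close> is divergence
  free, and \<open>curl curl\<close> acts on it as minus the second derivative of the profile.\<close>

lemma ip_curl_curl_wave:
  assumes E: "weak_curl E B" "weak_curl B C" and c: "test_function c" and k: "smooth_seq k"
    and R: "R < r" and c1: "\<And>y. norm y < r \<Longrightarrow> c y = 1"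
    and E0: "AE x in lborel. norm x > R \<longrightarrow> E x = 0" and B0: "AE x in lborel. norm x > R \<longrightarrow> B x = 0"
    and d: "norm d = 1" and p: "p \<bullet> d = 0"
  shows "ip C (\<lambda>x. wave c (k 0) d t x *\<^sub>R p) = - ip E (\<lambda>x. wave c (k 2) d t x *\<^sub>R p)"
proof -
  have L: "L2v E" "L2v B" "L2v C" using E by (auto simp: weak_curl_def)
  note tw = test_function_wave[OF c k, of _ d t]
  note Lw = test_function_L2v[OF tw]
  note [measurable] = L[THEN L2v_measurable] test_function_measurable[OF tw]
  have gw[measurable]: "grad (wave c (k n) d t) \<in> borel_measurable borel" for n
    using L2v_measurable[OF test_function_grad_L2v[OF tw]] .
  \<comment> \<open>The gradient of the cutoff never enters: the cutoff is 1 near the points with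
    norm at most R, and the field is zero at almost all others.\<close>
  have g: "AE x in lborel. cross3 (A x) (grad (wave c (k n) d t) x) = cross3 (wave c (k (Suc n)) d t x *\<^sub>R A x) d"
    if "AE x in lborel. norm x > R \<longrightarrow> A x = 0" for A :: "real^3 \<Rightarrow> real^3" and n
    using that
  proof eventually_elim
    case (elim x)
    then show ?case
    proof (cases "norm x > R")
      case False
      then show ?thesis
        using grad_wave[OF c k c1, where x = x and n = n and d = d and t = t] R
        by (simp add: cross_mult_right cross_mult_left)
    qed simp
  qed
  have step: "(LBINT x. wave c (k n) d t x *\<^sub>R A' x) = cross3 (LBINT x. wave c (k (Suc n)) d t x *\<^sub>R A x) d"
    if A: "weak_curl A A'" "AE x in lborel. norm x > R \<longrightarrow> A x = 0" for A A' n
  proof -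
    have [measurable]: "A \<in> borel_measurable borel" using A by (auto simp: weak_curl_def L2v_def)
    have "(LBINT x. wave c (k n) d t x *\<^sub>R A' x) = (LBINT x. cross3 (A x) (grad (wave c (k n) d t) x))"
      using A(1) tw[of n] by (simp add: weak_curl_def)
    also have "\<dots> = (LBINT x. cross3 (wave c (k (Suc n)) d t x *\<^sub>R A x) d)"
      by (rule integral_cong_AE[OF _ _ g[OF A(2)]]) simp_all
    also have "\<dots> = cross3 (LBINT x. wave c (k (Suc n)) d t x *\<^sub>R A x) d"
    proof (rule integral_bounded_linear)
      show "bounded_linear (\<lambda>y. cross3 y d)"
        using bilinear_cross by (simp add: bilinear_def linear_conv_bounded_linear)
      show "integrable lborel (\<lambda>x. wave c (k (Suc n)) d t x *\<^sub>R A x)"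
        using A by (intro integrable_scaleR_L2v Lw) (simp add: weak_curl_def)
    qed
    finally show ?thesis .
  qed
  have out: "ip A (\<lambda>x. wave c (k n) d t x *\<^sub>R p) = (LBINT x. wave c (k n) d t x *\<^sub>R A x) \<bullet> p"
    if "L2v A" for A n
  proof -
    have "(LBINT x. wave c (k n) d t x *\<^sub>R A x) \<bullet> p = (LBINT x. (wave c (k n) d t x *\<^sub>R A x) \<bullet> p)"
      by (rule integral_inner_left[symmetric]) (use integrable_scaleR_L2v[OF Lw that] in simp)
    then show ?thesis by (simp add: ip_def)
  qed
  define Z where "Z = (LBINT x. wave c (k 2) d t x *\<^sub>R E x)"
  have "(LBINT x. wave c (k 0) d t x *\<^sub>R C x) = cross3 (cross3 Z d) d"
    using step[OF E(2) B0, of 0] step[OF E(1) E0, of 1] by (simp add: Z_def numeral_2_eq_2)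
  \<comment> \<open>The double cross product with a unit vector is minus the projection orthogonal
    to d, and pairing with p removes the part along d.\<close>
  also have "\<dots> = (Z \<bullet> d) *\<^sub>R d - (d \<bullet> d) *\<^sub>R Z"
    unfolding vec_eq_iff forall_3 by (simp add: cross3_def inner_vec_def sum_3 algebra_simps)
  also have "\<dots> = (Z \<bullet> d) *\<^sub>R d - Z" using d by (simp add: norm_eq_1)
  finally have "(LBINT x. wave c (k 0) d t x *\<^sub>R C x) \<bullet> p = - (Z \<bullet> p)"
    using p by (simp add: inner_diff_left inner_commute[of d p])
  then show ?thesis by (simp add: out L Z_def)
qed

text \<open>The profile \<open>k\<close> vanishes beyond \<open>T - R\<close>, so that at time \<open>T\<close> the wave has left the ball of radius \<open>R\<close>
  and no information on the solution at time \<open>T\<close> is needed there.\<close>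

lemma source_orthogonal_to_waves:
  assumes T: "T > 0" and R: "R > 0" and mw: "maxwell_weak T F E E' E'' B C"
    and F: "\<And>t. L2v (F t)" "\<And>t x. norm x > R \<Longrightarrow> F t x = 0"
    and tang: "\<And>t x. 0 < t \<Longrightarrow> t < T \<Longrightarrow> norm x = R \<Longrightarrow> cross3 (E t x) x = 0"
    and k: "smooth_seq k" "\<And>s. s \<ge> T - R \<Longrightarrow> k 0 s = 0" "\<And>s. s \<ge> T - R \<Longrightarrow> k 1 s = 0"
    and d: "norm d = 1" and p: "p \<bullet> d = 0" and c: "test_function c" "\<And>x. norm x < r \<Longrightarrow> c x = 1" "R < r"
  shows "((\<lambda>t. ip (F t) (\<lambda>x. wave c (k 0) d t x *\<^sub>R p)) has_integral 0) {0..T}"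
proof -
  have cont: "continuous_on UNIV (E t)" and d1: "L2_deriv {0..T} E (E' t) t" and d2: "L2_deriv {0..T} E' (E'' t) t"
    and c2: "L2_lim E'' (E'' t) (at t within {0..T})" if "0 \<le> t" "t \<le> T" for t
    using mw that by (auto simp: maxwell_weak_def)
  have wc: "weak_curl (E t) (B t)" "weak_curl (B t) (C t)" and eq: "AE x in lborel. E'' t x + C t x = F t x"
    if "0 < t" "t \<le> T" for t
    using mw that by (auto simp: maxwell_weak_def)
  have ini: "E 0 x = 0" "AE x in lborel. E' 0 x = 0" for x using mw by (auto simp: maxwell_weak_def)
  let ?O = "\<lambda>f x. indicator (exterior R) x *\<^sub>R (f x :: real^3)"
  have L: "L2v (E t)" "L2v (E' t)" "L2v (E'' t)" if "0 \<le> t" "t \<le> T" for t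
    using L2_deriv_L2v d1[OF that] d2[OF that] by (blast+)
  have LB: "L2v (B t)" "L2v (C t)" if "0 < t" "t \<le> T" for t using wc[OF that] by (auto simp: weak_curl_def)
  have OO: "ip (?O f) (?O g) = ip (?O f) g" for f g :: "real^3 \<Rightarrow> real^3"
    unfolding ip_def by (rule Bochner_Integration.integral_cong) (auto simp: indicator_def)
  have LO: "L2v (?O f)" if "L2v f" for f using that by (rule L2v_indicator) simp
  \<comment> \<open>Green's formula is used at two different times: exchanging s and t gives the
    symmetry for the energy argument, and setting them equal gives the sign.\<close>
  have key: "ip (?O (E'' s)) (?O (E t)) = - ip (?O (B t)) (B s)" if s: "0 < s" "s < T" and t: "0 < t" "t < T" for s t
  proof -
    have "ip (?O (E'' s)) (?O (E t)) = ip (?O (E t)) (?O (E'' s))" by (rule ip_commute)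
    also have "\<dots> = ip (?O (E t)) (?O (\<lambda>x. - C s x))"
    proof (rule ip_cong_AE)
      show "AE x in lborel. ?O (E'' s) x = ?O (\<lambda>x. - C s x) x"
        using eq[OF s(1) less_imp_le[OF s(2)]]
      proof eventually_elim
        case (elim x)
        then show ?case using F(2)[of x s] by (cases "norm x > R") (auto simp: exterior_def eq_neg_iff_add_eq_0)
      qed
    qed (use L[of t] L[of s] LB[of s] s t in \<open>auto intro!: LO L2v_minus\<close>)
    also have "\<dots> = - ip (?O (E t)) (C s)" unfolding OO by (simp add: ip_def)
    also have "ip (?O (E t)) (C s) = ip (?O (B t)) (B s)"
      by (rule exterior_Green[OF wc(1) wc(2) cont R tang]) (use s t in auto)
    finally show ?thesis .
  qed
  have BB: "ip (?O (B t)) (B s) = ip (?O (B s)) (B t)" for s t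
    unfolding ip_def by (rule Bochner_Integration.integral_cong) (auto simp: inner_commute)
  have nz: "nrm (?O (E t)) = 0" "nrm (?O (E' t)) = 0" if t: "0 \<le> t" "t \<le> T" for t
  proof -
    have zero: "nrm (?O f) = 0" if "AE x in lborel. f x = 0" "L2v f" for f
    proof -
      have "ip (?O f) (?O f) = ip (\<lambda>x::real^3. 0::real^3) (\<lambda>x. 0)"
        by (rule ip_cong_AE) (use that LO[OF that(2)] in \<open>auto elim!: eventually_mono\<close>)
      then show ?thesis by (simp add: nrm_def ip_def)
    qed
    have neg: "ip (?O (E'' s)) (?O (E s)) \<le> 0" if "0 < s" "s < T" for s
      using key[OF that that] OO[of "B s" "B s"] ip_self_nonneg[of "?O (B s)"] by simp
    note ev = energy_vanishes[of T "\<lambda>t. ?O (E t)" "\<lambda>t. ?O (E' t)" "\<lambda>t. ?O (E'' t)", OF T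
      L2_deriv_indicator[OF d1 exterior_borel] L2_deriv_indicator[OF d2 exterior_borel] L2_lim_indicator[OF c2 exterior_borel] _ neg zero zero _ _]
    show "nrm (?O (E t)) = 0"
      by (rule ev(1)) (use t key BB ini L[of 0] T in auto)
    show "nrm (?O (E' t)) = 0"
      by (rule ev(2)) (use t key BB ini L[of 0] T in auto)
  qed
  have AEO: "AE x in lborel. norm x > R \<longrightarrow> f x = 0" if "nrm (?O f) = 0" "L2v f" for f
    using nrm_zero_AE[OF LO[OF that(2)] that(1)] by (auto elim!: eventually_mono simp: exterior_def)
  have E0: "AE x in lborel. norm x > R \<longrightarrow> E t x = 0" "AE x in lborel. norm x > R \<longrightarrow> E' t x = 0"
    if "0 \<le> t" "t \<le> T" for t
    using AEO[OF nz(1)[OF that] L(1)[OF that]] AEO[OF nz(2)[OF that] L(2)[OF that]] by auto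
  \<comment> \<open>With both times equal, \<open>key\<close> expresses the squared norm of the
    exterior curl through the field itself, which is already known to vanish there.\<close>
  have B0: "AE x in lborel. norm x > R \<longrightarrow> B t x = 0" if t: "0 < t" "t < T" for t
  proof -
    have "ip (?O (B t)) (?O (B t)) = - ip (?O (E'' t)) (?O (E t))" using key[OF t t] OO by simp
    also have "\<dots> = 0" using ip_CS[OF LO[OF L(3)] LO[OF L(1)], of t t] nz(1)[of t] t by simp
    finally show ?thesis using AEO[OF _ LB(1)] t by (simp add: nrm_def)
  qed
  define P where "P n t x = wave c (k n) d t x *\<^sub>R p" for n t x
  have dP: "L2_deriv {0..T} (P n) (P (Suc n) t) t" if "0 \<le> t" "t \<le> T" for t n
    using L2_deriv_wave[OF c(1) k(1), of t T n d p] that by (simp add: P_def[abs_def])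
  have LP: "L2v (P n t)" if "0 \<le> t" "t \<le> T" for t n
    using L2_deriv_L2v dP[OF that, of n] by blast
  \<comment> \<open>A Wronskian of the field and the wave: the two products of first derivatives
    cancel when it is differentiated.\<close>
  define N where "N t = ip (E' t) (P 0 t) - ip (E t) (P 1 t)" for t
  have dN: "(N has_vector_derivative (ip (E'' t) (P 0 t) - ip (E t) (P 2 t))) (at t within {0..T})"
    if t: "t \<in> {0..T}" for t
  proof -
    have t': "0 \<le> t" "t \<le> T" using t by auto
    have "((\<lambda>t. ip (E' t) (P 0 t)) has_real_derivative ip (E'' t) (P 0 t) + ip (E' t) (P 1 t)) (at t within {0..T})"
      using ip_has_derivative[OF d2[OF t'] dP[OF t', of 0]] by simp
    moreover have "((\<lambda>t. ip (E t) (P 1 t)) has_real_derivative ip (E' t) (P 1 t) + ip (E t) (P 2 t)) (at t within {0..T})"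
      using ip_has_derivative[OF d1[OF t'] dP[OF t', of 1]] by (simp add: numeral_2_eq_2)
    ultimately have "(N has_real_derivative (ip (E'' t) (P 0 t) + ip (E' t) (P 1 t))
        - (ip (E' t) (P 1 t) + ip (E t) (P 2 t))) (at t within {0..T})"
      unfolding N_def[abs_def] by (rule DERIV_diff)
    then show ?thesis by (simp add: has_real_derivative_iff_has_vector_derivative)
  qed
  have ip0: "ip f g = 0" if "AE x in lborel. f x = 0 \<or> g x = 0" "L2v f" "L2v g" for f g :: "real^3 \<Rightarrow> real^3"
  proof -
    have "ip f g = (LINT x|(lborel::(real^3) measure). 0)"
      unfolding ip_def by (rule integral_cong_AE) (use that in \<open>auto simp: L2v_def elim!: eventually_mono\<close>)
    then show ?thesis by simp
  qed
  have N0: "N 0 = 0"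
  proof -
    have "ip (E' 0) (P 0 0) = 0" by (rule ip0) (use ini(2) L[of 0] LP[of 0] T in auto)
    moreover have "ip (E 0) (P 1 0) = 0" by (simp add: ip_def ini(1))
    ultimately show ?thesis by (simp add: N_def)
  qed
  have NT: "N T = 0"
  proof -
    \<comment> \<open>In the ball the phase at time T is at least \<open>T - R\<close>, so the wave
      and its time derivative are zero; outside, the field and its time derivative are.\<close>
    have w: "P 0 T x = 0" "P 1 T x = 0" if "\<not> norm x > R" for x
    proof -
      have "- (x \<bullet> d) \<le> R" using Cauchy_Schwarz_ineq2[of x d] d that by (simp add: abs_le_iff)
      then have "T + x \<bullet> d \<ge> T - R" by simp
      then show "P 0 T x = 0" "P 1 T x = 0" using k(2,3) by (simp_all add: P_def wave_def)
    qed
    have "ip (E' T) (P 0 T) = 0" by (rule ip0) (use E0(2)[of T] T w L[of T] LP[of T] in \<open>auto elim!: eventually_mono\<close>)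
    moreover have "ip (E T) (P 1 T) = 0" by (rule ip0) (use E0(1)[of T] T w L[of T] LP[of T] in \<open>auto elim!: eventually_mono\<close>)
    ultimately show ?thesis by (simp add: N_def)
  qed
  have "((\<lambda>t. ip (E'' t) (P 0 t) - ip (E t) (P 2 t)) has_integral (N T - N 0)) {0..T}"
    by (rule fundamental_theorem_of_calculus) (use T dN in auto)
  \<comment> \<open>The endpoints are dropped because the weak equation is given for positive times
    and the vanishing of the exterior curl only before T.\<close>
  then show ?thesis unfolding N0 NT diff_0_right
  proof (rule has_integral_spike_finite[rotated 2])
    show "finite {0, T}" by simp
    fix t assume "t \<in> {0..T} - {0, T}"
    then have t: "0 < t" "t < T" by auto
    have "ip (F t) (P 0 t) = ip (\<lambda>x. E'' t x + C t x) (P 0 t)"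
      by (rule ip_cong_AE) (use eq[of t] F L[of t] LB[of t] LP[of t] t in \<open>auto intro: L2v_add elim!: eventually_mono\<close>)
    also have "\<dots> = ip (E'' t) (P 0 t) + ip (C t) (P 0 t)"
      by (rule ip_add_left) (use L[of t] LB[of t] LP[of t] t in auto)
    also have "ip (C t) (P 0 t) = - ip (E t) (P 2 t)"
      unfolding P_def by (rule ip_curl_curl_wave[OF wc c(1) k(1) c(3,2) E0(1) B0[OF t] d p]) (use t in auto)
    finally show "ip (F t) (\<lambda>x. wave c (k 0) d t x *\<^sub>R p) = ip (E'' t) (P 0 t) - ip (E t) (P 2 t)"
      by (simp add: P_def[abs_def])
  qed
qed

subsection \<open>Cutoffs and profiles\<close>

lemma smooth_seq_exp: "smooth_seq (\<lambda>n s. l ^ n * exp (l * s))"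
  unfolding smooth_seq_def by (auto intro!: derivative_eq_intros)

lemma cutoff_exists:
  assumes "r > 0" obtains c :: "'a::euclidean_space \<Rightarrow> real" where "test_function c" "\<And>x. norm x < r \<Longrightarrow> c x = 1"
proof -
  obtain D where D: "smooth_seq D" "\<And>n x. x \<le> 0 \<Longrightarrow> D n x = 0" "\<And>x. x \<ge> 1 \<Longrightarrow> D 0 x = 1"
    by (rule smooth_step) blast
  \<comment> \<open>The argument is affine in the squared norm, with the value 1 at radius r and 0
    at radius \<open>2 * r\<close>.\<close>
  define c where "c x = D 0 (4 / 3 + - (1 / (3 * r\<^sup>2)) * (x \<bullet> x))" for x :: 'a
  show thesis
  proof (rule that[of c])
    have "Ck k c" for k
      unfolding c_def[abs_def] by (rule Ck_compose[OF D(1)]) (intro Ck_add Ck_mult Ck_const Ck_norm_sq)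
    moreover have "c x = 0" if "norm x > 2 * r" for x
    proof -
      have "(2 * r)\<^sup>2 \<le> x \<bullet> x" using power_mono[of "2 * r" "norm x" 2] that assms by (simp add: power2_norm_eq_inner)
      then show ?thesis unfolding c_def using assms by (intro D(2)) (simp add: field_simps power_mult_distrib)
    qed
    ultimately show "test_function c" by (rule test_functionI)
    fix x :: 'a assume "norm x < r"
    then have "x \<bullet> x \<le> r\<^sup>2" using power_mono[of "norm x" r 2] by (simp add: power2_norm_eq_inner)
    then show "c x = 1" unfolding c_def using assms by (intro D(3)) (simp add: field_simps)
  qed
qed

lemma profile_exists:
  assumes "c' < c"
  obtains k where "smooth_seq k" "\<And>s. s \<le> c' \<Longrightarrow> k 0 s = exp (l * s)"
    "\<And>s. s \<ge> c \<Longrightarrow> k 0 s = 0" "\<And>s. s \<ge> c \<Longrightarrow> k 1 s = 0"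
proof -
  obtain D where D: "smooth_seq D" "\<And>n x. x \<le> 0 \<Longrightarrow> D n x = 0" "\<And>x. x \<ge> 1 \<Longrightarrow> D 0 x = 1"
    by (rule smooth_step) blast
  \<comment> \<open>The argument of the step is then 1 at \<open>c'\<close> and 0 at the midpoint of
    \<open>c'\<close> and c. Vanishing already from the midpoint on makes the first derivative zero
    at c as well.\<close>
  define m where "m = 2 / (c - c')"
  have m: "m > 0" using assms by (simp add: m_def)
  obtain A where A: "smooth_seq A" "A 0 = (\<lambda>x. D 0 (- m * x + m * (c + c') / 2))"
    by (rule smooth_affine[OF D(1), where c = "- m" and d = "m * (c + c') / 2"]) blast
  obtain k where k: "smooth_seq k" "k 0 = (\<lambda>x. l ^ 0 * exp (l * x) * A 0 x)"
    by (rule smooth_seq_mult[OF smooth_seq_exp[of l] A(1)]) blast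
  have k0: "k 0 s = 0" if "s \<ge> (c + c') / 2" for s
  proof -
    have "m * ((c + c') / 2) \<le> m * s" using that m by (intro mult_left_mono) auto
    then show ?thesis using D(2) by (simp add: k(2) A(2))
  qed
  have k1: "k 1 s = 0" if "s \<ge> c" for s
  proof -
    have "(k 0 has_real_derivative 0) (at s)"
      by (rule DERIV_locally_zero[of "{(c + c') / 2 <..}"]) (use assms that k0 in auto)
    then show ?thesis using DERIV_unique smooth_seqD[OF k(1), of 0 s] by fastforce
  qed
  have ke: "k 0 s = exp (l * s)" if "s \<le> c'" for s
  proof -
    have "m * s \<le> m * c'" using that m by (intro mult_left_mono) auto
    moreover have "m * (c + c') / 2 - m * c' = m * (c - c') / 2" by (simp add: field_simps)
    moreover have "m * (c - c') = 2"
      unfolding m_def using assms by (intro nonzero_eq_divide_eq[THEN iffD1]) auto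
    ultimately have "- m * s + m * (c + c') / 2 \<ge> 1" by linarith
    then show ?thesis using D(3) by (simp add: k(2) A(2))
  qed
  show thesis using that[OF k(1) ke k0 k1] assms by simp
qed

subsection \<open>Uniqueness for two-sided Laplace transforms\<close>

text \<open>If f is orthogonal to q and uniformly close to it where f is nonzero, the integral of
  its square equals that of \<open>f * (f - q)\<close>, which is small. Both uniqueness results for
  transforms end with this estimate.\<close>

lemma square_integral_zero:
  fixes f :: "'a \<Rightarrow> real"
  assumes ff: "integrable M (\<lambda>x. f x * f x)" and af: "integrable M f"
    and approx: "\<And>e. e > 0 \<Longrightarrow> \<exists>q. integrable M (\<lambda>x. f x * q x) \<and> (\<forall>x. f x \<noteq> 0 \<longrightarrow> \<bar>f x - q x\<bar> < e) \<and>
      (LINT x|M. f x * q x) = 0"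
  shows "(LINT x|M. f x * f x) = 0"
proof -
  define I where "I = (LINT x|M. \<bar>f x\<bar>)"
  have I: "I \<ge> 0" by (simp add: I_def)
  have "(LINT x|M. f x * f x) \<le> 0"
  proof (rule field_le_epsilon)
    fix e :: real assume e: "e > 0"
    define d where "d = e / (I + 1)"
    have "d > 0" using e I by (simp add: d_def)
    then obtain q where q: "integrable M (\<lambda>x. f x * q x)" "\<And>x. f x \<noteq> 0 \<Longrightarrow> \<bar>f x - q x\<bar> < d"
      "(LINT x|M. f x * q x) = 0" using approx by blast
    have "(LINT x|M. f x * f x) = (LINT x|M. f x * f x - f x * q x)" using ff q by simp
    also have "\<dots> \<le> (LINT x|M. d * \<bar>f x\<bar>)"
    proof (intro integral_mono Bochner_Integration.integrable_diff ff q(1) integrable_mult_right integrable_abs af)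
      fix x
      have "f x * f x - f x * q x = f x * (f x - q x)" by (simp add: algebra_simps)
      also have "\<dots> \<le> \<bar>f x\<bar> * \<bar>f x - q x\<bar>" by (simp add: abs_mult[symmetric])
      also have "\<dots> \<le> \<bar>f x\<bar> * d" using q(2)[of x] by (cases "f x = 0") (auto intro: mult_left_mono)
      finally show "f x * f x - f x * q x \<le> d * \<bar>f x\<bar>" by (simp add: mult.commute)
    qed
    also have "\<dots> = d * I" by (simp add: I_def)
    also have "\<dots> \<le> e" using e I by (simp add: d_def field_simps)
    finally show "(LINT x|M. f x * f x) \<le> 0 + e" by simp
  qed
  then show ?thesis by (intro antisym Bochner_Integration.integral_nonneg) simp_all
qed

text \<open>Differentiating under the integral sign turns the hypothesis into the vanishing of all moments of
  \<open>w t * exp (l * t)\<close>.\<close>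

lemma Laplace_unique_interval:
  fixes w :: "real \<Rightarrow> real"
  assumes ab: "a < b" and w: "continuous_on {a..b} w" and lu: "l < u"
    and z: "\<And>s. l < s \<Longrightarrow> s < u \<Longrightarrow> integral {a..b} (\<lambda>t. w t * exp (s * t)) = 0"
    and t: "t \<in> {a..b}"
  shows "w t = 0"
proof -
  define I where "I n s = integral {a..b} (\<lambda>t. w t * t ^ n * exp (s * t))" for n s
  have dI: "(I n has_real_derivative I (Suc n) s) (at s)" for n s
  proof -
    have "((\<lambda>s. integral (cbox a b) (\<lambda>t. w t * t ^ n * exp (s * t))) has_real_derivative
        integral (cbox a b) (\<lambda>t. w t * t ^ n * (t * exp (s * t)))) (at s within UNIV)"
    proof (rule leibniz_rule_field_derivative)
      show "((\<lambda>s. w t * t ^ n * exp (s * t)) has_real_derivative w t * t ^ n * (t * exp (s * t))) (at s within UNIV)" for s t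
        by (auto intro!: derivative_eq_intros)
      show "(\<lambda>t. w t * t ^ n * exp (s * t)) integrable_on cbox a b" for s
        using w by (intro integrable_continuous continuous_intros) auto
      have "continuous_on (UNIV \<times> cbox a b) (\<lambda>p. w (snd p) * snd p ^ n * (snd p * exp (fst p * snd p)))"
        using w by (auto intro!: continuous_intros continuous_on_compose2[OF w])
      then show "continuous_on (UNIV \<times> cbox a b) (\<lambda>(s, t). w t * t ^ n * (t * exp (s * t)))"
        by (simp add: case_prod_beta)
    qed auto
    then show ?thesis by (simp add: I_def[abs_def] mult_ac)
  qed
  \<comment> \<open>The induction uses that the hypothesis holds on an open interval:
    \<open>I (Suc n)\<close> is the derivative of a function that vanishes near s.\<close>
  have I0: "I n s = 0" if "l < s" "s < u" for n s
    using that
  proof (induction n arbitrary: s)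
    case 0
    then show ?case using z by (simp add: I_def)
  next
    case (Suc n)
    have "(I n has_real_derivative 0) (at s)"
      by (rule DERIV_locally_zero[of "{l<..<u}"]) (use Suc in auto)
    then show ?case using DERIV_unique dI by blast
  qed
  define s where "s = (l + u) / 2"
  have s: "l < s" "s < u" using lu by (auto simp: s_def)
  define f where "f t = w t * exp (s * t)" for t
  have f: "continuous_on {a..b} f" unfolding f_def by (intro continuous_intros w)
  \<comment> \<open>Extension by zero turns the integrals over the interval into integrals over the
    line, as in \<open>square_integral_zero\<close>.\<close>
  define F where "F t = indicator {a..b} t * f t" for t
  have int: "integrable lborel (\<lambda>t. F t * q t)" "(LBINT t. F t * q t) = integral {a..b} (\<lambda>t. f t * q t)"
    if "continuous_on {a..b} q" for q
  proof -
    have "set_integrable lborel {a..b} (\<lambda>t. f t * q t)"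
      by (intro borel_integrable_atLeastAtMost' continuous_intros f that)
    then show "integrable lborel (\<lambda>t. F t * q t)" "(LBINT t. F t * q t) = integral {a..b} (\<lambda>t. f t * q t)"
      using set_borel_integral_eq_integral(2)[of "{a..b}" "\<lambda>t. f t * q t"]
      by (simp_all add: F_def set_integrable_def set_lebesgue_integral_def mult.assoc)
  qed
  have FF: "F t * F t = F t * f t" for t by (simp add: F_def indicator_def)
  have "(LBINT t. F t * F t) = 0"
  proof (rule square_integral_zero)
    show "integrable lborel (\<lambda>t. F t * F t)" unfolding FF by (rule int(1)[OF f])
    show "integrable lborel F" using int(1)[of "\<lambda>_. 1"] by simp
    fix e :: real assume "e > 0"
    then obtain q where q: "real_polynomial_function q" "\<And>t. t \<in> {a..b} \<Longrightarrow> \<bar>f t - q t\<bar> < e"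
      using Stone_Weierstrass_real_polynomial_function[of "{a..b}" f e] f by auto
    obtain c n where c: "q = (\<lambda>x. \<Sum>i\<le>n. c i * x ^ i)" using q(1) by (auto simp: real_polynomial_function_iff_sum)
    have qc: "continuous_on {a..b} q" unfolding c by (intro continuous_intros)
    have "integral {a..b} (\<lambda>t. f t * q t) = integral {a..b} (\<lambda>t. \<Sum>i\<le>n. c i * (w t * t ^ i * exp (s * t)))"
      by (simp add: c f_def sum_distrib_left mult_ac)
    also have "\<dots> = (\<Sum>i\<le>n. integral {a..b} (\<lambda>t. c i * (w t * t ^ i * exp (s * t))))"
      by (intro integral_sum integrable_continuous_real continuous_intros w) simp
    also have "\<dots> = 0" using I0[OF s] by (simp add: I_def)
    finally have "(LBINT t. F t * q t) = 0" using int(2)[OF qc] by simp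
    then show "\<exists>q. integrable lborel (\<lambda>t. F t * q t) \<and> (\<forall>t. F t \<noteq> 0 \<longrightarrow> \<bar>F t - q t\<bar> < e) \<and> (LBINT t. F t * q t) = 0"
      using q(2) int(1)[OF qc] by (intro exI[of _ q]) (auto simp: F_def indicator_def)
  qed
  then have "integral {a..b} (\<lambda>t. f t * f t) = 0" using int(2)[OF f] by (simp add: FF)
  moreover have "(\<lambda>t. f t * f t) integrable_on {a..b}" by (intro integrable_continuous_real continuous_intros f)
  ultimately have "((\<lambda>t. f t * f t) has_integral 0) (cbox a b)" using integrable_integral by fastforce
  then have "f t * f t = 0"
    by (rule has_integral_0_cbox_imp_0[rotated 2]) (use f ab t in \<open>auto intro!: continuous_intros simp: box_real\<close>)
  then show ?thesis by (simp add: f_def)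
qed

text \<open>Finite sums of exponentials. They form an algebra because the product of two
  exponentials adds their exponents.\<close>

inductive_set exp_span :: "('a::euclidean_space \<Rightarrow> real) set" where
  exp: "(\<lambda>x. c * exp (v \<bullet> x)) \<in> exp_span"
| add: "f \<in> exp_span \<Longrightarrow> g \<in> exp_span \<Longrightarrow> (\<lambda>x. f x + g x) \<in> exp_span"

lemma exp_span_mult: assumes "f \<in> exp_span" "g \<in> exp_span" shows "(\<lambda>x. f x * g x) \<in> exp_span"
  using assms(1)
proof induction
  case (exp c v)
  show ?case using assms(2)
  proof induction
    case (exp c' v')
    show ?case using exp_span.exp[of "c * c'" "v + v'"] by (simp add: inner_add_left exp_add mult_ac)
  qed (simp add: distrib_left exp_span.add)
qed (simp add: distrib_right exp_span.add)

text \<open>By Stone-Weierstrass, exponential sums approximate f uniformly on a ball containing its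
  support, and f is orthogonal to all of them.\<close>

lemma Laplace_unique:
  fixes f :: "'a::euclidean_space \<Rightarrow> real"
  assumes f: "continuous_on UNIV f" "\<And>x. norm x > r \<Longrightarrow> f x = 0"
    and z: "\<And>v. (LBINT x. f x * exp (v \<bullet> x)) = 0"
  shows "f x = 0"
proof -
  interpret function_ring_on exp_span "cball (0::'a) r"
  proof
    fix g :: "'a \<Rightarrow> real" assume "g \<in> exp_span"
    then show "continuous_on (cball 0 r) g" by induction (auto intro!: continuous_intros)
  next
    fix c :: real show "(\<lambda>_::'a. c) \<in> exp_span" using exp_span.exp[of c 0] by simp
  next
    fix x y :: 'a assume "x \<noteq> y"
    then have "(x - y) \<bullet> (x - y) \<noteq> 0" by simp
    \<comment> \<open>The difference of the two points is itself an exponent that separates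
      them.\<close>
    then have "(x - y) \<bullet> x \<noteq> (x - y) \<bullet> y" unfolding inner_diff_right[of "x - y" x y] by linarith
    then show "\<exists>f\<in>exp_span. f x \<noteq> f y" by (intro bexI[OF _ exp_span.exp[of 1 "x - y"]]) simp
  qed (auto intro: exp_span_mult exp_span.add)
  have fi: "integrable lborel (\<lambda>x. f x * g x)" if "continuous_on UNIV g" for g
    by (rule continuous_bounded_support_integrable[of _ r]) (use f that in \<open>auto intro!: continuous_intros\<close>)
  have gc: "continuous_on UNIV g" if "g \<in> exp_span" for g :: "'a \<Rightarrow> real"
    using that by induction (auto intro!: continuous_intros)
  have gz: "(LBINT x. f x * g x) = 0" if "g \<in> exp_span" for g
    using that
  proof induction
    case (exp c v)
    have "(LBINT x. f x * (c * exp (v \<bullet> x))) = (LBINT x. c * (f x * exp (v \<bullet> x)))"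
      by (simp add: mult_ac)
    then show ?case using z by simp
  next
    case (add g h)
    then show ?case using fi[OF gc[OF add.hyps(1)]] fi[OF gc[OF add.hyps(2)]] by (simp add: distrib_left)
  qed
  have "(LBINT x. f x * f x) = 0"
  proof (rule square_integral_zero)
    show "integrable lborel (\<lambda>x. f x * f x)" by (rule fi[OF f(1)])
    show "integrable lborel f" using fi[of "\<lambda>_. 1"] by simp
    fix e :: real assume "e > 0"
    then obtain g where g: "g \<in> exp_span" "\<And>x. x \<in> cball 0 r \<Longrightarrow> \<bar>f x - g x\<bar> < e"
      using Stone_Weierstrass_basic[of f e] f(1) continuous_on_subset by blast
    moreover have "x \<in> cball 0 r" if "f x \<noteq> 0" for x using f(2)[of x] that by force
    ultimately show "\<exists>q. integrable lborel (\<lambda>x. f x * q x) \<and> (\<forall>x. f x \<noteq> 0 \<longrightarrow> \<bar>f x - q x\<bar> < e) \<and>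
        (LBINT x. f x * q x) = 0"
      using fi[OF gc[OF g(1)]] gz[OF g(1)] by blast
  qed
  then have "AE x in lborel. f x * f x = 0"
    using integral_nonneg_eq_0_iff_AE[OF fi[OF f(1)]] by simp
  then have "f x * f x = 0" by (intro continuous_AE_zero[of "\<lambda>x. f x * f x"]) (auto intro!: continuous_intros f(1))
  then show ?thesis by simp
qed

text \<open>It keeps the transform of h nonzero near one nonzero value, and later extends zeros of
  the transform of J from generic directions to all.\<close>

lemma Laplace_transform_continuous:
  fixes f :: "'a::euclidean_space \<Rightarrow> real"
  assumes f: "continuous_on UNIV f" "\<And>x. norm x > r \<Longrightarrow> f x = 0" and v: "v \<longlonglongrightarrow> w"
  shows "(\<lambda>n. LBINT x. f x * exp (v n \<bullet> x)) \<longlonglongrightarrow> (LBINT x. f x * exp (w \<bullet> x))"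
proof -
  obtain K where K: "\<And>n. norm (v n) \<le> K" using convergent_imp_Bseq[of v] v unfolding Bseq_def convergent_def by metis
  have m[measurable]: "f \<in> borel_measurable borel" using f(1) by (rule borel_measurable_continuous_onI)
  have fi: "integrable lborel f" by (rule continuous_bounded_support_integrable[OF f])
  show ?thesis
  proof (rule integral_dominated_convergence[where w="\<lambda>x. exp (K * r) * \<bar>f x\<bar>"])
    show "AE x in lborel. (\<lambda>n. f x * exp (v n \<bullet> x)) \<longlonglongrightarrow> f x * exp (w \<bullet> x)"
      by (intro AE_I2 tendsto_intros v)
    show "AE x in lborel. norm (f x * exp (v n \<bullet> x)) \<le> exp (K * r) * \<bar>f x\<bar>" for n
    proof (rule AE_I2)
      fix x
      show "norm (f x * exp (v n \<bullet> x)) \<le> exp (K * r) * \<bar>f x\<bar>"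
      proof (cases "norm x > r")
        case False
        have "v n \<bullet> x \<le> norm (v n) * norm x" by (rule norm_cauchy_schwarz)
        also have "\<dots> \<le> K * r" using False K[of n] norm_ge_zero[of "v n"] by (intro mult_mono) (auto intro: order_trans[OF norm_ge_zero])
        finally show ?thesis
          using mult_left_mono[of "exp (v n \<bullet> x)" "exp (K * r)" "\<bar>f x\<bar>"] by (simp add: abs_mult mult.commute)
      qed (simp add: f(2))
    qed
  qed (use fi in auto)
qed

subsection \<open>Splitting off the third coordinate\<close>

definition join :: "(real^2) \<times> real \<Rightarrow> real^3" where
  "join z = vector [fst z $ 1, fst z $ 2, snd z]"

lemma join_measurable [measurable]: "join \<in> borel_measurable borel"
proof (rule borel_measurable_continuous_onI)
  have "continuous_on UNIV (\<lambda>z::(real^2) \<times> real. (\<chi> i. if i = 1 then fst z $ 1 else if i = 2 then fst z $ 2 else snd z) :: real^3)"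
  proof (intro continuous_on_vec_lambda)
    fix i :: 3
    show "continuous_on UNIV (\<lambda>z::(real^2) \<times> real. if i = 1 then fst z $ 1 else if i = 2 then fst z $ 2 else snd z)"
      by (cases "i = 1"; cases "i = 2") (auto intro!: continuous_intros)
  qed
  also have "(\<lambda>z::(real^2) \<times> real. (\<chi> i. if i = 1 then fst z $ 1 else if i = 2 then fst z $ 2 else snd z) :: real^3) = join"
    by (auto simp: join_def fun_eq_iff vec_eq_iff forall_3)
  finally show "continuous_on UNIV join" .
qed

text \<open>Preimages of boxes are products of boxes, and Lebesgue measure is determined by its
  values on boxes.\<close>

lemma lborel_join: "distr (lborel \<Otimes>\<^sub>M lborel) borel join = lborel"
proof (rule lborel_eqI[symmetric])
  fix l u :: "real^3" assume lu: "\<And>b. b \<in> Basis \<Longrightarrow> l \<bullet> b \<le> u \<bullet> b"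
  have lu': "l $ i \<le> u $ i" for i using lu[of "axis i 1"] by (simp add: axis_in_Basis_iff inner_axis)
  have pre: "join -` box l u = box (vector [l $ 1, l $ 2]) (vector [u $ 1, u $ 2]) \<times> box (l $ 3) (u $ 3)"
    by (auto simp: join_def mem_box_cart forall_3 forall_2)
  have b3: "(\<Prod>b\<in>Basis. (u - l) \<bullet> b) = (u $ 1 - l $ 1) * (u $ 2 - l $ 2) * (u $ 3 - l $ 3)"
  proof -
    have B: "(Basis :: (real^3) set) = {axis 1 1, axis 2 1, axis 3 1}"
      unfolding Basis_vec_def by (auto simp: UNIV_3)
    show ?thesis unfolding B by (simp add: axis_eq_axis inner_axis)
  qed
  have b2: "(\<Prod>b\<in>Basis. (vector [u $ 1, u $ 2] - vector [l $ 1, l $ 2] :: real^2) \<bullet> b) = (u $ 1 - l $ 1) * (u $ 2 - l $ 2)"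
  proof -
    have B: "(Basis :: (real^2) set) = {axis 1 1, axis 2 1}"
      unfolding Basis_vec_def by (auto simp: UNIV_2)
    show ?thesis unfolding B by (simp add: axis_eq_axis inner_axis)
  qed
  have "\<forall>i. (vector [l $ 1, l $ 2] :: real^2) $ i \<le> (vector [u $ 1, u $ 2] :: real^2) $ i"
    using lu' by (simp add: forall_2)
  then have c2: "\<And>b. b \<in> Basis \<Longrightarrow> (vector [l $ 1, l $ 2] :: real^2) \<bullet> b \<le> vector [u $ 1, u $ 2] \<bullet> b"
    by (auto simp: Basis_vec_def inner_axis)
  have "emeasure (distr (lborel \<Otimes>\<^sub>M lborel) borel join) (box l u)
      = emeasure (lborel \<Otimes>\<^sub>M lborel) (box (vector [l $ 1, l $ 2] :: real^2) (vector [u $ 1, u $ 2]) \<times> box (l $ 3) (u $ 3))"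
    by (subst emeasure_distr) (auto simp: pre lborel_prod)
  also have "\<dots> = emeasure lborel (box (vector [l $ 1, l $ 2] :: real^2) (vector [u $ 1, u $ 2])) * emeasure lborel (box (l $ 3) (u $ 3))"
    by (rule lborel.emeasure_pair_measure_Times) auto
  also have "\<dots> = ennreal ((u $ 1 - l $ 1) * (u $ 2 - l $ 2)) * ennreal (u $ 3 - l $ 3)"
    using lu' by (simp only: emeasure_lborel_box[OF c2] b2) (simp add: box_real)
  also have "\<dots> = ennreal (\<Prod>b\<in>Basis. (u - l) \<bullet> b)"
    unfolding b3 using lu' by (intro ennreal_mult[symmetric]) auto
  finally show "emeasure (distr (lborel \<Otimes>\<^sub>M lborel) borel join) (box l u) = (\<Prod>b\<in>Basis. (u - l) \<bullet> b)" .
qed simp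

lemma planar_continuous: "continuous_on S planar"
proof -
  have "continuous_on S (\<lambda>x::real^3. (\<chi> i. if i = 1 then x $ 1 else x $ 2) :: real^2)"
  proof (intro continuous_on_vec_lambda)
    fix i :: 2 show "continuous_on S (\<lambda>x::real^3. if i = 1 then x $ 1 else x $ 2)"
      by (cases "i = 1") (auto intro!: continuous_intros)
  qed
  also have "(\<lambda>x::real^3. (\<chi> i. if i = 1 then x $ 1 else x $ 2) :: real^2) = planar"
    by (auto simp: planar_def fun_eq_iff vec_eq_iff forall_2)
  finally show ?thesis .
qed

lemma planar_measurable [measurable]: "planar \<in> borel_measurable borel"
  by (rule borel_measurable_continuous_onI[OF planar_continuous])

lemma integral_planar:
  assumes p: "integrable lborel p" and q: "integrable lborel q"
  shows "(LBINT x. p (planar x) * q (x $ 3)) = (LBINT y. p y) * (LBINT s. q s :: real)"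
proof -
  have [measurable]: "p \<in> borel_measurable borel" "q \<in> borel_measurable borel" using p q by auto
  have "integrable (lborel \<Otimes>\<^sub>M lborel) (\<lambda>(y, s). p y * q s)"
  proof (rule lborel_pair.Fubini_integrable)
    show "integrable lborel (\<lambda>y. LBINT s. norm (case (y, s) of (y, s) \<Rightarrow> p y * q s))"
      using p by (simp add: abs_mult)
  qed (use q in simp_all)
  from lborel_pair.integral_fst[OF this]
  have *: "(LINT z|(lborel \<Otimes>\<^sub>M lborel). (case z of (y, s) \<Rightarrow> p y * q s)) = (LBINT y. p y) * (LBINT s. q s)"
    by simp
  have pl: "planar (join (y, s)) = y" "join (y, s) $ 3 = s" for y s
    by (simp_all add: planar_def join_def vec_eq_iff forall_2)
  have "(LBINT x. p (planar x) * q (x $ 3)) = (LINT x|distr (lborel \<Otimes>\<^sub>M lborel) borel join. p (planar x) * q (x $ 3))"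
    by (simp add: lborel_join)
  also have "\<dots> = (LINT z|(lborel \<Otimes>\<^sub>M lborel). (case z of (y, s) \<Rightarrow> p y * q s))"
    by (subst integral_distr) (auto simp: pl lborel_prod case_prod_beta split: prod.split intro!: Bochner_Integration.integral_cong)
  finally show ?thesis using * by simp
qed

subsection \<open>The moving source\<close>

lemma norm_planar: "norm x = sqrt ((norm (planar x))\<^sup>2 + (x $ 3)\<^sup>2)"
  by (simp add: norm_eq_sqrt_inner planar_def inner_vec_def sum_3 sum_2 power2_eq_square)

lemma moving_source_L2v:
  assumes J: "continuous_on UNIV J" "\<And>y. norm y \<ge> s \<Longrightarrow> J y = 0"
    and h: "continuous_on UNIV h" "\<And>z. \<bar>z\<bar> \<ge> s \<Longrightarrow> h z = 0"
  shows "L2v (moving_source J h g a t)"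
  unfolding L2v_componentwise
proof
  fix i
  let ?f = "\<lambda>x. moving_source J h g a t x $ i"
  have c: "continuous_on UNIV ?f"
    unfolding moving_source_def
    by (intro continuous_intros continuous_on_compose2[OF J(1)] continuous_on_compose2[OF h(1)]
        planar_continuous) auto
  have "?f x = 0" if "norm x > s + norm (a t) + s" for x
  proof -
    have "norm x \<le> norm (planar x) + \<bar>x $ 3\<bar>"
      unfolding norm_planar[of x] using sqrt_sum_squares_le_sum_abs[of "norm (planar x)" "x $ 3"] by simp
    then have "s \<le> \<bar>x $ 3\<bar> \<or> s + norm (a t) \<le> norm (planar x)" using that by linarith
    then have "s \<le> \<bar>x $ 3\<bar> \<or> s \<le> norm (planar x - a t)"
      using norm_triangle_ineq2[of "planar x" "a t"] by linarith
    then show ?thesis using J(2) h(2) by (auto simp: moving_source_def)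
  qed
  then have "integrable lborel (\<lambda>x. (?f x)\<^sup>2)"
    by (intro continuous_bounded_support_integrable[where r = "s + norm (a t) + s"] continuous_intros c) auto
  then show "L2 ?f" using borel_measurable_continuous_onI[OF c] by (simp add: L2_def)
qed

lemma moving_source_support:
  assumes "moving_source J h g a t x \<noteq> 0" "norm (a t) \<le> r"
    and "\<And>y. norm y \<ge> s \<Longrightarrow> J y = 0" "\<And>z. \<bar>z\<bar> > s' \<Longrightarrow> h z = 0"
  shows "norm x \<le> r + sqrt (s\<^sup>2 + s'\<^sup>2)"
proof -
  have "h (x $ 3) \<noteq> 0" "J (planar x - a t) \<noteq> 0" using assms(1) by (auto simp: moving_source_def)
  then have b: "norm (planar x - a t) < s" "\<bar>x $ 3\<bar> \<le> s'"
    using assms(3)[of "planar x - a t"] assms(4)[of "x $ 3"] by (auto simp flip: not_le)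
  \<comment> \<open>The orbit point placed in the plane of height 0. Relative to it, Pythagoras
    combines the planar radius s with the half-height \<open>s'\<close>.\<close>
  define e where "e = join (a t, 0)"
  have pe: "planar e = a t" "e $ 3 = 0" by (simp_all add: e_def join_def planar_def vec_eq_iff forall_2)
  have pd: "planar (x - e) = planar x - planar e" by (simp add: planar_def vec_eq_iff forall_2)
  have "norm x \<le> norm e + norm (x - e)" using norm_triangle_ineq[of e "x - e"] by simp
  also have "norm e = norm (a t)" by (subst norm_planar) (simp add: pe)
  also have "norm (x - e) = sqrt ((norm (planar x - a t))\<^sup>2 + (x $ 3)\<^sup>2)"
    by (subst norm_planar) (simp add: pd pe)
  also have "\<dots> \<le> sqrt (s\<^sup>2 + s'\<^sup>2)"
    using b power_mono[of "norm (planar x - a t)" s 2] abs_le_square_iff[of "x $ 3" s']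
    by (intro real_sqrt_le_mono add_mono) auto
  finally show ?thesis using assms(2) by simp
qed

text \<open>On the support of the source the wave is \<open>exp (l * t) * exp (v \<bullet> planar x) * exp (c * x $ 3)\<close>, so
  the pairing factorizes.\<close>

lemma ip_moving_source_wave:
  fixes J :: "real^2 \<Rightarrow> real^3"
  assumes J: "continuous_on UNIV J" "\<And>y. norm y \<ge> s \<Longrightarrow> J y = 0"
    and h: "continuous_on UNIV h" "\<And>z. \<bar>z\<bar> \<ge> s \<Longrightarrow> h z = 0"
    and supp: "\<And>x. moving_source J h g a t x \<noteq> 0 \<Longrightarrow> \<eta> x = 1 \<and> t + x \<bullet> d \<le> c'"
    and k: "\<And>s. s \<le> c' \<Longrightarrow> k s = exp (l * s)"
    and l: "l *\<^sub>R d = vector [v $ 1, v $ 2, c]"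
  shows "ip (moving_source J h g a t) (\<lambda>x. wave \<eta> k d t x *\<^sub>R p)
       = g t * exp (l * t) * exp (v \<bullet> a t) * (LBINT y. (J y \<bullet> p) * exp (v \<bullet> y)) * (LBINT z. h z * exp (c * z))"
proof -
  define P where "P y = (J (y - a t) \<bullet> p) * exp (v \<bullet> y)" for y
  define Q where "Q z = h z * exp (c * z)" for z
  have J0: "J (y - a t) = 0" if "norm y > s + norm (a t)" for y
    using norm_triangle_ineq2[of y "a t"] that by (intro J(2)) linarith
  have Pi: "integrable lborel P"
    unfolding P_def
    by (rule continuous_bounded_support_integrable[where r = "s + norm (a t)"])
       (use J0 in \<open>auto intro!: continuous_intros continuous_on_compose2[OF J(1)]\<close>)
  have Qi: "integrable lborel Q"
    unfolding Q_def
    by (rule continuous_bounded_support_integrable[where r = s])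
       (use h in \<open>auto intro!: continuous_intros\<close>)
  have pt: "moving_source J h g a t x \<bullet> (wave \<eta> k d t x *\<^sub>R p) = (g t * exp (l * t)) * (P (planar x) * Q (x $ 3))" for x
  proof (cases "moving_source J h g a t x = 0")
    case True
    then have "h (x $ 3) = 0 \<or> g t = 0 \<or> J (planar x - a t) = 0" by (simp add: moving_source_def)
    then show ?thesis using True by (auto simp: P_def Q_def)
  next
    case False
    have "l * (x \<bullet> d) = x \<bullet> (l *\<^sub>R d)" by simp
    also have "\<dots> = v \<bullet> planar x + c * (x $ 3)"
      unfolding l by (simp add: inner_vec_def planar_def sum_3 sum_2 mult.commute)
    finally have e: "exp (l * (t + x \<bullet> d)) = exp (l * t) * (exp (v \<bullet> planar x) * exp (c * (x $ 3)))"
      by (simp add: distrib_left exp_add)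
    show ?thesis using supp[OF False] k e
      by (simp add: wave_def moving_source_def P_def Q_def mult_ac)
  qed
  have "(LBINT y. P y) = (LBINT y. P (y + a t))"
    using integral_translate[of P "a t"] Pi by simp
  also have "\<dots> = (LBINT y. exp (v \<bullet> a t) * ((J y \<bullet> p) * exp (v \<bullet> y)))"
    by (simp add: P_def inner_add_right exp_add mult_ac)
  finally have "(LBINT y. P y) = exp (v \<bullet> a t) * (LBINT y. (J y \<bullet> p) * exp (v \<bullet> y))" by simp
  then show ?thesis
    unfolding ip_def pt using integral_planar[OF Pi Qi] by (simp add: Q_def)
qed

lemma LINT_eq_integral:
  fixes f :: "real \<Rightarrow> real"
  assumes "continuous_on UNIV f" "\<And>x. \<bar>x\<bar> > s \<Longrightarrow> f x = 0"
  shows "(LBINT x. f x) = integral {-s..s} f"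
proof -
  have "integrable lborel f" by (rule continuous_bounded_support_integrable[of f s]) (use assms in auto)
  then have "(f has_integral (LBINT x. f x)) UNIV" by (rule has_integral_integral_lborel)
  moreover have "(f has_integral integral {-s..s} f) UNIV"
    by (rule has_integral_on_superset[OF integrable_integral[OF integrable_continuous_real]])
       (use assms in \<open>auto intro: continuous_on_subset\<close>)
  ultimately show ?thesis by (rule has_integral_unique)
qed

text \<open>Integration by parts against the exponential: the divergence of J turns into the inner
  product of v with the transform of J.\<close>

lemma divergence_free_Laplace:
  fixes J :: "real^2 \<Rightarrow> real^3"
  assumes J: "continuous_on UNIV J" "\<And>y. norm y \<ge> s \<Longrightarrow> J y = 0" and s: "s > 0"
    and H: "\<And>i. Hk 2 (\<lambda>y. J y $ i)" and div: "AE y in lborel. div2 J y = 0"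
  shows "v $ 1 * (LBINT y. J y $ 1 * exp (v \<bullet> y)) + v $ 2 * (LBINT y. J y $ 2 * exp (v \<bullet> y)) = 0"
proof -
  obtain \<eta> :: "real^2 \<Rightarrow> real" where \<eta>: "test_function \<eta>" "\<And>y. norm y < s + 1 \<Longrightarrow> \<eta> y = 1"
    using cutoff_exists[of "s + 1"] s by auto
  \<comment> \<open>With unit rate and time 0 the wave in direction v is
    \<open>exp (v \<bullet> y)\<close> times the cutoff, a test function that agrees with the
    exponential on the support of J.\<close>
  define k where "k = (\<lambda>n s. (1::real) ^ n * exp (1 * s))"
  have k: "smooth_seq k" unfolding k_def by (rule smooth_seq_exp)
  define \<phi> where "\<phi> = wave \<eta> (k 0) v 0"
  have t: "test_function \<phi>" unfolding \<phi>_def by (rule test_function_wave[OF \<eta>(1) k])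
  have ax: "axis i 1 \<in> (Basis :: (real^2) set)" for i by (simp add: axis_in_Basis_iff)
  have pt: "J y $ j * partial (axis i 1) \<phi> y = v $ i * (J y $ j * exp (v \<bullet> y))" for i j y
  proof (cases "norm y \<ge> s")
    case False
    then have "grad \<phi> y = exp (v \<bullet> y) *\<^sub>R v"
      unfolding \<phi>_def using grad_wave[OF \<eta>(1) k \<eta>(2), where x = y and n = 0 and d = v and t = 0] \<eta>(2)[of y]
      by (simp add: wave_def k_def inner_commute)
    then have "partial (axis i 1) \<phi> y = exp (v \<bullet> y) * v $ i"
      using grad_inner[OF ax, of \<phi> y i] by (simp add: inner_axis)
    then show ?thesis by (simp add: mult_ac)
  qed (simp add: J(2))
  define W where "W i j = weak_partial (axis i 1) (\<lambda>y. J y $ j)" for i :: 2 and j :: 3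
  have W: "has_weak_partial (axis i 1) (\<lambda>y. J y $ j) (W i j)" for i j
    unfolding W_def using Hk_weak_partial(1)[of 1 "\<lambda>y. J y $ j" "axis i 1"] H[of j] ax by (simp add: numeral_2_eq_2)
  have wi: "integrable lborel (\<lambda>y. W i j y * \<phi> y)" for i j
    using W[of i j] by (intro locally_integrable_mult_test t) (simp add: has_weak_partial_def)
  have "(LBINT y. J y $ j * partial (axis i 1) \<phi> y) = - (LBINT y. W i j y * \<phi> y)" for i j
    using W[of i j] t unfolding has_weak_partial_def by blast
  then have "v $ i * (LBINT y. J y $ j * exp (v \<bullet> y)) = - (LBINT y. W i j y * \<phi> y)" for i j
    by (simp add: pt)
  then have "v $ 1 * (LBINT y. J y $ 1 * exp (v \<bullet> y)) + v $ 2 * (LBINT y. J y $ 2 * exp (v \<bullet> y))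
      = - (LBINT y. W 1 1 y * \<phi> y + W 2 2 y * \<phi> y)"
    using wi by simp
  also have "(LBINT y. W 1 1 y * \<phi> y + W 2 2 y * \<phi> y) = (LINT y|(lborel :: (real^2) measure). 0)"
  proof (rule integral_cong_AE)
    show "AE y in lborel. W 1 1 y * \<phi> y + W 2 2 y * \<phi> y = 0"
      using div by eventually_elim (simp add: div2_def W_def distrib_right[symmetric])
    show "(\<lambda>y. W 1 1 y * \<phi> y + W 2 2 y * \<phi> y) \<in> borel_measurable lborel"
      using wi[of 1 1] wi[of 2 2] by (intro borel_measurable_add borel_measurable_integrable)
  qed simp
  finally show ?thesis by simp
qed

theorem theorem4p5:
  fixes Rh R\<^sub>1 T\<^sub>0 R T :: real
    and J :: "real^2 \<Rightarrow> real^3"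
    and h g :: "real \<Rightarrow> real"
    and a b :: "real \<Rightarrow> real^2"
    and E\<^sub>1 E\<^sub>2 :: "real \<Rightarrow> real^3 \<Rightarrow> real^3"
  assumes "Rh > 0" and "R\<^sub>1 > 0" and "T\<^sub>0 > 0"
    and "R > Rh + R\<^sub>1"
    and "T = T\<^sub>0 + R + Rh + R\<^sub>1"
    and J_plane: "\<And>y. J y $ 3 = 0"
    and J_H2: "\<And>i. Hk 2 (\<lambda>y. J y $ i)"
    and J_cont: "continuous_on UNIV J"
    and J_supp: "fsupp J \<subseteq> {y. norm y < sqrt 2 / 2 * Rh}"
    and J_div: "AE y in lborel. div2 J y = 0"
    and J_A: "class_A J"
    and h_H2: "Hk 2 h"
    and h_cont: "continuous_on UNIV h"
    and h_nonzero: "\<exists>s. h s \<noteq> 0"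
    and h_supp: "fsupp h \<subseteq> {- (sqrt 2 / 2 * Rh) <..< sqrt 2 / 2 * Rh}"
    and g_C1: "C1_within {0..} g"
    and g_zero: "\<And>t. t \<ge> T\<^sub>0 \<or> t \<le> 0 \<Longrightarrow> g t = 0"
    and g_supp: "fsupp g = {0..T\<^sub>0}"
    and a_C1: "C1_within {0..T\<^sub>0} a"
    and b_C1: "C1_within {0..T\<^sub>0} b"
    and a_bound: "\<And>t. t \<in> {0..T\<^sub>0} \<Longrightarrow> norm (a t) \<le> R\<^sub>1"
    and b_bound: "\<And>t. t \<in> {0..T\<^sub>0} \<Longrightarrow> norm (b t) \<le> R\<^sub>1"
    and E\<^sub>1: "maxwell_solution (moving_source J h g a) E\<^sub>1"
    and E\<^sub>2: "maxwell_solution (moving_source J h g b) E\<^sub>2"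
    and data: "\<And>x t. x \<in> sphere 0 R \<Longrightarrow> t \<in> {0<..<T} \<Longrightarrow>
                 cross3 (E\<^sub>1 t x) (x /\<^sub>R R) = cross3 (E\<^sub>2 t x) (x /\<^sub>R R)"
  shows "\<forall>t\<in>{0..T\<^sub>0}. a t = b t"
proof -

  \<comment> \<open>Geometry of the source\<close>
  note pos = \<open>Rh > 0\<close> \<open>R\<^sub>1 > 0\<close> \<open>T\<^sub>0 > 0\<close> \<open>R > Rh + R\<^sub>1\<close> and T = \<open>T = T\<^sub>0 + R + Rh + R\<^sub>1\<close>
  define s where "s = sqrt 2 / 2 * Rh"
  have s: "s > 0" using pos by (simp add: s_def)
  have s2: "s\<^sup>2 + s\<^sup>2 = Rh\<^sup>2" by (simp add: s_def power_mult_distrib power_divide)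
  have J0: "J y = 0" if "norm y \<ge> s" for y
    using J_supp fsuppI[of J y] that by (cases "J y = 0") (auto simp: s_def)
  have hsub: "fsupp h \<subseteq> {-s<..<s}" using h_supp by (simp add: s_def)
  \<comment> \<open>Compactness provides an attained height \<open>s'\<close> that is strictly less
    than s. Hence \<rho> is strictly less than Rh, which leaves room to cut off the exponential
    profile.\<close>
  have "compact (fsupp h)"
    using bounded_subset[OF bounded_box hsub[folded box_real(1)]] by (simp add: compact_eq_bounded_closed fsupp_def)
  moreover have "fsupp h \<noteq> {}" using h_nonzero fsuppI by fastforce
  moreover have "continuous_on (fsupp h) (\<lambda>z. \<bar>z\<bar>)" by (intro continuous_intros)
  ultimately obtain z0 where z0: "z0 \<in> fsupp h" "\<And>z. z \<in> fsupp h \<Longrightarrow> \<bar>z\<bar> \<le> \<bar>z0\<bar>"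
    using continuous_attains_sup[of "fsupp h" "\<lambda>z. \<bar>z\<bar>"] by blast
  define s' where "s' = \<bar>z0\<bar>"
  have s': "0 \<le> s'" "s' < s" using subsetD[OF hsub z0(1)] by (auto simp: s'_def)
  have h0': "h z = 0" if "\<bar>z\<bar> > s'" for z
    using z0(2)[OF fsuppI[of h z]] that by (cases "h z = 0") (auto simp: s'_def)
  have h0: "h z = 0" if "\<bar>z\<bar> \<ge> s" for z using h0'[of z] that s' by auto
  define \<rho> where "\<rho> = sqrt (s\<^sup>2 + s'\<^sup>2)"
  have \<rho>: "\<rho> < Rh"
  proof -
    have "s'\<^sup>2 < s\<^sup>2" using s' by (intro power_strict_mono) auto
    then have "\<rho> < sqrt (Rh\<^sup>2)" unfolding \<rho>_def using s2 by (intro real_sqrt_less_mono) simp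
    then show ?thesis using pos by simp
  qed
  have g_range: "0 < t" "t < T\<^sub>0" if "g t \<noteq> 0" for t
    using g_zero[of t] that by (auto simp flip: not_le)
  define F where "F t x = moving_source J h g a t x - moving_source J h g b t x" for t x
  have supp: "norm x \<le> R\<^sub>1 + \<rho>" "t < T\<^sub>0"
    if "moving_source J h g w t x \<noteq> 0" "\<And>t. t \<in> {0..T\<^sub>0} \<Longrightarrow> norm (w t) \<le> R\<^sub>1" for w t x
  proof -
    have "g t \<noteq> 0" using that(1) by (auto simp: moving_source_def)
    from g_range[OF this] show "t < T\<^sub>0" "norm x \<le> R\<^sub>1 + \<rho>"
      unfolding \<rho>_def using that by (auto intro!: moving_source_support[OF that(1) _ J0 h0'])
  qed
  have LM: "L2v (moving_source J h g w t)" for w t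
    by (rule moving_source_L2v[OF J_cont J0 h_cont h0])
  have Tp: "T > 0" and Rp: "R > 0" using pos T by auto

  \<comment> \<open>Orthogonality of the source difference to plane waves\<close>
  obtain E\<^sub>1' E\<^sub>1'' B\<^sub>1 C\<^sub>1 where 1: "maxwell_weak T (moving_source J h g a) E\<^sub>1 E\<^sub>1' E\<^sub>1'' B\<^sub>1 C\<^sub>1"
    by (rule maxwell_solution_weak[OF E\<^sub>1 LM Tp])
  obtain E\<^sub>2' E\<^sub>2'' B\<^sub>2 C\<^sub>2 where 2: "maxwell_weak T (moving_source J h g b) E\<^sub>2 E\<^sub>2' E\<^sub>2'' B\<^sub>2 C\<^sub>2"
    by (rule maxwell_solution_weak[OF E\<^sub>2 LM Tp])
  obtain \<eta> :: "real^3 \<Rightarrow> real" where \<eta>: "test_function \<eta>" "\<And>x. norm x < R + 1 \<Longrightarrow> \<eta> x = 1"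
    using cutoff_exists[of "R + 1"] Rp by auto
  have ortho: "((\<lambda>t. ip (F t) (\<lambda>x. wave \<eta> (k 0) d t x *\<^sub>R p)) has_integral 0) {0..T}"
    if k: "smooth_seq k" "\<And>s. s \<ge> T - R \<Longrightarrow> k 0 s = 0" "\<And>s. s \<ge> T - R \<Longrightarrow> k 1 s = 0"
      and d: "norm d = 1" and p: "p \<bullet> d = 0" for k d p
  proof (rule source_orthogonal_to_waves[OF Tp Rp maxwell_weak_diff[OF 1 2, folded F_def], where r = "R + 1"])
    show "L2v (F t)" for t unfolding F_def by (intro L2v_diff LM)
    show "F t x = 0" if "norm x > R" for t x
    proof -
      have "\<not> norm x \<le> R\<^sub>1 + \<rho>" using that \<rho> pos by linarith
      then show ?thesis using supp(1)[of a t x] supp(1)[of b t x] a_bound b_bound by (force simp: F_def)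
    qed
    show "cross3 (E\<^sub>1 t x - E\<^sub>2 t x) x = 0" if "0 < t" "t < T" "norm x = R" for t x
      using data[of x t] that Rp by (simp add: Cross3.left_diff_distrib cross_mult_right)
  qed (use k d p \<eta> in auto)
  have ga: "continuous_on {0..T\<^sub>0} g" "continuous_on {0..T\<^sub>0} a" "continuous_on {0..T\<^sub>0} b"
  proof -
    have C1: "continuous_on S f" if "C1_within S f" for S and f :: "real \<Rightarrow> 'z::real_normed_vector"
      using that unfolding C1_within_def
      by (metis continuous_on_eq_continuous_within has_vector_derivative_continuous)
    show "continuous_on {0..T\<^sub>0} a" "continuous_on {0..T\<^sub>0} b" using C1 a_C1 b_C1 by auto
    show "continuous_on {0..T\<^sub>0} g" by (rule continuous_on_subset[OF C1[OF g_C1]]) auto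
  qed

  \<comment> \<open>Factorization of the pairing into transforms\<close>
  define Jh where "Jh i v = (LBINT y. J y $ i * exp (v \<bullet> y))" for i v
  define Hh where "Hh c = (LBINT z. h z * exp (c * z))" for c
  have Jc: "continuous_on UNIV (\<lambda>y. J y $ i)" for i by (intro continuous_intros J_cont)
  have Ji: "integrable lborel (\<lambda>y. J y $ i * exp (v \<bullet> y))" for i v
    by (rule continuous_bounded_support_integrable[where r = s])
       (use J0 in \<open>auto intro!: continuous_intros J_cont\<close>)
  have main: "integral {0..T\<^sub>0} (\<lambda>t. g t * (exp (v \<bullet> a t) - exp (v \<bullet> b t)) * exp (l * t)) * ((v $ 1 * Jh 2 v - v $ 2 * Jh 1 v) * Hh c) = 0"
    if l: "l > 0" "l\<^sup>2 = v \<bullet> v + c\<^sup>2" for l v c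
  proof -
    define d :: "real^3" where "d = inverse l *\<^sub>R vector [v $ 1, v $ 2, c]"
    define p :: "real^3" where "p = vector [- (v $ 2), v $ 1, 0]"
    \<comment> \<open>An upper bound for the phase \<open>t + x \<bullet> d\<close> on the source;
      up to this value the profile has to be the exponential.\<close>
    define c' where "c' = T\<^sub>0 + R\<^sub>1 + \<rho>"
    have "c' < T - R" using \<rho> T by (simp add: c'_def)
    then obtain k where k: "smooth_seq k" "\<And>s. s \<le> c' \<Longrightarrow> k 0 s = exp (l * s)"
      "\<And>s. s \<ge> T - R \<Longrightarrow> k 0 s = 0" "\<And>s. s \<ge> T - R \<Longrightarrow> k 1 s = 0"
      by (rule profile_exists[where l = l]) blast
    have ld: "l *\<^sub>R d = vector [v $ 1, v $ 2, c]" using l by (simp add: d_def)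
    have "(norm (l *\<^sub>R d))\<^sup>2 = l\<^sup>2"
      unfolding ld l(2) power2_norm_eq_inner by (simp add: inner_vec_def sum_3 sum_2 power2_eq_square)
    then have d1: "norm d = 1" using l(1) by (simp add: power_mult_distrib abs_square_eq_1)
    have pd: "p \<bullet> d = 0" by (simp add: p_def d_def inner_vec_def sum_3)
    have Jp: "(LBINT y. (J y \<bullet> p) * exp (v \<bullet> y)) = v $ 1 * Jh 2 v - v $ 2 * Jh 1 v"
    proof -
      have "(LBINT y. (J y \<bullet> p) * exp (v \<bullet> y))
          = (LBINT y. v $ 1 * (J y $ 2 * exp (v \<bullet> y)) - v $ 2 * (J y $ 1 * exp (v \<bullet> y)))"
        by (rule Bochner_Integration.integral_cong) (simp_all add: p_def inner_vec_def[of "J _"] sum_3 algebra_simps)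
      then show ?thesis by (simp add: Ji Jh_def)
    qed
    define M where "M = (v $ 1 * Jh 2 v - v $ 2 * Jh 1 v) * Hh c"
    define w where "w t = g t * (exp (v \<bullet> a t) - exp (v \<bullet> b t)) * exp (l * t)" for t
    have ipw: "ip (moving_source J h g f t) (\<lambda>x. wave \<eta> (k 0) d t x *\<^sub>R p) = g t * exp (l * t) * exp (v \<bullet> f t) * M"
      if f: "\<And>t. t \<in> {0..T\<^sub>0} \<Longrightarrow> norm (f t) \<le> R\<^sub>1" for f t
    proof -
      have "ip (moving_source J h g f t) (\<lambda>x. wave \<eta> (k 0) d t x *\<^sub>R p) = g t * exp (l * t) * exp (v \<bullet> f t)
          * (LBINT y. (J y \<bullet> p) * exp (v \<bullet> y)) * (LBINT z. h z * exp (c * z))"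
      proof (rule ip_moving_source_wave[OF J_cont J0 h_cont h0 _ k(2) ld])
        fix x assume x: "moving_source J h g f t x \<noteq> 0"
        have n: "norm x \<le> R\<^sub>1 + \<rho>" "t < T\<^sub>0" using supp[OF x f] by auto
        have "x \<bullet> d \<le> norm x" using norm_cauchy_schwarz[of x d] d1 by simp
        then show "\<eta> x = 1 \<and> t + x \<bullet> d \<le> c'"
          using n \<rho> pos \<eta>(2)[of x] by (auto simp: c'_def)
      qed
      then show ?thesis by (simp add: Jp M_def Hh_def)
    qed
    have "ip (F t) (\<lambda>x. wave \<eta> (k 0) d t x *\<^sub>R p) = w t * M" for t
    proof -
      have "L2v (\<lambda>x. wave \<eta> (k 0) d t x *\<^sub>R p)"
        by (rule L2v_bound[OF _ test_function_L2v[OF test_function_wave[OF \<eta>(1) k(1)]], of _ "norm p"])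
           (use test_function_measurable[OF test_function_wave[OF \<eta>(1) k(1)]] in \<open>auto simp: mult.commute\<close>)
      then have "ip (F t) (\<lambda>x. wave \<eta> (k 0) d t x *\<^sub>R p)
          = ip (moving_source J h g a t) (\<lambda>x. wave \<eta> (k 0) d t x *\<^sub>R p)
            - ip (moving_source J h g b t) (\<lambda>x. wave \<eta> (k 0) d t x *\<^sub>R p)"
        unfolding F_def by (intro ip_diff_left LM)
      then show ?thesis using ipw[OF a_bound] ipw[OF b_bound] by (simp add: w_def algebra_simps)
    qed
    then have i0: "((\<lambda>t. w t * M) has_integral 0) {0..T}"
      using ortho[OF k(1,3,4) d1 pd] by simp
    have "continuous_on {0..T\<^sub>0} w" unfolding w_def by (intro continuous_intros ga)
    then have "((\<lambda>t. w t * M) has_integral integral {0..T\<^sub>0} w * M) {0..T\<^sub>0}"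
      by (intro has_integral_mult_left integrable_integral integrable_continuous_real)
    then have "((\<lambda>t. w t * M) has_integral integral {0..T\<^sub>0} w * M) {0..T}"
      by (rule has_integral_on_superset) (use g_zero T pos in \<open>auto simp: w_def\<close>)
    from has_integral_unique[OF this i0] show ?thesis by (simp add: w_def[abs_def] M_def)
  qed

  \<comment> \<open>An interval on which the transform of h has no zero\<close>
  have hcont: "continuous_on UNIV (\<lambda>z. h z * exp (c * z))" for c by (intro continuous_intros h_cont)
  have "\<exists>c. 0 < c \<and> Hh c \<noteq> 0"
  proof (rule ccontr)
    assume "\<nexists>c. 0 < c \<and> Hh c \<noteq> 0"
    then have "Hh c = 0" if "0 < c" "c < 1" for c using that by blast
    then have "integral {-s..s} (\<lambda>z. h z * exp (c * z)) = 0" if "0 < c" "c < 1" for c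
      using that LINT_eq_integral[OF hcont, of s c] h0 by (simp add: Hh_def)
    then have "h z = 0" if "z \<in> {-s..s}" for z
      using Laplace_unique_interval[of "-s" s h 0 1 z] s that continuous_on_subset[OF h_cont] by auto
    then have "h z = 0" for z using h0[of z] by (cases "z \<in> {-s..s}") auto
    then show False using h_nonzero by blast
  qed
  then obtain c0 where c0: "0 < c0" "Hh c0 \<noteq> 0" by blast
  obtain \<delta> where \<delta>: "\<delta> > 0" "\<And>c. \<bar>c - c0\<bar> < \<delta> \<Longrightarrow> Hh c \<noteq> 0"
  proof -
    have "isCont Hh c0"
      unfolding continuous_at_sequentially
    proof (intro allI impI)
      fix v :: "nat \<Rightarrow> real" assume "v \<longlonglongrightarrow> c0"
      from Laplace_transform_continuous[OF h_cont _ this, of s]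
      show "(Hh \<circ> v) \<longlonglongrightarrow> Hh c0" using h0 by (simp add: Hh_def o_def)
    qed
    then obtain \<delta> where "\<delta> > 0" "\<And>c. dist c0 c < \<delta> \<Longrightarrow> Hh c \<noteq> 0"
      using continuous_at_avoid[of c0 Hh 0] c0(2) by blast
    then show thesis using that by (simp add: dist_real_def abs_minus_commute)
  qed

  \<comment> \<open>Coincidence of the orbits at times where g is nonzero\<close>
  have eq: "a t = b t" if gt: "g t \<noteq> 0" for t
  proof (rule ccontr)
    assume ne: "a t \<noteq> b t"
    define v where "v = a t - b t"
    have v: "v \<bullet> v > 0" using ne by (simp add: v_def)
    have tT: "t \<in> {0..T\<^sub>0}" using g_range[OF gt] by auto
    have perp: "\<xi> $ 1 * Jh 2 \<xi> - \<xi> $ 2 * Jh 1 \<xi> = 0" if \<xi>: "\<xi> \<bullet> v \<noteq> 0" for \<xi>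
    proof (rule ccontr)
      assume nz: "\<xi> $ 1 * Jh 2 \<xi> - \<xi> $ 2 * Jh 1 \<xi> \<noteq> 0"
      have n0: "\<xi> \<bullet> \<xi> \<ge> 0" by simp
      \<comment> \<open>These are the values of l that correspond to \<open>c = c0\<close> and
        \<open>c = c0 + \<delta>\<close>. Each l between them belongs to a c at which the transform
        of h is nonzero.\<close>
      define lo hi where "lo = sqrt (\<xi> \<bullet> \<xi> + c0\<^sup>2)" and "hi = sqrt (\<xi> \<bullet> \<xi> + (c0 + \<delta>)\<^sup>2)"
      have lh: "lo < hi" unfolding lo_def hi_def using c0(1) \<delta>(1)
        by (intro real_sqrt_less_mono add_strict_left_mono power_strict_mono) auto
      have lo0: "lo > 0" using c0(1) n0 by (simp add: lo_def add_nonneg_pos)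
      have "integral {0..T\<^sub>0} (\<lambda>t. g t * (exp (\<xi> \<bullet> a t) - exp (\<xi> \<bullet> b t)) * exp (l * t)) = 0" if l: "lo < l" "l < hi" for l
      proof -
        define c where "c = sqrt (l\<^sup>2 - \<xi> \<bullet> \<xi>)"
        have "lo\<^sup>2 < l\<^sup>2" "l\<^sup>2 < hi\<^sup>2" using l lo0 by (auto intro!: power_strict_mono)
        then have b: "c0\<^sup>2 < l\<^sup>2 - \<xi> \<bullet> \<xi>" "l\<^sup>2 - \<xi> \<bullet> \<xi> < (c0 + \<delta>)\<^sup>2"
          using n0 by (auto simp: lo_def hi_def)
        have "sqrt (c0\<^sup>2) < c" "c < sqrt ((c0 + \<delta>)\<^sup>2)"
          unfolding c_def by (rule real_sqrt_less_mono[OF b(1)], rule real_sqrt_less_mono[OF b(2)])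
        then have "Hh c \<noteq> 0" using c0(1) \<delta>(1) by (intro \<delta>(2)) auto
        moreover have "c\<^sup>2 = l\<^sup>2 - \<xi> \<bullet> \<xi>"
          unfolding c_def using b(1) zero_le_power2[of c0] by (intro real_sqrt_pow2) linarith
        then have "l\<^sup>2 = \<xi> \<bullet> \<xi> + c\<^sup>2" by simp
        ultimately show ?thesis using main[of l \<xi> c] l lo0 nz by simp
      qed
      then have "g t * (exp (\<xi> \<bullet> a t) - exp (\<xi> \<bullet> b t)) = 0"
        by (intro Laplace_unique_interval[OF pos(3) _ lh _ tT, of "\<lambda>t. g t * (exp (\<xi> \<bullet> a t) - exp (\<xi> \<bullet> b t))"])
           (auto intro!: continuous_intros ga)
      then show False using gt \<xi> by (simp add: v_def inner_diff_right)
    qed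
    have off: "Jh i \<xi> = 0" if \<xi>: "\<xi> \<bullet> v \<noteq> 0" and i: "i \<in> {1, 2}" for \<xi> i
    proof -
      have e1: "\<xi> $ 1 * Jh 1 \<xi> + \<xi> $ 2 * Jh 2 \<xi> = 0"
        unfolding Jh_def by (rule divergence_free_Laplace[OF J_cont J0 s J_H2 J_div])
      note e2 = perp[OF \<xi>]
      \<comment> \<open>The two linear equations for the transform of J have the determinant
        \<open>\<xi> \<bullet> \<xi>\<close>, so both components vanish.\<close>
      have n: "\<xi> $ 1 * \<xi> $ 1 + \<xi> $ 2 * \<xi> $ 2 \<noteq> 0"
      proof -
        have "\<xi> \<bullet> \<xi> \<noteq> 0" using \<xi> by auto
        then show ?thesis by (simp add: inner_vec_def sum_2)
      qed
      have "(\<xi> $ 1 * \<xi> $ 1 + \<xi> $ 2 * \<xi> $ 2) * Jh 1 \<xi> = \<xi> $ 1 * (\<xi> $ 1 * Jh 1 \<xi> + \<xi> $ 2 * Jh 2 \<xi>)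
          - \<xi> $ 2 * (\<xi> $ 1 * Jh 2 \<xi> - \<xi> $ 2 * Jh 1 \<xi>)" by (simp add: algebra_simps)
      moreover have "(\<xi> $ 1 * \<xi> $ 1 + \<xi> $ 2 * \<xi> $ 2) * Jh 2 \<xi> = \<xi> $ 2 * (\<xi> $ 1 * Jh 1 \<xi> + \<xi> $ 2 * Jh 2 \<xi>)
          + \<xi> $ 1 * (\<xi> $ 1 * Jh 2 \<xi> - \<xi> $ 2 * Jh 1 \<xi>)" by (simp add: algebra_simps)
      ultimately show ?thesis using n i unfolding e1 e2 by auto
    qed
    have all: "Jh i \<xi> = 0" if i: "i \<in> {1, 2}" for \<xi> i
    proof (cases "\<xi> \<bullet> v = 0")
      case True
      \<comment> \<open>Moving along v leaves the exceptional line
        \<open>\<xi> \<bullet> v = 0\<close>, so every exceptional \<xi> is a limit of directions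
        already treated.\<close>
      define \<xi>n where "\<xi>n n = \<xi> + inverse (real (Suc n)) *\<^sub>R v" for n
      have "\<xi>n \<longlonglongrightarrow> \<xi> + 0 *\<^sub>R v"
        unfolding \<xi>n_def by (intro tendsto_intros LIMSEQ_inverse_real_of_nat)
      then have lim: "(\<lambda>n. Jh i (\<xi>n n)) \<longlonglongrightarrow> Jh i \<xi>"
        unfolding Jh_def by (intro Laplace_transform_continuous[OF Jc, of s]) (auto simp: J0)
      have "\<xi>n n \<bullet> v \<noteq> 0" for n using True v by (simp add: \<xi>n_def inner_add_left del: of_nat_Suc)
      then have "Jh i (\<xi>n n) = 0" for n using off i by blast
      then show ?thesis using lim LIMSEQ_unique[OF lim, of 0] by simp
    qed (use off i in blast)
    have Jz: "J y $ i = 0" if "i \<in> {1, 2}" for i y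
    proof (rule Laplace_unique[OF Jc, of s])
      show "J y $ i = 0" if "norm y > s" for y using J0[of y] that by simp
      show "(LBINT y. J y $ i * exp (w \<bullet> y)) = 0" for w
        using all[OF \<open>i \<in> {1, 2}\<close>, of w] by (simp add: Jh_def)
    qed
    obtain i where i: "i \<in> {1, 2}" "\<And>y. y \<noteq> 0 \<Longrightarrow> J 0 $ i > J y $ i" using J_A by (auto simp: class_A_def)
    then show False using i(2)[of "axis 1 1"] Jz[OF i(1)] by (simp add: axis_eq_0_iff)
  qed
  \<comment> \<open>Coincidence is a closed condition, so it passes from the set where g is nonzero
    to its closure, the whole interval; this includes zeros of g inside it and the
    endpoints.\<close>
  have "closed {t \<in> {0..T\<^sub>0}. a t - b t = 0}"
    by (intro continuous_closed_preimage_constant continuous_on_diff ga) simp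
  moreover have "{t. g t \<noteq> 0} \<subseteq> {t \<in> {0..T\<^sub>0}. a t - b t = 0}"
  proof
    fix t assume "t \<in> {t. g t \<noteq> 0}"
    then have "g t \<noteq> 0" by simp
    from g_range[OF this] eq[OF this] show "t \<in> {t \<in> {0..T\<^sub>0}. a t - b t = 0}" by simp
  qed
  ultimately have "fsupp g \<subseteq> {t \<in> {0..T\<^sub>0}. a t - b t = 0}"
    unfolding fsupp_def by (intro closure_minimal)
  then show ?thesis unfolding g_supp by auto
qed

end
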